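(* Let $A \subseteq \mathbb{N}_{\geq 2}$ be a non-empty set of integers. Then the set of finite presentations of $A$-torsion-free groups is $\Pi^{0}_{2}$-hard. Moreover, if $A$ is recursively enumerable, then this set of finite presentations is $\Pi^{0}_{2}$-complete.
   Context: For a group $G$ and set of integers $A$, $G$ is $A$-torsion-free if there is no $g \neq e$ in $G$ with $g^{n} = e$ for some $n \in A$. $\Pi^{0}_{2}$ refers to the corresponding level of Kleene's arithmetic hierarchy; hardness and completeness are with respect to many-one reductions, with finite presentations coded as natural numbers in a standard way. *)

theory Defs
  imports Main "HOL-Library.Nat_Bijection"
begin

datatype recf = Zero | Succ | Proj nat | Comp recf "recf list" | Prim recf recf | Mu recf

inductive eval :: "recf \<Rightarrow> nat list \<Rightarrow> nat \<Rightarrow> bool" where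
  eval_Zero: "eval Zero xs 0"
| eval_Succ: "eval Succ (x # xs) (Suc x)"
| eval_Proj: "i < length xs \<Longrightarrow> eval (Proj i) xs (xs ! i)"
| eval_Comp: "list_all2 (\<lambda>g y. eval g xs y) gs ys \<Longrightarrow> eval f ys z \<Longrightarrow> eval (Comp f gs) xs z"
| eval_Prim0: "eval f xs y \<Longrightarrow> eval (Prim f g) (0 # xs) y"
| eval_PrimS: "eval (Prim f g) (n # xs) y \<Longrightarrow> eval g (n # y # xs) z \<Longrightarrow> eval (Prim f g) (Suc n # xs) z"
| eval_Mu: "eval f (n # xs) 0 \<Longrightarrow> (\<forall>m<n. \<exists>v. eval f (m # xs) v \<and> 0 < v) \<Longrightarrow> eval (Mu f) xs n"

definition computable :: "(nat \<Rightarrow> nat) \<Rightarrow> bool" where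
  "computable h \<longleftrightarrow> (\<exists>p. \<forall>x. eval p [x] (h x))"

definition r_e :: "nat set \<Rightarrow> bool" where
  "r_e S \<longleftrightarrow> (\<exists>p. \<forall>x. x \<in> S \<longleftrightarrow> (\<exists>v. eval p [x] v))"

definition Pi02 :: "nat set \<Rightarrow> bool" where
  "Pi02 S \<longleftrightarrow> (\<exists>p. (\<forall>x y z. \<exists>v. eval p [x, y, z] v) \<and>
                    (\<forall>x. x \<in> S \<longleftrightarrow> (\<forall>y. \<exists>z. eval p [x, y, z] 0)))"

definition many_one_reducible :: "nat set \<Rightarrow> nat set \<Rightarrow> bool" where
  "many_one_reducible X Y \<longleftrightarrow> (\<exists>h. computable h \<and> (\<forall>x. x \<in> X \<longleftrightarrow> h x \<in> Y))"

definition Pi02_hard :: "nat set \<Rightarrow> bool" where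
  "Pi02_hard Y \<longleftrightarrow> (\<forall>X. Pi02 X \<longrightarrow> many_one_reducible X Y)"

definition Pi02_complete :: "nat set \<Rightarrow> bool" where
  "Pi02_complete Y \<longleftrightarrow> Pi02 Y \<and> Pi02_hard Y"

text \<open>A finite presentation is a pair (n, R): generators x_1..x_n, and relators R, each a word.
  A word is a list of nonzero integers; i stands for x_i and -i for x_i^{-1}.\<close>

definition valid_word :: "nat \<Rightarrow> int list \<Rightarrow> bool" where
  "valid_word n w \<longleftrightarrow> (\<forall>a\<in>set w. a \<noteq> 0 \<and> \<bar>a\<bar> \<le> int n)"

definition valid_pres :: "nat \<Rightarrow> int list list \<Rightarrow> bool" where
  "valid_pres n R \<longleftrightarrow> (\<forall>r\<in>set R. valid_word n r)"

text \<open>Equality in the presented group: the congruence on words generated by free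
  cancellation and by the relators (i.e. w ~ v iff w v^{-1} lies in the normal closure of R
  in the free group).\<close>
inductive word_eq :: "int list list \<Rightarrow> int list \<Rightarrow> int list \<Rightarrow> bool" for R where
  we_refl: "word_eq R w w"
| we_sym: "word_eq R w v \<Longrightarrow> word_eq R v w"
| we_trans: "word_eq R u v \<Longrightarrow> word_eq R v w \<Longrightarrow> word_eq R u w"
| we_cancel: "word_eq R (u @ [a, -a] @ v) (u @ v)"
| we_rel: "r \<in> set R \<Longrightarrow> word_eq R (u @ r @ v) (u @ v)"

definition A_torsion_free_pres :: "nat set \<Rightarrow> nat \<Rightarrow> int list list \<Rightarrow> bool" where
  "A_torsion_free_pres A n R \<longleftrightarrow>
     (\<forall>w k. valid_word n w \<longrightarrow> k \<in> A \<longrightarrow> word_eq R (concat (replicate k w)) [] \<longrightarrow> word_eq R w [])"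

definition code_pres :: "nat \<Rightarrow> int list list \<Rightarrow> nat" where
  "code_pres n R = prod_encode (n, list_encode (map (\<lambda>r. list_encode (map int_encode r)) R))"

definition tf_presentations :: "nat set \<Rightarrow> nat set" where
  "tf_presentations A = {code_pres n R | n R. valid_pres n R \<and> A_torsion_free_pres A n R}"

end

theory Submission
  imports Defs "HOL-Computational_Algebra.Primes" "HOL-Library.Infinite_Set"
begin

text \<open>Hardness. A \<open>\<Pi>\<^sup>0\<^sub>2\<close> set is \<open>{x. \<forall>y. \<exists>z. f x y z = 0}\<close> with \<open>f\<close> primitive recursive. A loop program
  that searches \<open>z\<close> is simulated by finitely many affine rules \<open>m z + j \<mapsto> a z + b\<close> on the integers, such that
  every integer reaches a halting value iff \<open>x\<close> lies in the set. In the free group on \<open>x, t\<close>, put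
  \<open>t_i = x\<^sup>i t x\<^sup>-\<^sup>i\<close>. Stable letters conjugating \<open>x\<^sup>m, t_j\<close> to \<open>x\<^sup>a, t_b\<close> generate together with the
  halting \<open>t_s\<close> a subgroup \<open>L\<close> that contains \<open>t_i\<close> exactly if \<open>i\<close> reaches a halting value. A further stable
  letter \<open>k\<close> centralizes \<open>L\<close>. If also \<open>[k\<^sup>n, t_i] = 1\<close> and \<open>[k, t_i k t_i\<^sup>-\<^sup>1] = 1\<close>, then
  \<open>k\<^sup>-\<^sup>1 t_i k t_i\<^sup>-\<^sup>1\<close> has order dividing \<open>n\<close>, and it is trivial iff \<open>t_i\<close> lies in \<open>L\<close>.

  Each of these two families of relations alone holds in a torsion-free finitely presented group, where a
  letter commuting with \<open>k\<close> shifts the \<open>t_i\<close>. That letter must not act on the group above: it would make the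
  torsion elements conjugate to each other. A stable letter conjugating \<open>g\<close> to \<open>g g'\<close>, with \<open>g\<close> in the
  torsion-free group and \<open>g'\<close> the corresponding element of the commuting group above, transfers the relations
  but not the shift. If every \<open>i\<close> reaches a halting value, the transferred relations are redundant, so that the
  group is an iterated HNN extension and is torsion-free.\<close>


section \<open>Words, relators and permutations\<close>

text \<open>The universal quantifier of a \<open>Pi02\<close> condition becomes the quantifier over
  all integers i, and every integer codes a configuration. So the simulated program must halt from
  arbitrary configurations, not just initial ones: stores are read off as prime multiplicities,
  which makes every nonzero integer a store, and zeros of f are first made to recur for arbitrarily
  large z, because a search may start beyond the least one. Group relations also apply the rules
  backwards; this is harmless since a deterministic step neither creates nor destroys halting.

  If some i never halts, the transferred relations are not redundant, and the two transferring
  letters need not give an HNN extension. Adding both families for all i to the group of x, t, k and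
  the rule letters makes them redundant again, so this infinitely presented quotient embeds in its
  own tower, and the finitely presented group maps to that tower. In the quotient, k acts as a
  counter modulo n at the coset L, which shows that \<open>k^-1 t_i k t_i^-1\<close> is nontrivial.
  That t_i lies outside L is seen after mapping the free group to Z wr Z, where supports of
  functions decide membership.\<close>

inductive weq :: "int list set \<Rightarrow> int list \<Rightarrow> int list \<Rightarrow> bool" for R where
  weq_refl: "weq R w w"
| weq_sym: "weq R w v \<Longrightarrow> weq R v w"
| weq_trans: "weq R u v \<Longrightarrow> weq R v w \<Longrightarrow> weq R u w"
| weq_cancel: "weq R (u @ [a, -a] @ v) (u @ v)"
| weq_rel: "r \<in> R \<Longrightarrow> weq R (u @ r @ v) (u @ v)"

lemma word_eq_iff_weq: "word_eq R u v \<longleftrightarrow> weq (set R) u v"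
proof
  show "word_eq R u v \<Longrightarrow> weq (set R) u v"
    by (induction rule: word_eq.induct) (blast intro: weq.intros)+
  show "weq (set R) u v \<Longrightarrow> word_eq R u v"
    by (induction rule: weq.induct) (blast intro: word_eq.intros)+
qed

definition winv :: "int list \<Rightarrow> int list" where
  "winv w = map uminus (rev w)"

lemma winv_simps [simp]: "winv [] = []" "winv (a # w) = winv w @ [-a]" "winv (u @ v) = winv v @ winv u"
  "winv (winv w) = w"
  by (simp_all add: winv_def rev_map)

lemma weq_append: "weq R u v \<Longrightarrow> weq R (p @ u @ q) (p @ v @ q)"
proof (induction rule: weq.induct)
  case (weq_cancel u a v)
  then show ?case using weq.weq_cancel[of R "p @ u" a "v @ q"] by simp
next
  case (weq_rel r u v)
  then show ?case using weq.weq_rel[of r R "p @ u" "v @ q"] by simp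
qed (blast intro: weq_refl weq_sym weq_trans)+

text \<open>A presentation is a value, so its group cannot be a type of its own. Presented groups
  are therefore realized inside permutation groups of a fixed type, which makes the algebra of
  \<open>group_add\<close> (additive notation, not commutative) available for all of them.\<close>

typedef 'a sym = "{f :: 'a \<Rightarrow> 'a. bij f}"
  by (rule exI[of _ id]) simp

setup_lifting type_definition_sym

instantiation sym :: (type) group_add
begin

lift_definition zero_sym :: "'a sym" is id by simp
lift_definition plus_sym :: "'a sym \<Rightarrow> 'a sym \<Rightarrow> 'a sym" is "(\<circ>)" by (rule bij_comp)
lift_definition uminus_sym :: "'a sym \<Rightarrow> 'a sym" is inv by (rule bij_imp_bij_inv)
definition minus_sym :: "'a sym \<Rightarrow> 'a sym \<Rightarrow> 'a sym" where "minus_sym a b = a + - b"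

instance
proof
  fix a b c :: "'a sym"
  show "a + b + c = a + (b + c)" by transfer (simp add: o_assoc)
  show "0 + a = a" by transfer simp
  show "a + 0 = a" by transfer simp
  show "- a + a = 0" by transfer (simp add: bij_is_inj)
  show "a + - b = a - b" by (simp add: minus_sym_def)
qed

end

abbreviation ev :: "(int \<Rightarrow> 'g::group_add) \<Rightarrow> int list \<Rightarrow> 'g" where
  "ev g w \<equiv> sum_list (map g w)"

lemma ev_winv: "(\<And>a. g (- a) = - g a) \<Longrightarrow> ev g (winv w) = - ev g w"
  by (induction w) (simp_all add: minus_add)

lemma ev_sound:
  assumes "weq R u v" and "\<And>a. g (- a) = - g a" and "\<And>r. r \<in> R \<Longrightarrow> ev g r = 0"
  shows "ev g u = ev g v"
  using assms(1) by (induction rule: weq.induct) (simp_all add: assms(2,3) add.assoc)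

section \<open>The regular representation of a presented group\<close>

definition wclosed :: "int list set \<Rightarrow> int list set \<Rightarrow> bool" where
  "wclosed R X \<longleftrightarrow> (\<forall>u v. weq R u v \<longrightarrow> u \<in> X \<longrightarrow> v \<in> X)"

definition ltrans :: "int list \<Rightarrow> int list set \<Rightarrow> int list set" where
  "ltrans w X = {v. winv w @ v \<in> X}"

lemma ltrans_append: "ltrans (u @ v) X = ltrans u (ltrans v X)"
  by (simp add: ltrans_def)

lemma ltrans_Nil [simp]: "ltrans [] X = X"
  by (simp add: ltrans_def)

lemma wclosed_ltrans: "wclosed R X \<Longrightarrow> wclosed R (ltrans w X)"
  using weq_append[of R _ _ "winv w" "[]"] by (auto simp: wclosed_def ltrans_def)

lemma wclosed_iff: "wclosed R X \<Longrightarrow> weq R u v \<Longrightarrow> u \<in> X \<longleftrightarrow> v \<in> X"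
  by (meson wclosed_def weq_sym)

lemma weq_winv_self: "weq R (w @ winv w) []"
proof (induction w)
  case (Cons a w)
  have "weq R ([a] @ (w @ winv w) @ [-a]) ([a] @ [] @ [-a])"
    using Cons.IH by (rule weq_append)
  then show ?case using weq_trans[OF _ weq_cancel[of R "[]" a "[]"]] by simp
qed (simp add: weq_refl)

lemma weq_winv: assumes "weq R u v" shows "weq R (winv u) (winv v)"
proof -
  have "weq R (winv u @ (v @ winv v) @ []) (winv u @ [] @ [])"
    by (rule weq_append[OF weq_winv_self])
  moreover have "weq R ([] @ (winv u @ winv (winv u)) @ winv v) ([] @ [] @ winv v)"
    by (rule weq_append[OF weq_winv_self])
  moreover have "weq R (winv u @ u @ winv v) (winv u @ v @ winv v)"
    using assms by (rule weq_append)
  ultimately show ?thesis by simp (meson weq_sym weq_trans)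
qed

lemma ltrans_weq: "wclosed R X \<Longrightarrow> weq R u v \<Longrightarrow> ltrans u X = ltrans v X"
  using weq_append[OF weq_winv, of R u v "[]"] wclosed_iff by (fastforce simp: ltrans_def)

text \<open>Translations by \<open>a\<close> and \<open>- a\<close> are sure to be mutually inverse
  only on closed sets of words; the identity elsewhere yields a permutation of all sets.\<close>

definition reg_fun :: "int list set \<Rightarrow> int \<Rightarrow> int list set \<Rightarrow> int list set" where
  "reg_fun R a X = (if wclosed R X then ltrans [a] X else X)"

lemma reg_fun_inverse: "reg_fun R a (reg_fun R (- a) X) = X"
proof (cases "wclosed R X")
  case True
  then have "ltrans [a] (ltrans [-a] X) = X"
    using ltrans_weq[OF True weq_cancel[of R "[]" a "[]"]] by (simp flip: ltrans_append)
  with True show ?thesis by (simp add: reg_fun_def wclosed_ltrans)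
qed (simp add: reg_fun_def)

lift_definition reg :: "int list set \<Rightarrow> int \<Rightarrow> int list set sym" is reg_fun
  using reg_fun_inverse[of _ _] reg_fun_inverse[of _ "- _"]
  by (intro o_bij[of "reg_fun _ (- _)"]) (auto simp: fun_eq_iff)

lemma reg_minus: "reg R (- a) = - reg R a"
proof -
  have "reg R a + reg R (- a) = 0"
    by transfer (simp add: fun_eq_iff reg_fun_inverse)
  then show ?thesis by (metis minus_unique)
qed

abbreviation val :: "int list set \<Rightarrow> int list \<Rightarrow> int list set sym" where
  "val R w \<equiv> ev (reg R) w"

lemma val_apply: "wclosed R X \<Longrightarrow> Rep_sym (val R w) X = ltrans w X"
proof (induction w)
  case (Cons a w)
  then show ?case
    using ltrans_append[of "[a]" w X]
    by (simp add: plus_sym.rep_eq reg.rep_eq reg_fun_def wclosed_ltrans)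
qed (simp add: zero_sym.rep_eq)

lemma val_winv [simp]: "val R (winv w) = - val R w"
  by (rule ev_winv) (rule reg_minus)

text \<open>The class of the empty word is closed and its translate by \<open>u\<close> is the class
  of \<open>u\<close>, so the permutation determines \<open>u\<close> up to equality. In the other
  direction, nothing moves on sets that are not closed.\<close>

lemma val_eq_iff: "val R u = val R v \<longleftrightarrow> weq R u v"
proof
  define X where "X = {w. weq R w []}"
  have X: "wclosed R X"
    unfolding X_def wclosed_def by (auto intro: weq_sym weq_trans)
  assume "val R u = val R v"
  then have "ltrans u X = ltrans v X"
    by (metis X val_apply)
  moreover have "u \<in> ltrans u X"
    using weq_winv_self[of R "winv u"] by (simp add: X_def ltrans_def)
  ultimately have "weq R (winv v @ u) []"
    by (simp add: ltrans_def X_def)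
  then have "weq R (v @ (winv v @ u) @ []) (v @ [] @ [])"
    by (rule weq_append)
  moreover have "weq R ([] @ (v @ winv v) @ u) ([] @ [] @ u)"
    by (rule weq_append[OF weq_winv_self])
  ultimately show "weq R u v" by simp (meson weq_sym weq_trans)
next
  assume uv: "weq R u v"
  have "Rep_sym (val R u) X = Rep_sym (val R v) X" for X
  proof (cases "wclosed R X")
    case True
    with uv show ?thesis by (simp add: val_apply ltrans_weq)
  next
    case False
    then have "Rep_sym (val R w) X = X" for w
      by (induction w) (simp_all add: zero_sym.rep_eq plus_sym.rep_eq reg.rep_eq reg_fun_def)
    then show ?thesis by simp
  qed
  then show "val R u = val R v"
    by (simp add: Rep_sym_inject[symmetric] fun_eq_iff)
qed

lemma val_relator: "r \<in> R \<Longrightarrow> val R r = 0"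
  using weq_rel[of r R "[]" "[]"] val_eq_iff[of R r "[]"] by simp

lemma val_eq_0_iff: "val R u = 0 \<longleftrightarrow> weq R u []"
  using val_eq_iff[of R u "[]"] by simp

text \<open>The universal property of the presentation. All homomorphisms below are given in this
  way, by an odd map on letters that kills the relators.\<close>

lemma weq_respects:
  fixes g :: "int \<Rightarrow> 'g::group_add"
  assumes "\<And>a. g (- a) = - g a" and "\<And>r. r \<in> R \<Longrightarrow> ev g r = 0"
  shows "val R u = val R v \<Longrightarrow> ev g u = ev g v"
  using ev_sound[OF _ assms] val_eq_iff by blast

lemma weq_mono: "(\<And>r. r \<in> R \<Longrightarrow> val R' r = 0) \<Longrightarrow> val R u = val R v \<Longrightarrow> val R' u = val R' v"
  by (rule weq_respects[where g = "reg R'", OF reg_minus])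

section \<open>HNN extensions\<close>

text \<open>A stable letter \<open>e\<close> satisfies \<open>e a e\<^sup>-\<^sup>1 = b\<close> for \<open>(a, b) \<in> Phi e\<close>.
  A state \<open>(g, [(e\<^sub>1, c\<^sub>1), \<dots>, (e\<^sub>n, c\<^sub>n)])\<close> is the normal form of \<open>g e\<^sub>1 c\<^sub>1 \<dots> e\<^sub>n c\<^sub>n\<close>.
  The subgroup \<open>H\<close> is preserved by the stable letters; representatives of cosets are chosen in \<open>H\<close>
  where possible.\<close>

locale hnn =
  fixes St :: "int set" and Phi :: "int \<Rightarrow> ('g::group_add \<times> 'g) set" and base :: "int \<Rightarrow> 'g" and H :: "'g set"
  assumes St_nz: "0 \<notin> St" and St_uminus: "e \<in> St \<Longrightarrow> - e \<in> St"
    and Phi_0: "(0, 0) \<in> Phi e"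
    and Phi_add: "(a, b) \<in> Phi e \<Longrightarrow> (a', b') \<in> Phi e \<Longrightarrow> (a + a', b + b') \<in> Phi e"
    and Phi_minus: "(a, b) \<in> Phi e \<Longrightarrow> (- a, - b) \<in> Phi e"
    and Phi_conv: "(a, b) \<in> Phi e \<Longrightarrow> (b, a) \<in> Phi (- e)"
    and Phi_fun: "(0, b) \<in> Phi e \<Longrightarrow> b = 0"
    and base_uminus: "base (- x) = - base x"
    and H_0: "0 \<in> H" and H_add: "a \<in> H \<Longrightarrow> b \<in> H \<Longrightarrow> a + b \<in> H" and H_minus: "a \<in> H \<Longrightarrow> - a \<in> H"
    and H_Phi: "(a, b) \<in> Phi e \<Longrightarrow> a \<in> H \<Longrightarrow> b \<in> H"
begin

definition A where "A e = Domain (Phi e)"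
definition im where "im e a = (THE b. (a, b) \<in> Phi e)"
definition rep where
  "rep e g = (if g \<in> A e then 0 else if \<exists>h\<in>H. g - h \<in> A e then SOME h. h \<in> H \<and> g - h \<in> A e
              else SOME h. g - h \<in> A e)"

lemma A_0: "0 \<in> A e"
  using Phi_0 by (auto simp: A_def)

lemma A_add: "a \<in> A e \<Longrightarrow> b \<in> A e \<Longrightarrow> a + b \<in> A e"
  using Phi_add by (fastforce simp: A_def)

lemma A_minus: "a \<in> A e \<Longrightarrow> - a \<in> A e"
  using Phi_minus by (fastforce simp: A_def)

lemma A_diff: "a \<in> A e \<Longrightarrow> b \<in> A e \<Longrightarrow> a - b \<in> A e"
  using A_add[of a e "- b"] A_minus by simp

lemma A_add_iff: "a \<in> A e \<Longrightarrow> a + g \<in> A e \<longleftrightarrow> g \<in> A e"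
  using A_add[of a e g] A_add[of "- a" e "a + g"] A_minus[of a e] by (auto simp: add.assoc[symmetric])

lemma im_eqI: assumes "(a, b) \<in> Phi e" shows "im e a = b"
  unfolding im_def
proof (rule the_equality)
  fix c assume "(a, c) \<in> Phi e"
  then have "(a + - a, c + - b) \<in> Phi e" using assms Phi_add Phi_minus by blast
  then have "(0, c - b) \<in> Phi e" by simp
  then have "c - b = 0" by (rule Phi_fun)
  then show "c = b" by simp
qed (rule assms)

lemma im_Phi: "a \<in> A e \<Longrightarrow> (a, im e a) \<in> Phi e"
  using im_eqI by (auto simp: A_def)

lemma im_A: "a \<in> A e \<Longrightarrow> im e a \<in> A (- e)"
  using im_Phi Phi_conv by (fastforce simp: A_def)

lemma im_im: "a \<in> A e \<Longrightarrow> im (- e) (im e a) = a"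
  by (simp add: im_Phi Phi_conv im_eqI)

lemma rep_in: "g - rep e g \<in> A e"
proof -
  have "g - g \<in> A e" by (simp add: A_0)
  then have *: "g - (SOME h. g - h \<in> A e) \<in> A e" by (rule someI)
  have "g - (SOME h. h \<in> H \<and> g - h \<in> A e) \<in> A e" if "\<exists>h\<in>H. g - h \<in> A e"
    using someI_ex[of "\<lambda>h. h \<in> H \<and> g - h \<in> A e"] that by blast
  with * show ?thesis by (auto simp: rep_def)
qed

lemma rep_cong: assumes "a \<in> A e" shows "rep e (a + g) = rep e g"
proof -
  have "a + g - h \<in> A e \<longleftrightarrow> g - h \<in> A e" for h
    using A_add_iff[OF assms, of "g - h"] by (simp add: add_diff_eq)
  moreover have "a + g \<in> A e \<longleftrightarrow> g \<in> A e" by (rule A_add_iff[OF assms])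
  ultimately show ?thesis by (simp add: rep_def)
qed

lemma rep_rep: "rep e (rep e g) = rep e g"
  using rep_cong[OF A_minus[OF rep_in], of e g g] by (simp add: algebra_simps)

lemma rep_A: "g \<in> A e \<Longrightarrow> rep e g = 0"
  by (simp add: rep_def)

lemma rep_0_iff: "rep e g = 0 \<longleftrightarrow> g \<in> A e"
  using rep_A rep_in[of g e] by auto

lemma rep_H: "g \<in> H \<Longrightarrow> rep e g \<in> H"
  using someI[of "\<lambda>h. h \<in> H \<and> g - h \<in> A e" g] A_0[of e] H_0
  by (auto simp: rep_def)

text \<open>Write g as (g - c) + c with g - c in the associated subgroup. The letter
  \<open>e\<close> moves past g - c, which becomes its image, and then either cancels against a
  following \<open>- e\<close>, possible only for c = 0, or stays in front of c. Acting on normal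
  forms (van der Waerden's method) replaces a confluence proof for reductions.\<close>

definition st_act :: "int \<Rightarrow> 'g \<times> (int \<times> 'g) list \<Rightarrow> 'g \<times> (int \<times> 'g) list" where
  "st_act e s = (let g = fst s; l = snd s; c = rep e g; v = im e (g - c) in
     if c = 0 \<and> l \<noteq> [] \<and> fst (hd l) = - e then (v + snd (hd l), tl l) else (v, (e, c) # l))"

fun reduced :: "(int \<times> 'g) list \<Rightarrow> bool" where
  "reduced [] \<longleftrightarrow> True"
| "reduced ((e, c) # l) \<longleftrightarrow> e \<in> St \<and> rep e c = c \<and> \<not> (c = 0 \<and> l \<noteq> [] \<and> fst (hd l) = - e) \<and> reduced l"

definition act :: "int \<Rightarrow> 'g \<times> (int \<times> 'g) list \<Rightarrow> 'g \<times> (int \<times> 'g) list" where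
  "act a s = (if a \<in> St then st_act a s else (base a + fst s, snd s))"

definition valid :: "'g \<times> (int \<times> 'g) list \<Rightarrow> bool" where
  "valid s \<longleftrightarrow> reduced (snd s)"

lemma st_act_valid: "e \<in> St \<Longrightarrow> valid s \<Longrightarrow> valid (st_act e s)"
  by (cases s; cases "snd s") (auto simp: st_act_def valid_def Let_def rep_rep)

lemma act_valid: "valid s \<Longrightarrow> valid (act a s)"
  using st_act_valid by (auto simp: act_def) (simp add: valid_def)

lemma st_act_inverse:
  assumes e: "e \<in> St" and s: "valid s"
  shows "st_act (- e) (st_act e s) = s"
proof -
  obtain g l where gl: "s = (g, l)" by (cases s)
  define c v where "c = rep e g" and "v = im e (g - c)"
  have gc: "g - c \<in> A e" by (simp add: c_def rep_in)
  then have v: "v \<in> A (- e)" "im (- e) v = g - c" by (simp_all add: v_def im_A im_im)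
  show ?thesis
  proof (cases "c = 0 \<and> l \<noteq> [] \<and> fst (hd l) = - e")
    case True
    then obtain c' l' where l: "l = (- e, c') # l'" by (cases l) auto
    have st: "st_act e s = (v + c', l')"
      using True by (simp add: st_act_def gl c_def[symmetric] l) (simp add: v_def)
    have red: "rep (- e) c' = c'" "\<not> (c' = 0 \<and> l' \<noteq> [] \<and> fst (hd l') = e)"
      using s by (auto simp: valid_def gl l)
    have "rep (- e) (v + c') = c'" using rep_cong[OF v(1)] red by simp
    with red(2) show ?thesis using True v(2) unfolding st by (auto simp: st_act_def gl l Let_def)
  next
    case False
    have st: "st_act e s = (v, (e, c) # l)"
      using False by (auto simp: st_act_def gl c_def[symmetric] v_def[symmetric])
    show ?thesis using v unfolding st by (simp add: st_act_def gl rep_A Let_def)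
  qed
qed

lemma act_inverse: "valid s \<Longrightarrow> act (- a) (act a s) = s"
  using st_act_inverse[of a s] St_uminus[of a] St_uminus[of "- a"] base_uminus[of a]
  by (cases s) (auto simp: act_def add.assoc[symmetric])

abbreviation wact :: "int list \<Rightarrow> 'g \<times> (int \<times> 'g) list \<Rightarrow> 'g \<times> (int \<times> 'g) list" where
  "wact w s \<equiv> foldr act w s"

lemma wact_valid: "valid s \<Longrightarrow> valid (wact w s)"
  by (induction w) (simp_all add: act_valid)

lemma wact_winv: "valid s \<Longrightarrow> wact (winv w) (wact w s) = s"
proof (induction w)
  case (Cons a w)
  then show ?case by (simp add: act_inverse wact_valid)
qed simp

lemma wact_base: "set w \<inter> St = {} \<Longrightarrow> wact w (g, l) = (ev base w + g, l)"
  by (induction w) (auto simp: act_def add.assoc)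

text \<open>The relation e a = b e as an identity of actions: \<open>rep\<close> is constant on
  cosets, so a left factor \<open>a\<close> only changes the part that moves past
  \<open>e\<close>.\<close>

lemma wact_stable:
  assumes e: "e \<in> St" and ab: "(a, b) \<in> Phi e"
  shows "st_act e (a + g, l) = (b + fst (st_act e (g, l)), snd (st_act e (g, l)))"
proof -
  have aA: "a \<in> A e" using ab by (auto simp: A_def)
  have "im e (a + g - rep e g) = b + im e (g - rep e g)"
    using im_eqI[OF Phi_add[OF ab im_Phi[OF rep_in]], of g] by (simp add: add_diff_eq)
  then show ?thesis
    by (auto simp: st_act_def Let_def rep_cong[OF aA] add.assoc)
qed

lemma wact_relator:
  assumes e: "e \<in> St" and u: "set u \<inter> St = {}" "set v \<inter> St = {}"
    and uv: "(ev base u, ev base v) \<in> Phi e" and s: "valid s"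
  shows "wact ([e] @ u @ [- e] @ winv v) s = s"
proof -
  define s' where "s' = wact ([- e] @ winv v) s"
  have v': "set (winv v) \<inter> St = {}"
    using u(2) St_uminus by (fastforce simp: winv_def)
  have "wact ([e] @ u) s' = wact (v @ [e]) s'"
    using wact_stable[OF e uv, of "fst s'" "snd s'"] u wact_base[of u "fst s'" "snd s'"]
      wact_base[of v "fst (st_act e s')" "snd (st_act e s')"]
    by (simp add: act_def e)
  also have "\<dots> = wact v (act e (act (- e) (wact (winv v) s)))"
    by (simp add: s'_def)
  also have "\<dots> = wact v (wact (winv v) s)"
    using act_inverse[of "wact (winv v) s" "- e"] s by (simp add: wact_valid)
  also have "\<dots> = s"
    using wact_winv[OF s, of "winv v"] by simp
  finally show ?thesis by (simp add: s'_def)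
qed

lemma wact_sound:
  assumes "weq R u v" and R: "\<And>r s. r \<in> R \<Longrightarrow> valid s \<Longrightarrow> wact r s = s" and s: "valid s"
  shows "wact u s = wact v s"
  using assms(1) s
proof (induction arbitrary: s rule: weq.induct)
  case (weq_cancel u a v)
  then show ?case using act_inverse[of "wact v s" "- a"] by (simp add: wact_valid)
qed (simp_all add: R wact_valid)

definition in_H :: "'g \<times> (int \<times> 'g) list \<Rightarrow> bool" where
  "in_H s \<longleftrightarrow> fst s \<in> H \<and> snd ` set (snd s) \<subseteq> H"

text \<open>The choice of representatives pays off here: for g in \<open>H\<close> the
  representative and the difference both lie in \<open>H\<close>, and stable letters carry
  \<open>H\<close> into itself.\<close>

lemma st_act_in_H: assumes "in_H s" shows "in_H (st_act e s)"
proof -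
  obtain g l where gl: "s = (g, l)" by (cases s)
  have g: "g \<in> H" "snd ` set l \<subseteq> H" using assms by (auto simp: in_H_def gl)
  have c: "rep e g \<in> H" using g rep_H by blast
  have "im e (g - rep e g) \<in> H"
    using H_Phi[OF im_Phi[OF rep_in]] g c H_add H_minus by (metis add_uminus_conv_diff)
  with g c show ?thesis
    by (cases l) (auto simp: st_act_def in_H_def gl Let_def intro!: H_add)
qed

text \<open>The subgroup generated by \<open>H\<close> and the stable letters meets the base group in \<open>H\<close>.\<close>

lemma wact_in_H:
  assumes "\<And>w. w \<in> set ws \<Longrightarrow> (\<exists>e\<in>St. w = [e]) \<or> (set w \<inter> St = {} \<and> ev base w \<in> H)" and "in_H s"
  shows "in_H (wact (concat ws) s)"
  using assms(1)
proof (induction ws)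
  case (Cons w ws)
  let ?s = "wact (concat ws) s"
  have s: "in_H ?s" using Cons by simp
  consider e where "e \<in> St" "w = [e]" | "set w \<inter> St = {}" "ev base w \<in> H"
    using Cons.prems[of w] by auto
  then show ?case
  proof cases
    case 1
    with s show ?thesis by (simp add: act_def[of e] st_act_in_H)
  next
    case 2
    with s show ?thesis using wact_base[of w "fst ?s" "snd ?s"] H_add by (simp add: in_H_def)
  qed
qed (simp add: assms(2))

definition pinch :: "int list \<Rightarrow> bool" where
  "pinch w \<longleftrightarrow> (\<exists>p f u q. w = p @ [f] @ u @ [- f] @ q \<and> f \<in> St \<and> set u \<inter> St = {} \<and> ev base u \<in> A f)"

text \<open>The second conjunct serves the induction: the group component is the prefix before the
  first stable letter \<open>f\<close>, followed by an element of the subgroup of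
  \<open>- f\<close>. If a new letter on the left cancelled against \<open>f\<close>, that prefix
  would lie in the associated subgroup, which is a pinch.\<close>

lemma pinch_free_state:
  assumes "\<not> pinch w"
  shows "map fst (snd (wact w (0, []))) = filter (\<lambda>a. a \<in> St) w \<and>
    (\<exists>u w'. w = u @ w' \<and> set u \<inter> St = {} \<and>
       ((w' = [] \<and> fst (wact w (0, [])) = ev base u) \<or>
        (\<exists>f w'' b. w' = f # w'' \<and> f \<in> St \<and> b \<in> A (- f) \<and> fst (wact w (0, [])) = ev base u + b)))"
  using assms
proof (induction w)
  case (Cons a w)
  have np: "\<not> pinch w"
    using Cons.prems unfolding pinch_def by (metis append_Cons)
  obtain g l where gl: "wact w (0, []) = (g, l)" by (cases "wact w (0, [])")
  from Cons.IH[OF np] gl have l: "map fst l = filter (\<lambda>a. a \<in> St) w" by simp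
  from Cons.IH[OF np] gl obtain u w' where u: "w = u @ w'" "set u \<inter> St = {}"
    "(w' = [] \<and> g = ev base u) \<or> (\<exists>f w'' b. w' = f # w'' \<and> f \<in> St \<and> b \<in> A (- f) \<and> g = ev base u + b)"
    by auto
  show ?case
  proof (cases "a \<in> St")
    case False
    have "wact (a # w) (0, []) = (base a + g, l)"
      using False by (simp add: gl act_def)
    moreover have "a # w = (a # u) @ w'" "set (a # u) \<inter> St = {}"
      "(w' = [] \<and> base a + g = ev base (a # u)) \<or> (\<exists>f w'' b. w' = f # w'' \<and> f \<in> St \<and> b \<in> A (- f) \<and> base a + g = ev base (a # u) + b)"
      using u False by (auto simp: add.assoc)
    ultimately show ?thesis using l False by (metis (no_types, lifting) filter.simps(2) fst_conv snd_conv)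
  next
    case True
    have nc: "\<not> (rep a g = 0 \<and> l \<noteq> [] \<and> fst (hd l) = - a)"
    proof
      assume c: "rep a g = 0 \<and> l \<noteq> [] \<and> fst (hd l) = - a"
      then have g: "g \<in> A a" by (simp add: rep_0_iff)
      have "filter (\<lambda>a. a \<in> St) w \<noteq> []" "hd (filter (\<lambda>a. a \<in> St) w) = - a"
        using c l by (metis Nil_is_map_conv, metis hd_map)
      then obtain w'' b where w': "w' = - a # w''" "b \<in> A a" "g = ev base u + b"
        using u by (auto simp: filter_empty_conv[symmetric] disjoint_iff)
      have "ev base u = g - b" by (simp add: w')
      then have "ev base u \<in> A a" using A_diff[OF g w'(2)] by simp
      then have "pinch (a # w)"
        unfolding pinch_def using True u w' by (intro exI[of _ "[]"] exI[of _ a] exI[of _ u] exI[of _ w'']) simp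
      with Cons.prems show False ..
    qed
    then have "wact (a # w) (0, []) = (im a (g - rep a g), (a, rep a g) # l)"
      using True by (auto simp: gl act_def st_act_def Let_def)
    then show ?thesis
      using True l im_A[OF rep_in, of a g] by (intro conjI exI[of _ "[]"] exI[of _ "a # w"]) auto
  qed
qed simp

text \<open>Britton's lemma: without a pinch nothing cancels, and all stable letters of
  \<open>w\<close> survive in the state.\<close>

lemma britton:
  assumes "wact w (0, []) = (0, [])"
  shows "pinch w \<or> (set w \<inter> St = {} \<and> ev base w = 0)"
proof (cases "pinch w")
  case False
  from pinch_free_state[OF this] assms have "filter (\<lambda>a. a \<in> St) w = []" by simp
  then have w: "set w \<inter> St = {}" by (auto simp: filter_empty_conv)
  with wact_base[OF w, of 0 "[]"] assms show ?thesis by simp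
qed simp

end

section \<open>HNN extensions given by generators and relators\<close>

definition over :: "int set \<Rightarrow> int list \<Rightarrow> bool" where
  "over Gs w \<longleftrightarrow> (\<forall>a\<in>set w. \<bar>a\<bar> \<in> Gs)"

lemma over_simps [simp]: "over Gs []" "over Gs (a # w) \<longleftrightarrow> \<bar>a\<bar> \<in> Gs \<and> over Gs w"
  "over Gs (u @ v) \<longleftrightarrow> over Gs u \<and> over Gs v" "over Gs (winv w) \<longleftrightarrow> over Gs w"
  by (auto simp: over_def winv_def)

lemma over_mono: "over Gs w \<Longrightarrow> Gs \<subseteq> Gs' \<Longrightarrow> over Gs' w"
  by (auto simp: over_def)

definition wpow :: "nat \<Rightarrow> int list \<Rightarrow> int list" where
  "wpow n w = concat (replicate n w)"

lemma wpow_simps [simp]: "wpow 0 w = []" "wpow (Suc n) w = w @ wpow n w"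
  by (simp_all add: wpow_def)

lemma over_wpow: "over Gs w \<Longrightarrow> over Gs (wpow n w)"
  by (induction n) auto

definition torsion_free :: "int set \<Rightarrow> int list set \<Rightarrow> bool" where
  "torsion_free Gs R \<longleftrightarrow> (\<forall>w n. over Gs w \<longrightarrow> 0 < n \<longrightarrow> val R (wpow n w) = 0 \<longrightarrow> val R w = 0)"

lemma ev_wpow_conj:
  assumes "ev g w = h + ev g w' - h"
  shows "ev g (wpow n w) = h + ev g (wpow n w') - h"
  by (induction n) (simp_all add: assms, simp add: diff_conv_add_uminus add.assoc del: add_uminus_conv_diff)

definition hrel :: "int \<Rightarrow> int list \<Rightarrow> int list \<Rightarrow> int list" where
  "hrel e a b = [e] @ a @ [- e] @ winv b"

lemma ev_hrel:
  assumes "\<And>a. g (- a) = - g a"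
  shows "ev g (hrel e a b) = 0 \<longleftrightarrow> g e + ev g a - g e = ev g b"
proof -
  have "ev g (hrel e a b) = (g e + ev g a - g e) - ev g b"
    using ev_winv[of g, OF assms] assms by (simp add: hrel_def diff_conv_add_uminus add.assoc del: add_uminus_conv_diff)
  then show ?thesis by simp
qed

text \<open>The map between subgroups induced by a stable letter, as a relation on words: generator
  pairs and their inverses are multiplied in parallel. Well-definedness and injectivity are then
  separate claims about trivial words.\<close>

inductive_set gpair :: "(int list \<times> int list) set \<Rightarrow> (int list \<times> int list) set" for P where
  gpair_Nil: "([], []) \<in> gpair P"
| gpair_pos: "(a, b) \<in> P \<Longrightarrow> (u, v) \<in> gpair P \<Longrightarrow> (a @ u, b @ v) \<in> gpair P"
| gpair_neg: "(a, b) \<in> P \<Longrightarrow> (u, v) \<in> gpair P \<Longrightarrow> (winv a @ u, winv b @ v) \<in> gpair P"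

lemma gpair_append: "(u, v) \<in> gpair P \<Longrightarrow> (u', v') \<in> gpair P \<Longrightarrow> (u @ u', v @ v') \<in> gpair P"
  by (induction rule: gpair.induct) (auto intro: gpair.intros)

lemma gpair_winv: "(u, v) \<in> gpair P \<Longrightarrow> (winv u, winv v) \<in> gpair P"
proof (induction rule: gpair.induct)
  case (gpair_pos a b u v)
  then show ?case using gpair_append[OF gpair_pos.IH gpair.gpair_neg[OF _ gpair.gpair_Nil, of a b]] by simp
next
  case (gpair_neg a b u v)
  then show ?case using gpair_append[OF gpair_neg.IH gpair.gpair_pos[OF _ gpair.gpair_Nil, of a b]] by simp
qed (simp add: gpair_Nil)

lemma gpair_over:
  "(u, v) \<in> gpair P \<Longrightarrow> (\<And>a b. (a, b) \<in> P \<Longrightarrow> over Gs a \<and> over Gs b) \<Longrightarrow> over Gs u \<and> over Gs v"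
  by (induction rule: gpair.induct) auto

lemma gpair_ev:
  assumes "(u, v) \<in> gpair P" and "\<And>a b. (a, b) \<in> P \<Longrightarrow> h + ev g a - h = ev g b"
    and "\<And>a. g (- a) = - g a"
  shows "h + ev g u - h = ev g v"
  using assms(1)
proof (induction rule: gpair.induct)
  case (gpair_pos a b u v)
  have "h + (ev g a + ev g u) - h = (h + ev g a - h) + (h + ev g u - h)"
    by (simp add: diff_conv_add_uminus add.assoc del: add_uminus_conv_diff)
  with gpair_pos assms(2) show ?case by simp
next
  case (gpair_neg a b u v)
  have "- ev g b = h + - ev g a - h"
    by (simp flip: assms(2)[OF gpair_neg(1)] add: minus_add diff_conv_add_uminus add.assoc del: add_uminus_conv_diff)
  moreover have "h + (- ev g a + ev g u) - h = (h + - ev g a - h) + (h + ev g u - h)"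
    by (simp add: diff_conv_add_uminus add.assoc del: add_uminus_conv_diff)
  ultimately show ?case using gpair_neg.IH by (simp add: ev_winv[of g, OF assms(3)])
qed simp

text \<open>A homomorphism realizing the pairs of \<open>P\<close> makes the induced map on subgroups well defined.\<close>

lemma gpair_hom:
  fixes g :: "int \<Rightarrow> int list set sym"
  assumes uv: "(u, v) \<in> gpair P" and g: "\<And>a. g (- a) = - g a" and R: "\<And>r. r \<in> R \<Longrightarrow> ev g r = 0"
    and P: "\<And>a b. (a, b) \<in> P \<Longrightarrow> ev g a = val R' b" and u: "val R u = 0"
  shows "val R' v = 0"
proof -
  have "ev g u = val R' v"
    using uv by (induction rule: gpair.induct) (simp_all add: P ev_winv[of g, OF g])
  moreover have "ev g u = 0"
    using weq_respects[of g R u "[]", OF g R] u by simp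
  ultimately show ?thesis by simp
qed

text \<open>The assumption \<open>iso\<close> says that matching the generators in
  \<open>P e\<close> extends to an isomorphism of the subgroups they generate. All letters of
  \<open>E\<close> are adjoined simultaneously.\<close>

locale whnn =
  fixes Gs :: "int set" and R :: "int list set" and E :: "int set" and P :: "int \<Rightarrow> (int list \<times> int list) set"
  assumes Gs_pos: "x \<in> Gs \<Longrightarrow> 0 < x" and E_pos: "e \<in> E \<Longrightarrow> 0 < e" and disj: "Gs \<inter> E = {}"
    and R_over: "r \<in> R \<Longrightarrow> over Gs r"
    and P_over: "e \<in> E \<Longrightarrow> (a, b) \<in> P e \<Longrightarrow> over Gs a \<and> over Gs b"
    and iso: "e \<in> E \<Longrightarrow> (u, v) \<in> gpair (P e) \<Longrightarrow> val R u = 0 \<longleftrightarrow> val R v = 0"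
begin

definition hR where "hR = R \<union> {hrel e a b | e a b. e \<in> E \<and> (a, b) \<in> P e}"

definition St where "St = {e. \<bar>e\<bar> \<in> E}"
definition base where "base a = (if \<bar>a\<bar> \<in> Gs then reg R a else 0)"
text \<open>The locale \<open>hnn\<close> asks for its axioms at every integer, hence the trivial
  relation outside the stable letters. The pairs of a negative letter are those of its inverse,
  reversed.\<close>

definition Q where
  "Q e = (if e \<in> E then gpair (P e) else if - e \<in> E then (gpair (P (- e)))\<inverse> else {([], [])})"
definition Phi where "Phi e = (\<lambda>(u, v). (val R u, val R v)) ` Q e"

lemma PhiE: "(a, b) \<in> Phi e \<Longrightarrow> (\<And>u v. (u, v) \<in> Q e \<Longrightarrow> a = val R u \<Longrightarrow> b = val R v \<Longrightarrow> thesis) \<Longrightarrow> thesis"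
  by (auto simp: Phi_def)

lemma PhiI: "(u, v) \<in> Q e \<Longrightarrow> (val R u, val R v) \<in> Phi e"
  by (force simp: Phi_def)

lemma Q_Nil: "([], []) \<in> Q e"
  by (simp add: Q_def gpair_Nil)

lemma Q_append: "(u, v) \<in> Q e \<Longrightarrow> (u', v') \<in> Q e \<Longrightarrow> (u @ u', v @ v') \<in> Q e"
  using gpair_append by (auto simp: Q_def)

lemma Q_winv: "(u, v) \<in> Q e \<Longrightarrow> (winv u, winv v) \<in> Q e"
  using gpair_winv by (auto simp: Q_def)

lemma Q_conv: "(u, v) \<in> Q e \<Longrightarrow> (v, u) \<in> Q (- e)"
  using E_pos[of e] E_pos[of "- e"] by (auto simp: Q_def split: if_splits)

lemma Q_iso: "(u, v) \<in> Q e \<Longrightarrow> val R u = 0 \<longleftrightarrow> val R v = 0"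
  using iso by (auto simp: Q_def split: if_splits)

lemma ev_base: "over Gs w \<Longrightarrow> ev base w = val R w"
  by (induction w) (simp_all add: base_def)

lemma over_St: "over Gs w \<Longrightarrow> set w \<inter> St = {}"
  using disj by (auto simp: over_def St_def)

sublocale hnn St Phi base UNIV
proof
  show "0 \<notin> St" using E_pos by (force simp: St_def)
  show "e \<in> St \<Longrightarrow> - e \<in> St" for e by (simp add: St_def)
  show "(0, 0) \<in> Phi e" for e
    using PhiI[OF Q_Nil] by simp
  show "(a + a', b + b') \<in> Phi e" if "(a, b) \<in> Phi e" "(a', b') \<in> Phi e" for a b a' b' e
    using that by (auto elim!: PhiE intro: PhiI[OF Q_append, simplified])
  show "(- a, - b) \<in> Phi e" if "(a, b) \<in> Phi e" for a b e
    using that by (auto elim!: PhiE intro: PhiI[OF Q_winv, simplified])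
  show "(b, a) \<in> Phi (- e)" if "(a, b) \<in> Phi e" for a b e
    using that by (auto elim!: PhiE intro: PhiI[OF Q_conv])
  show "b = 0" if "(0, b) \<in> Phi e" for b e
    using that Q_iso by (auto elim!: PhiE)
  show "base (- x) = - base x" for x by (simp add: base_def reg_minus)
qed auto

lemma wact_hR:
  assumes w: "val hR u = val hR v"
  shows "wact u (0, []) = wact v (0, [])"
proof (rule wact_sound)
  show "weq hR u v" using w by (simp add: val_eq_iff)
  show "valid (0, [])" by (simp add: valid_def)
  fix r s assume r: "r \<in> hR" and s: "valid s"
  show "wact r s = s"
  proof (cases "r \<in> R")
    case True
    then show ?thesis
      using wact_base[OF over_St[OF R_over[OF True]], of "fst s" "snd s"]
      by (simp add: ev_base R_over val_relator)
  next
    case False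
    then obtain e a b where e: "r = hrel e a b" "e \<in> E" "(a, b) \<in> P e"
      using r by (auto simp: hR_def)
    have "(a, b) \<in> gpair (P e)" using gpair_pos[OF e(3) gpair_Nil] by simp
    then have "(ev base a, ev base b) \<in> Phi e"
      using PhiI[of a b e] e P_over[OF e(2,3)] by (simp add: ev_base Q_def)
    moreover have "e \<in> St" using e E_pos[of e] by (simp add: St_def)
    ultimately show ?thesis
      unfolding e(1) hrel_def using over_St P_over[OF e(2,3)] s by (intro wact_relator) auto
  qed
qed

text \<open>A word of the base group sends \<open>(0, [])\<close> to its own value in the base
  group, so it can act trivially only if it was trivial there.\<close>

lemma embedding:
  assumes "over Gs w" and "val hR w = 0"
  shows "val R w = 0"
  using wact_hR[of w "[]"] wact_base[OF over_St[OF assms(1)], of 0 "[]"] assms by (simp add: ev_base)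

lemma hR_val: "val R u = val R v \<Longrightarrow> val hR u = val hR v"
  by (rule weq_mono[of R hR]) (auto intro!: val_relator simp: hR_def)

lemma hR_pair:
  assumes "e \<in> E" and "(u, v) \<in> gpair (P e)"
  shows "reg hR e + val hR u - reg hR e = val hR v"
proof (rule gpair_ev[where g = "reg hR", OF assms(2) _ reg_minus])
  fix a b assume "(a, b) \<in> P e"
  then have "val hR (hrel e a b) = 0" using assms(1) by (intro val_relator) (auto simp: hR_def)
  then show "reg hR e + val hR a - reg hR e = val hR b" using ev_hrel[of "reg hR", OF reg_minus] by simp
qed

lemma hR_pinch:
  assumes f: "f \<in> St" and u: "over Gs u" "ev base u \<in> A f"
  shows "\<exists>v. over Gs v \<and> val hR ([f] @ u @ [- f]) = val hR v"
proof (cases "f \<in> E")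
  case True
  then obtain u' v' where uv: "(u', v') \<in> gpair (P f)" "val R u = val R u'"
    using u by (auto simp: A_def Q_def ev_base elim!: PhiE)
  then have "val hR ([f] @ u @ [- f]) = val hR v'"
    using hR_pair[OF True uv(1)] hR_val[OF uv(2)] by (simp add: reg_minus add_diff_eq)
  then show ?thesis using gpair_over[OF uv(1)] P_over[OF True] by blast
next
  case False
  then have f': "- f \<in> E" using f E_pos by (auto simp: St_def abs_if split: if_splits)
  then obtain u' v' where uv: "(u', v') \<in> gpair (P (- f))" "val R u = val R v'"
    using u False by (auto simp: A_def Q_def ev_base elim!: PhiE)
  have "val hR v' = - reg hR f + val hR u' + reg hR f"
    using hR_pair[OF f' uv(1)] by (simp add: reg_minus)
  then have "val hR ([f] @ u @ [- f]) = val hR u'"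
    using hR_val[OF uv(2)] by (simp add: reg_minus diff_conv_add_uminus add.assoc del: add_uminus_conv_diff)
  then show ?thesis using gpair_over[OF uv(1)] P_over[OF f'] by blast
qed

lemma britton_word:
  assumes "over (Gs \<union> E) w" and "val hR w = 0"
  shows "over Gs w \<or> (\<exists>p f u q. w = p @ [f] @ u @ [- f] @ q \<and> f \<in> St \<and> over Gs u \<and> ev base u \<in> A f)"
proof -
  have ov: "over Gs u" if "over (Gs \<union> E) u" "set u \<inter> St = {}" for u
    using that by (auto simp: over_def St_def)
  have "wact w (0, []) = (0, [])" using wact_hR[of w "[]"] assms(2) by simp
  then consider "pinch w" | "set w \<inter> St = {}" using britton by blast
  then show ?thesis
  proof cases
    case 1
    then obtain p f u q where "w = p @ [f] @ u @ [- f] @ q" "f \<in> St" "set u \<inter> St = {}" "ev base u \<in> A f"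
      by (auto simp: pinch_def)
    moreover from this have "over Gs u" using ov[of u] assms(1) by simp
    ultimately show ?thesis by blast
  qed (use ov assms(1) in blast)
qed

text \<open>The first stable letter of \<open>y @ z\<close> is \<open>f\<close>; as \<open>y\<close>
  contains some stable letter, it contains this one.\<close>

lemma first_stable:
  assumes "y @ z = u @ f # q" "over Gs u" "f \<in> St" "\<not> over Gs y" "over (Gs \<union> E) y"
  shows "\<exists>y'. y = u @ f # y'"
proof -
  obtain v where "(y = u @ v \<and> v @ z = f # q) \<or> (y @ v = u \<and> z = v @ f # q)"
    using assms(1) append_eq_append_conv2[of y z u "f # q"] by blast
  then show ?thesis
  proof
    assume v: "y = u @ v \<and> v @ z = f # q"
    then have "v \<noteq> []" using assms by auto
    then show ?thesis using v by (cases v) auto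
  next
    assume "y @ v = u \<and> z = v @ f # q"
    then show ?thesis using assms by auto
  qed
qed

text \<open>A pinch in a power of \<open>w\<close> occurs in \<open>w\<close> or across the seam of \<open>w @ w\<close>.\<close>

lemma pinch_power:
  assumes "over (Gs \<union> E) w" and "wpow n w = p @ [f] @ u @ [- f] @ q" and "f \<in> St" and "over Gs u"
  shows "\<exists>w1 w2 u' y f'. w = w1 @ w2 \<and> w2 @ w1 = [f'] @ u' @ [- f'] @ y \<and> f' = f \<and> u' = u \<or>
     (\<exists>p y. w = p @ [f] @ u @ [- f] @ y)"
  using assms(2)
proof (induction n arbitrary: p)
  case (Suc n)
  have f_over: "\<not> over Gs [f]" "\<not> over Gs [-f]" "- f \<in> St" "f \<noteq> - f"
    using assms(3) disj E_pos[of 0] by (auto simp: St_def)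
  have eq: "w @ wpow n w = p @ f # (u @ - f # q)" using Suc.prems by simp
  show ?case
  proof (cases "\<exists>p'. p = w @ p'")
    case True
    then show ?thesis using Suc by auto
  next
    case False
    then obtain v where v: "w = p @ v" "v @ wpow n w = f # (u @ - f # q)"
      using eq by (auto simp: append_eq_append_conv2)
    then have "v \<noteq> []" using False by auto
    then obtain y where y: "v = f # y" "y @ wpow n w = u @ - f # q"
      using v by (cases v) auto
    have w: "w = p @ f # y" using v y by simp
    show ?thesis
    proof (cases "over Gs y")
      case False
      then obtain y' where "y = u @ - f # y'"
        using first_stable[OF y(2) assms(4) f_over(3) False] assms(1) w by auto
      then show ?thesis using w by auto
    next
      case True
      have "n \<noteq> 0"
      proof
        assume "n = 0"
        then have "over Gs [-f]" using True y(2) by simp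
        then show False using f_over by simp
      qed
      then obtain k where k: "wpow n w = (p @ [f]) @ (y @ wpow k w)"
        using w by (cases n) auto
      have "(y @ p @ [f]) @ (y @ wpow k w) = u @ - f # q"
        using y(2) k by simp
      moreover have "over (Gs \<union> E) (y @ p @ [f])" using assms(1) w by simp
      ultimately obtain y' where y': "y @ p @ [f] = u @ - f # y'"
        using first_stable[of "y @ p @ [f]" _ u "- f" q] assms(4) f_over by auto
      \<comment> \<open>The pinch opened by \<open>f\<close> closes in the next copy of
        \<open>w\<close>, at the latest at the position of the same \<open>f\<close>. Since that
        letter is not \<open>- f\<close>, the pinch closes earlier and lies in the rotation f y p of
        \<open>w\<close>.\<close>
      obtain y'' where y'': "y' = y'' @ [f]"
      proof (cases y' rule: rev_cases)
        case Nil
        then have "(y @ p) @ [f] = u @ [- f]" using y' by simp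
        then show ?thesis using f_over(4) by blast
      next
        case (snoc ys c)
        then have "(y @ p) @ [f] = (u @ - f # ys) @ [c]" using y' by simp
        then show ?thesis using that snoc by blast
      qed
      then have "y @ p = u @ - f # y''" using y' by simp
      then show ?thesis using w
        by (intro exI[of _ p] exI[of _ "f # y"] exI[of _ u] exI[of _ y''] exI[of _ f]) simp
    qed
  qed
qed simp

text \<open>Induction on the number of stable letters. A trivial power of a word with stable letters
  contains a pinch; after a cyclic rotation, that is a conjugation, the pinch lies inside
  \<open>w\<close>. Replacing it by a base word gives a conjugate of \<open>w\<close> with two
  stable letters fewer.\<close>

lemma torsion_free_hR:
  assumes tf: "torsion_free Gs R"
  shows "torsion_free (Gs \<union> E) hR"
  unfolding torsion_free_def
proof (intro allI impI)
  fix w n assume "over (Gs \<union> E) w" "0 < n" "val hR (wpow n w) = 0"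
  then show "val hR w = 0"
  proof (induction "length (filter (\<lambda>a. a \<in> St) w)" arbitrary: w rule: less_induct)
    case less
    show ?case
    proof (cases "over Gs w")
      case True
      have "val R (wpow n w) = 0" using embedding[OF over_wpow[OF True]] less by simp
      then have "val R w = 0" using tf True less by (auto simp: torsion_free_def)
      then show ?thesis using hR_val[of w "[]"] by simp
    next
      case False
      then have "\<not> over Gs (wpow n w)" using less.prems(2) by (cases n) auto
      then obtain p f u q where pinch: "wpow n w = p @ [f] @ u @ [- f] @ q" "f \<in> St" "over Gs u" "ev base u \<in> A f"
        using britton_word[OF over_wpow[OF less.prems(1)] less.prems(3)] by blast
      obtain v where v: "over Gs v" "val hR ([f] @ u @ [- f]) = val hR v"
        using hR_pinch pinch by blast
      have mf: "- f \<in> St" using pinch by (simp add: St_def)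
      consider w1 w2 y where "w = w1 @ w2" "w2 @ w1 = [f] @ u @ [- f] @ y" | p y where "w = p @ [f] @ u @ [- f] @ y"
        using pinch_power[OF less.prems(1) pinch(1-3)] by blast
      then obtain h w' where w': "over (Gs \<union> E) w'" "val hR w = h + val hR w' - h"
        "length (filter (\<lambda>a. a \<in> St) w') < length (filter (\<lambda>a. a \<in> St) w)"
      proof cases
        case 1
        have "val hR w = val hR w1 + val hR (w2 @ w1) - val hR w1"
          by (simp add: 1(1) diff_conv_add_uminus add.assoc del: add_uminus_conv_diff)
        also have "val hR (w2 @ w1) = val hR ([f] @ u @ [- f]) + val hR y"
          by (simp add: 1(2) add.assoc del: map_append sum_list_append) (simp add: add.assoc)
        also have "\<dots> = val hR (v @ y)" unfolding v(2) by simp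
        finally have "val hR w = val hR w1 + val hR (v @ y) - val hR w1" .
        moreover have "over (Gs \<union> E) (w2 @ w1)" using less.prems(1) 1(1) by simp
        moreover have "filter (\<lambda>a. a \<in> St) v = []" using over_St[OF v(1)] by (auto simp: filter_empty_conv)
        moreover have "length (filter (\<lambda>a. a \<in> St) w) = length (filter (\<lambda>a. a \<in> St) (w2 @ w1))"
          by (simp add: 1(1))
        ultimately show ?thesis
          using that[of "v @ y" "val hR w1"] v(1) over_mono[of Gs v "Gs \<union> E"] pinch(2) mf by (simp add: 1(2))
      next
        case 2
        have "val hR w = val hR p + val hR ([f] @ u @ [- f]) + val hR y"
          by (simp add: 2 add.assoc)
        also have "\<dots> = val hR (p @ v @ y)" unfolding v(2) by (simp add: add.assoc)
        finally have "val hR w = 0 + val hR (p @ v @ y) - 0" by simp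
        moreover have "filter (\<lambda>a. a \<in> St) v = []" using over_St[OF v(1)] by (auto simp: filter_empty_conv)
        ultimately show ?thesis
          using that[of "p @ v @ y" 0] v(1) over_mono[of Gs v "Gs \<union> E"] pinch(2) mf less.prems(1) by (simp add: 2)
      qed
      have "h + val hR (wpow n w') - h = 0"
        using ev_wpow_conj[OF w'(2), of n] less.prems(3) by simp
      then have "val hR (wpow n w') = 0"
        by (metis add.right_neutral add_left_imp_eq diff_eq_eq add_0)
      then have "val hR w' = 0" using less.hyps w' less.prems(2) by blast
      then show ?thesis using w'(2) by simp
    qed
  qed
qed

end

section \<open>Integer multiples\<close>

definition zp :: "int \<Rightarrow> 'g::group_add \<Rightarrow> 'g" where
  "zp i g = (if 0 \<le> i then sum_list (replicate (nat i) g) else - sum_list (replicate (nat (- i)) g))"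

lemma sum_list_replicate_Suc: "sum_list (replicate (Suc n) g) = sum_list (replicate n g) + (g::'g::group_add)"
  by (induction n) (simp_all, metis add.assoc)

lemma zp_0 [simp]: "zp 0 g = 0" and zp_1 [simp]: "zp 1 g = g"
  by (simp_all add: zp_def)

lemma zp_of_nat: "zp (int n) g = sum_list (replicate n g)"
  by (simp add: zp_def)

lemma zp_minus: "zp (- i) g = - zp i g"
  by (auto simp: zp_def)

lemma zp_succ: "zp (i + 1) g = zp i g + g"
proof (cases "0 \<le> i")
  case True
  then show ?thesis by (simp only: zp_def nat_add_distrib) (simp add: sum_list_replicate_Suc del: replicate.simps)
next
  case False
  define k where "k = nat (- (i + 1))"
  have i: "i = - int k - 1" using False by (simp add: k_def)
  have "zp i g = - (g + sum_list (replicate k g))"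
    by (simp add: i zp_def nat_add_distrib)
  moreover have "zp (i + 1) g = - sum_list (replicate k g)"
    by (simp add: i zp_def)
  ultimately show ?thesis by (simp add: minus_add diff_conv_add_uminus add.assoc del: add_uminus_conv_diff)
qed

lemma zp_pred: "zp (i - 1) g = zp i g - g"
  using zp_succ[of "i - 1" g] by simp

lemma zp_add: "zp (i + j) g = zp i g + zp j g"
proof (induction j rule: int_induct[of _ 0])
  case (step1 j)
  then show ?case using zp_succ[of "i + j" g] zp_succ[of j g] by (simp add: add.assoc)
next
  case (step2 j)
  then show ?case using zp_pred[of "i + j" g] zp_pred[of j g] by (simp add: add_diff_eq)
qed simp

lemma zp_mult: "zp (j * i) g = zp i (zp j g)"
proof (induction i rule: int_induct[of _ 0])
  case (step1 i)
  then show ?case by (simp add: distrib_left zp_add)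
next
  case (step2 i)
  then show ?case using zp_add[of "j * i" "- j" g] by (simp add: right_diff_distrib zp_pred zp_minus)
qed simp

lemma zp_conj: "h + zp i g - h = zp i (h + g - h)"
proof (induction i rule: int_induct[of _ 0])
  case (step1 i)
  have "h + (zp i g + g) - h = (h + zp i g - h) + (h + g - h)"
    by (simp add: diff_conv_add_uminus add.assoc del: add_uminus_conv_diff)
  with step1 show ?case by (simp add: zp_succ)
next
  case (step2 i)
  have "h + (zp i g - g) - h = (h + zp i g - h) - (h + g - h)"
    by (simp add: diff_conv_add_uminus add.assoc minus_add del: add_uminus_conv_diff)
  with step2 show ?case by (simp add: zp_pred)
qed simp

definition xp :: "int \<Rightarrow> int list" where
  "xp i = (if 0 \<le> i then replicate (nat i) 1 else replicate (nat (- i)) (- 1))"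

text \<open>The element t_i; letter 1 is x and letter 2 is t.\<close>

definition tw :: "int \<Rightarrow> int list" where
  "tw i = xp i @ [2] @ winv (xp i)"

lemma ev_xp: assumes "\<And>a. g (- a) = - g a" shows "ev g (xp i) = zp i (g 1)"
proof -
  have "ev g (replicate n (- 1)) = - sum_list (replicate n (g 1))" for n
  proof (induction n)
    case (Suc n)
    then have "ev g (replicate (Suc n) (- 1)) = - (sum_list (replicate n (g 1)) + g 1)"
      by (simp add: assms minus_add)
    then show ?case by (simp only: sum_list_replicate_Suc)
  qed simp
  then show ?thesis by (simp add: xp_def zp_def)
qed

lemma ev_tw: assumes "\<And>a. g (- a) = - g a" shows "ev g (tw i) = zp i (g 1) + g 2 - zp i (g 1)"
  using ev_winv[of g, OF assms] ev_xp[of g, OF assms] by (simp add: tw_def add_diff_eq)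

lemma over_xp: "1 \<in> Gs \<Longrightarrow> over Gs (xp i)"
  by (auto simp: over_def xp_def)

lemma over_tw: "1 \<in> Gs \<Longrightarrow> 2 \<in> Gs \<Longrightarrow> over Gs (tw i)"
  by (simp add: tw_def over_xp)

section \<open>Torsion-freeness is inherited by HNN extensions\<close>

definition tfs :: "int set \<Rightarrow> int list set \<Rightarrow> bool" where
  "tfs Gs R \<longleftrightarrow> (\<forall>a\<in>Gs. 0 < a) \<and> (\<forall>r\<in>R. over Gs r) \<and> torsion_free Gs R"

abbreviation hrels :: "int \<Rightarrow> (int list \<times> int list) set \<Rightarrow> int list set" where
  "hrels e P \<equiv> (\<lambda>(a, b). hrel e a b) ` P"

lemma over_hrel: "over Gs (hrel e a b) \<longleftrightarrow> \<bar>e\<bar> \<in> Gs \<and> over Gs a \<and> over Gs b"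
  by (auto simp: hrel_def)

lemma tfs_hnn:
  assumes tf: "tfs Gs R" and E: "\<And>e. e \<in> E \<Longrightarrow> 0 < e" "Gs \<inter> E = {}"
    and P: "\<And>e a b. e \<in> E \<Longrightarrow> (a, b) \<in> P e \<Longrightarrow> over Gs a \<and> over Gs b"
    and iso: "\<And>e u v. e \<in> E \<Longrightarrow> (u, v) \<in> gpair (P e) \<Longrightarrow> val R u = 0 \<longleftrightarrow> val R v = 0"
  shows "tfs (Gs \<union> E) (R \<union> (\<Union>e\<in>E. hrels e (P e)))"
proof -
  interpret whnn Gs R E P
    using assms by unfold_locales (auto simp: tfs_def)
  have eq: "hR = R \<union> (\<Union>e\<in>E. hrels e (P e))"
    by (auto simp: hR_def)
  have "over (Gs \<union> E) r" if "r \<in> hR" for r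
    using that R_over P_over E over_mono[of Gs _ "Gs \<union> E"] by (fastforce simp: hR_def over_hrel)
  then show ?thesis
    using torsion_free_hR tf E(1) by (auto simp: tfs_def eq)
qed

lemma gpair_conv: "(u, v) \<in> gpair P \<Longrightarrow> (v, u) \<in> gpair (P\<inverse>)"
  by (induction rule: gpair.induct) (auto intro: gpair.intros)

text \<open>If one fixed \<open>h\<close> conjugates each pair correctly, the isomorphism condition
  is automatic. Most stable letters below are adjoined in this way; \<open>h = 0\<close> is the case
  of a letter that merely centralizes a subgroup.\<close>

lemma tfs_conj:
  assumes tf: "tfs Gs R" and e: "0 < e" "e \<notin> Gs"
    and P: "\<And>a b. (a, b) \<in> P \<Longrightarrow> over Gs a \<and> over Gs b \<and> h + val R a - h = val R b"
  shows "tfs (insert e Gs) (R \<union> hrels e P)"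
proof -
  have "val R u = 0 \<longleftrightarrow> val R v = 0" if "(u, v) \<in> gpair P" for u v
  proof -
    have "h + val R u - h = val R v"
      using gpair_ev[where g = "reg R", OF that] P reg_minus by blast
    then show ?thesis
      by (metis add.right_neutral add_left_cancel diff_add_cancel diff_self)
  qed
  then show ?thesis
    using tfs_hnn[OF tf, of "{e}" "\<lambda>_. P"] e P by auto
qed

lemma tfs_free: "tfs {1, 2} {}"
proof -
  have "tfs {} {}" by (auto simp: tfs_def torsion_free_def over_def)
  from tfs_conj[OF this, of 2 "{}"] tfs_conj[of "{2}" "{}" 1 "{}"] show ?thesis by simp
qed

text \<open>The endomorphism \<open>x \<mapsto> x\<^sup>m\<close>, \<open>t \<mapsto> t\<close> of the free group preserves reduced words.\<close>

definition fold_x :: "nat \<Rightarrow> int \<Rightarrow> int list" where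
  "fold_x m a = (if \<bar>a\<bar> = 1 then replicate m a else [a])"

text \<open>Britton's lemma over the trivial group, where the word between the two letters of a
  pinch must be empty.\<close>

lemma free_cancel:
  assumes "over {1, 2} w" "val {} w = 0" "w \<noteq> []"
  shows "\<exists>p f q. w = p @ [f, - f] @ q"
proof -
  interpret whnn "{}" "{}" "{1, 2}" "\<lambda>_. {}"
    by unfold_locales (auto elim: gpair.cases)
  have "hR = {}" by (simp add: hR_def)
  then consider "over {} w" | p f u q where "w = p @ [f] @ u @ [- f] @ q" "over {} u"
    using britton_word[of w] assms by auto
  then show ?thesis
  proof cases
    case 1
    with assms(3) show ?thesis by (cases w) auto
  next
    case 2
    then have "u = []" by (cases u) auto
    with 2 show ?thesis by auto
  qed
qed

text \<open>Each letter becomes a nonempty block of equal letters, and no block contains a letter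
  and its inverse. A cancelling pair therefore straddles two adjacent blocks, and their letters
  cancel in \<open>w\<close>.\<close>

lemma cancel_fold_x:
  assumes "0 < m" and "concat (map (fold_x m) w) = p @ [f, - f] @ q" and "f \<noteq> 0"
  shows "\<exists>p f q. w = p @ [f, - f] @ q"
  using assms(2)
proof (induction w arbitrary: p)
  case (Cons a w)
  have fold: "\<exists>k. fold_x m a = replicate (Suc k) a" for a
  proof (cases "\<bar>a\<bar> = 1")
    case True
    then show ?thesis using assms(1) by (intro exI[of _ "m - 1"]) (simp add: fold_x_def del: replicate.simps)
  qed (auto simp: fold_x_def intro: exI[of _ 0])
  have hd: "w \<noteq> [] \<Longrightarrow> hd (concat (map (fold_x m) w)) = hd w \<and> concat (map (fold_x m) w) \<noteq> []"
    using fold[of "hd w"] by (cases w) auto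
  obtain k where k: "fold_x m a = replicate (Suc k) a"
    using fold by blast
  have eq: "replicate (Suc k) a @ concat (map (fold_x m) w) = p @ f # - f # q"
    using Cons.prems k by simp
  have IH: "\<exists>p f q. a # w = p @ [f, - f] @ q" if "concat (map (fold_x m) w) = p' @ [f, - f] @ q" for p'
    using Cons.IH[OF that] by (metis append_Cons)
  obtain us where us: "replicate (Suc k) a = p @ us \<and> us @ concat (map (fold_x m) w) = f # - f # q \<or>
      concat (map (fold_x m) w) = us @ f # - f # q"
    using eq unfolding append_eq_append_conv2 by blast
  then show ?case
  proof
    assume us: "replicate (Suc k) a = p @ us \<and> us @ concat (map (fold_x m) w) = f # - f # q"
    have mem: "c = a" if "c \<in> set us" for c
    proof -
      have "c \<in> set (replicate (Suc k) a)" using us that by (metis Un_iff set_append)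
      then show ?thesis by auto
    qed
    consider "us = []" | c where "us = [c]" | c d vs where "us = c # d # vs"
      by (cases us rule: remdups_adj.cases) auto
    then show ?thesis
    proof cases
      case 1
      then show ?thesis using IH[of "[]"] us by simp
    next
      case 2
      then have "concat (map (fold_x m) w) = - a # q" using us mem by auto
      then have "w \<noteq> [] \<and> hd w = - a" using hd by force
      then obtain w' where "w = - a # w'" by (cases w) auto
      then show ?thesis by (intro exI[of _ "[]"] exI[of _ a] exI[of _ w']) simp
    next
      case 3
      then have "f = a" "- f = a" using us mem by auto
      then show ?thesis using assms(3) by simp
    qed
  qed (use IH in auto)
qed simp

lemma fold_x_inj:
  assumes "0 < m" "over {1, 2} w" "val {} (concat (map (fold_x m) w)) = 0"
  shows "val {} w = 0"
  using assms(2,3)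
proof (induction "length w" arbitrary: w rule: less_induct)
  case less
  let ?c = "concat (map (fold_x m) w)"
  have ov: "over {1, 2} ?c"
    using less.prems(1) by (induction w) (auto simp: over_def fold_x_def)
  have "?c \<noteq> []" if "w \<noteq> []" using that assms(1) by (cases w) (auto simp: fold_x_def)
  then consider "w = []" | p f q where "?c = p @ [f, - f] @ q"
    using free_cancel[OF ov less.prems(2)] by blast
  then show ?case
  proof cases
    case 2
    then have "f \<noteq> 0" using ov by auto
    from cancel_fold_x[OF assms(1) 2 this] obtain p f q where w: "w = p @ [f, - f] @ q" by blast
    have "val {} (fold_x m f) + val {} (fold_x m (- f)) = 0"
      using ev_xp[of "reg {}" "int m", OF reg_minus] ev_xp[of "reg {}" "- int m", OF reg_minus] assms(1)
      by (cases "f = 1"; cases "f = -1") (auto simp: fold_x_def xp_def reg_minus zp_minus)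
    then have "val {} ?c = val {} (concat (map (fold_x m) (p @ q)))"
      using add.assoc[of "val {} (fold_x m f)" "val {} (fold_x m (- f))" "val {} (concat (map (fold_x m) q))"]
      by (simp add: w)
    then have "val {} (p @ q) = 0"
      using less.hyps[of "p @ q"] less.prems by (simp add: w)
    then show ?thesis by (simp add: w reg_minus)
  qed simp
qed

section \<open>The presentation attached to a system of affine rules\<close>

text \<open>A rule \<open>(m, j, a, b)\<close> identifies \<open>m z + j\<close> with \<open>a z + b\<close> for every integer \<open>z\<close>.\<close>

type_synonym rule = "nat \<times> nat \<times> nat \<times> nat"

inductive_set reach :: "rule list \<Rightarrow> nat list \<Rightarrow> int set" for rs bs where
  reach_base: "s \<in> set bs \<Longrightarrow> int s \<in> reach rs bs"
| reach_fwd: "(m, j, a, b) \<in> set rs \<Longrightarrow> int m * z + int j \<in> reach rs bs \<Longrightarrow> int a * z + int b \<in> reach rs bs"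
| reach_bwd: "(m, j, a, b) \<in> set rs \<Longrightarrow> int a * z + int b \<in> reach rs bs \<Longrightarrow> int m * z + int j \<in> reach rs bs"

text \<open>Letters 1, 2, 3 are \<open>x, t, k\<close> and \<open>15 + i\<close> is the stable letter of the \<open>i\<close>-th rule.\<close>

definition rl :: "nat \<Rightarrow> int" where "rl i = 15 + int i"

fun rule_pairs :: "rule \<Rightarrow> (int list \<times> int list) list" where
  "rule_pairs (m, j, a, b) = [(xp (int m), xp (int a)), (tw (int j), tw (int b))]"

definition rels_K :: "rule list \<Rightarrow> int list list" where
  "rels_K rs = concat (map (\<lambda>i. map (\<lambda>(a, b). hrel (rl i) a b) (rule_pairs (rs ! i))) [0..<length rs])"

definition gens_L :: "rule list \<Rightarrow> nat list \<Rightarrow> int list list" where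
  "gens_L rs bs = map (\<lambda>s. tw (int s)) bs @ map (\<lambda>i. [rl i]) [0..<length rs]"

definition rels_P :: "rule list \<Rightarrow> nat list \<Rightarrow> int list list" where
  "rels_P rs bs = rels_K rs @ map (\<lambda>w. hrel 3 w w) (gens_L rs bs)"

definition letters_P :: "rule list \<Rightarrow> int list" where
  "letters_P rs = [1, 2, 3] @ map rl [0..<length rs]"

definition letters_K :: "rule list \<Rightarrow> int set" where
  "letters_K rs = {1, 2} \<union> rl ` {..<length rs}"

lemma set_letters_P: "set (letters_P rs) = insert 3 (letters_K rs)"
  by (auto simp: letters_P_def letters_K_def)

text \<open>Up to conjugation by x^j, the map x to x^m, t to t_j is the endomorphism x to x^m, t to
  t, injective for m > 0. Both x^m, t_j and x^a, t_b are thus free bases of the subgroups they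
  generate, so every rule letter induces an isomorphism.\<close>

lemma tfs_K:
  assumes rs: "\<And>m j a b. (m, j, a, b) \<in> set rs \<Longrightarrow> 0 < m \<and> 0 < a"
  shows "tfs (letters_K rs) (set (rels_K rs))"
proof -
  define P where "P e = set (rule_pairs (rs ! nat (e - 15)))" for e
  \<comment> \<open>The endomorphism x to x^m, t to t_j of the free group, with value 0 on integers
    that are not letters of it.\<close>
  define g where "g m j a = (if \<bar>a\<bar> = 1 then (if 0 < a then zp m (reg {} 1) else - zp m (reg {} 1))
    else if \<bar>a\<bar> = 2 then (if 0 < a then val {} (tw j) else - val {} (tw j)) else 0)" for m j a :: int
  have g_minus: "g m j (- a) = - g m j a" for m j a by (auto simp: g_def)
  have g_xt: "ev (g m j) (xp i) = val {} (xp (m * i))" "ev (g m j) [2] = val {} (tw j)" for m j i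
    by (simp_all add: ev_xp[of "g m j", OF g_minus] ev_xp[of "reg {}", OF reg_minus]) (simp_all add: g_def zp_mult)
  have g_x1: "ev (g m j) [1] = val {} (xp m)" for m j
    using g_xt(1)[of m j 1] by (simp add: xp_def)
  have g_inj: "val {} w = 0" if w: "over {1, 2} w" and "0 < m" and 0: "ev (g (int m) j) w = 0" for m j w
  proof -
    let ?h = "zp j (reg {} 1)"
    \<comment> \<open>Conjugation by x^j fixes x^m and turns t into t_j.\<close>
    have "ev (g (int m) j) w = ?h + val {} (concat (map (fold_x m) w)) - ?h"
      using w
    proof (induction w)
      case (Cons a w)
      have r: "val {} (replicate m 1) = zp (int m) (reg {} 1)" "val {} (replicate m (- 1)) = - zp (int m) (reg {} 1)"
        using ev_xp[of "reg {}" "int m", OF reg_minus] ev_xp[of "reg {}" "- int m", OF reg_minus] \<open>0 < m\<close>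
        by (simp_all add: xp_def zp_minus)
      have c: "?h + zp i (reg {} 1) - ?h = zp i (reg {} 1)" for i
        using zp_add[of j i "reg {} 1"] zp_add[of i j "reg {} 1"] by (simp add: add.commute diff_eq_eq)
      have "a = 1 \<or> a = -1 \<or> a = 2 \<or> a = -2" using Cons.prems by auto
      then have "g (int m) j a = ?h + val {} (fold_x m a) - ?h"
        using c[of "int m"] c[of "- int m"]
        by (elim disjE) (simp_all only: g_def fold_x_def, simp_all add: r zp_minus
          ev_tw[of "reg {}", OF reg_minus] reg_minus minus_add diff_conv_add_uminus add.assoc
          del: add_uminus_conv_diff map_replicate sum_list_replicate)
      then show ?case using Cons
        by (simp add: diff_conv_add_uminus add.assoc del: add_uminus_conv_diff)
    qed simp
    then have "?h + val {} (concat (map (fold_x m) w)) = ?h" using 0 by (simp add: diff_eq_eq)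
    then have "val {} (concat (map (fold_x m) w)) = 0" using add_left_imp_eq[of ?h _ 0] by simp
    then show ?thesis using fold_x_inj[OF \<open>0 < m\<close> w] by simp
  qed
  have pair: "\<exists>c. (c = [1] \<or> c = [2]) \<and> val {} u = ev (g (int m) (int j)) c \<and> val {} v = ev (g (int a) (int b)) c"
    if uv: "(u, v) \<in> set (rule_pairs (m, j, a, b))" for u v m j a b
  proof -
    consider "u = xp (int m)" "v = xp (int a)" | "u = tw (int j)" "v = tw (int b)"
      using uv by auto
    then show ?thesis
    proof cases
      case 1
      then show ?thesis by (intro exI[of _ "[1]"]) (simp only: g_x1, simp)
    next
      case 2
      then show ?thesis by (intro exI[of _ "[2]"]) (simp only: g_xt(2), simp)
    qed
  qed
  have gp: "\<exists>w. over {1, 2} w \<and> val {} u = ev (g (int m) (int j)) w \<and> val {} v = ev (g (int a) (int b)) w"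
    if "(u, v) \<in> gpair (set (rule_pairs (m, j, a, b)))" for u v m j a b
    using that
  proof (induction rule: gpair.induct)
    case gpair_Nil
    show ?case by (rule exI[of _ "[]"]) simp
  next
    case (gpair_pos u' v' u v)
    then obtain w where w: "over {1, 2} w" "val {} u = ev (g (int m) (int j)) w" "val {} v = ev (g (int a) (int b)) w"
      by blast
    obtain c where "c = [1] \<or> c = [2]" "val {} u' = ev (g (int m) (int j)) c" "val {} v' = ev (g (int a) (int b)) c"
      using pair[OF gpair_pos.hyps(1)] by blast
    then show ?case using w by (intro exI[of _ "c @ w"]) auto
  next
    case (gpair_neg u' v' u v)
    then obtain w where w: "over {1, 2} w" "val {} u = ev (g (int m) (int j)) w" "val {} v = ev (g (int a) (int b)) w"
      by blast
    obtain c where "c = [1] \<or> c = [2]" "val {} u' = ev (g (int m) (int j)) c" "val {} v' = ev (g (int a) (int b)) c"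
      using pair[OF gpair_neg.hyps(1)] by blast
    then show ?case using w ev_winv[of "g _ _", OF g_minus] by (intro exI[of _ "winv c @ w"]) auto
  qed
  have P_over: "over {1, 2} a \<and> over {1, 2} b" if "(a, b) \<in> P e" for a b e
    using that by (cases "rs ! nat (e - 15)") (auto simp: P_def over_tw over_xp)
  have "tfs ({1, 2} \<union> rl ` {..<length rs}) ({} \<union> (\<Union>e\<in>rl ` {..<length rs}. hrels e (P e)))"
  proof (rule tfs_hnn[OF tfs_free])
    fix e u v assume e: "e \<in> rl ` {..<length rs}" and uv: "(u, v) \<in> gpair (P e)"
    obtain m j a b where mj: "rs ! nat (e - 15) = (m, j, a, b)" by (cases "rs ! nat (e - 15)")
    have "rs ! nat (e - 15) \<in> set rs" using e by (auto simp: rl_def)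
    then have pos: "0 < m" "0 < a" using rs mj by auto
    obtain w where w: "over {1, 2} w" "val {} u = ev (g (int m) (int j)) w" "val {} v = ev (g (int a) (int b)) w"
      using gp[of u v m j a b] uv mj by (auto simp: P_def)
    have g_resp: "ev (g m j) w = 0" if "val {} w = 0" for m j
      using weq_respects[of "g m j" "{}" w "[]", OF g_minus] that by simp
    have "val {} u = 0 \<longleftrightarrow> val {} w = 0"
      unfolding w(2) using g_inj[OF w(1) pos(1)] g_resp by blast
    moreover have "val {} v = 0 \<longleftrightarrow> val {} w = 0"
      unfolding w(3) using g_inj[OF w(1) pos(2)] g_resp by blast
    ultimately show "val {} u = 0 \<longleftrightarrow> val {} v = 0" by simp
  qed (use P_over in \<open>auto simp: rl_def\<close>)
  moreover have "(\<Union>e\<in>rl ` {..<length rs}. hrels e (P e)) = set (rels_K rs)"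
    by (auto simp: rels_K_def P_def rl_def image_iff)
  ultimately show ?thesis by (simp add: letters_K_def)
qed

lemma over_gens_L: "w \<in> set (gens_L rs bs) \<Longrightarrow> over (letters_K rs) w"
  by (auto simp: gens_L_def letters_K_def over_tw rl_def)

lemma tfs_P:
  assumes "\<And>m j a b. (m, j, a, b) \<in> set rs \<Longrightarrow> 0 < m \<and> 0 < a"
  shows "tfs (insert 3 (letters_K rs)) (set (rels_P rs bs))"
proof -
  have "tfs (insert 3 (letters_K rs)) (set (rels_K rs) \<union> hrels 3 ((\<lambda>w. (w, w)) ` set (gens_L rs bs)))"
  proof (rule tfs_conj[OF tfs_K[OF assms], where h = 0])
    show "3 \<notin> letters_K rs" by (auto simp: letters_K_def rl_def)
  qed (auto simp: over_gens_L)
  moreover have "hrels 3 ((\<lambda>w. (w, w)) ` set (gens_L rs bs)) = (\<lambda>w. hrel 3 w w) ` set (gens_L rs bs)"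
    by force
  ultimately show ?thesis by (simp add: rels_P_def)
qed

text \<open>The letter carries x^(mz) to x^(az), and t_(mz+j) is the conjugate of t_j by
  x^(mz).\<close>

lemma rule_conj:
  assumes i: "i < length rs" "rs ! i = (m, j, a, b)" and R: "set (rels_K rs) \<subseteq> R"
  shows "reg R (rl i) + val R (tw (int m * z + int j)) - reg R (rl i) = val R (tw (int a * z + int b))"
proof -
  let ?r = "reg R (rl i)" and ?x = "reg R 1"
  have "val R (hrel (rl i) u v) = 0" if "(u, v) \<in> set (rule_pairs (rs ! i))" for u v
  proof -
    have "hrel (rl i) u v \<in> set (rels_K rs)"
      unfolding rels_K_def using i(1) that by force
    then show ?thesis using R by (intro val_relator) auto
  qed
  then have *: "?r + val R u - ?r = val R v" if "(u, v) \<in> set (rule_pairs (rs ! i))" for u v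
    using that ev_hrel[of "reg R", OF reg_minus] by blast
  have x: "?r + zp (int m) ?x - ?r = zp (int a) ?x"
    using *[of "xp (int m)" "xp (int a)"] by (simp add: i(2) ev_xp[of "reg R", OF reg_minus])
  have x': "?r + zp z (zp (int m) ?x) - ?r = zp (int a * z) ?x"
    using zp_conj[of ?r z "zp (int m) ?x"] by (simp only: x zp_mult)
  have t: "?r + val R (tw (int j)) - ?r = val R (tw (int b))"
    using *[of "tw (int j)" "tw (int b)"] by (simp add: i(2))
  have tw: "val R (tw (c + d)) = zp c ?x + val R (tw d) - zp c ?x" for c d
    by (simp add: ev_tw[of "reg R", OF reg_minus] zp_add diff_conv_add_uminus add.assoc minus_add del: add_uminus_conv_diff)
  have "?r + val R (tw (int m * z + int j)) - ?r
      = (?r + zp z (zp (int m) ?x) - ?r) + (?r + val R (tw (int j)) - ?r) - (?r + zp z (zp (int m) ?x) - ?r)"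
    by (simp add: tw zp_mult diff_conv_add_uminus add.assoc minus_add del: add_uminus_conv_diff)
  also have "\<dots> = zp (int a * z) ?x + val R (tw (int b)) - zp (int a * z) ?x"
    by (simp only: x' t)
  finally show ?thesis by (simp add: tw)
qed

lemma conj_cancel: "h + a - h = h + b - h \<longleftrightarrow> a = (b :: 'g::group_add)"
  by (simp add: diff_conv_add_uminus del: add_uminus_conv_diff)

text \<open>Rule letters commute with k, so commuting with k passes between t_(mz+j) and t_(az+b) in
  both directions, starting from the t_s with s in \<open>bs\<close>.\<close>

lemma k_commutes:
  assumes R: "set (rels_P rs bs) \<subseteq> R" and i: "i \<in> reach rs bs"
  shows "reg R 3 + val R (tw i) - reg R 3 = val R (tw i)"
proof -
  have L: "reg R 3 + val R w - reg R 3 = val R w" if "w \<in> set (gens_L rs bs)" for w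
  proof -
    have "hrel 3 w w \<in> R" using R that by (auto simp: rels_P_def)
    then show ?thesis using ev_hrel[of "reg R", OF reg_minus] val_relator by blast
  qed
  have K: "set (rels_K rs) \<subseteq> R" using R by (auto simp: rels_P_def)
  have r: "reg R 3 + reg R (rl i) = reg R (rl i) + reg R 3" if "i < length rs" for i
    using L[of "[rl i]"] that by (auto simp: gens_L_def diff_eq_eq)
  have conj: "reg R 3 + (reg R (rl i) + g - reg R (rl i)) - reg R 3 = reg R (rl i) + (reg R 3 + g - reg R 3) - reg R (rl i)"
    if "i < length rs" for i g
  proof -
    have "reg R 3 + (reg R (rl i) + g - reg R (rl i)) - reg R 3
        = (reg R 3 + reg R (rl i)) + g - (reg R 3 + reg R (rl i))"
      by (simp add: diff_conv_add_uminus add.assoc minus_add del: add_uminus_conv_diff)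
    also have "\<dots> = reg R (rl i) + (reg R 3 + g - reg R 3) - reg R (rl i)"
      unfolding r[OF that] by (simp add: diff_conv_add_uminus add.assoc minus_add del: add_uminus_conv_diff)
    finally show ?thesis .
  qed
  show ?thesis using i
  proof (induction rule: reach.induct)
    case (reach_base s)
    then show ?case using L[of "tw (int s)"] by (simp add: gens_L_def)
  next
    case (reach_fwd m j a b z)
    then obtain i where i: "i < length rs" "rs ! i = (m, j, a, b)" by (auto simp: in_set_conv_nth)
    have "reg R 3 + val R (tw (int a * z + int b)) - reg R 3
        = reg R 3 + (reg R (rl i) + val R (tw (int m * z + int j)) - reg R (rl i)) - reg R 3"
      by (simp only: rule_conj[OF i K])
    also have "\<dots> = reg R (rl i) + (reg R 3 + val R (tw (int m * z + int j)) - reg R 3) - reg R (rl i)"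
      by (rule conj[OF i(1)])
    also have "\<dots> = val R (tw (int a * z + int b))"
      by (simp only: reach_fwd.IH rule_conj[OF i K])
    finally show ?case .
  next
    case (reach_bwd m j a b z)
    then obtain i where i: "i < length rs" "rs ! i = (m, j, a, b)" by (auto simp: in_set_conv_nth)
    have "reg R (rl i) + (reg R 3 + val R (tw (int m * z + int j)) - reg R 3) - reg R (rl i)
        = reg R (rl i) + val R (tw (int m * z + int j)) - reg R (rl i)"
      using reach_bwd.IH by (simp only: conj[OF i(1), symmetric] rule_conj[OF i K])
    then show ?case by (simp only: conj_cancel)
  qed
qed

section \<open>Transfer of relations between commuting groups\<close>

lemma hnn_embed:
  assumes Gs: "\<And>a. a \<in> Gs \<Longrightarrow> 0 < a" and R: "\<And>r. r \<in> R \<Longrightarrow> over Gs r"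
    and E: "\<And>e. e \<in> E \<Longrightarrow> 0 < e" "Gs \<inter> E = {}"
    and P: "\<And>e a b. e \<in> E \<Longrightarrow> (a, b) \<in> P e \<Longrightarrow> over Gs a \<and> over Gs b"
    and iso: "\<And>e u v. e \<in> E \<Longrightarrow> (u, v) \<in> gpair (P e) \<Longrightarrow> val R u = 0 \<longleftrightarrow> val R v = 0"
    and w: "over Gs w" "val (R \<union> (\<Union>e\<in>E. hrels e (P e))) w = 0"
  shows "val R w = 0"
proof -
  interpret whnn Gs R E P
    using assms by unfold_locales auto
  have eq: "hR = R \<union> (\<Union>e\<in>E. hrels e (P e))"
    by (auto simp: hR_def)
  show ?thesis using embedding[OF w(1)] w(2) by (simp add: eq)
qed

text \<open>Prescribes a homomorphism on the positive letters; oddness then holds by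
  construction.\<close>

definition ext :: "(int \<Rightarrow> 'g::group_add) \<Rightarrow> int \<Rightarrow> 'g" where
  "ext f a = (if 0 < a then f a else if a < 0 then - f (- a) else 0)"

lemma ext_minus: "ext f (- a) = - ext f a"
  by (auto simp: ext_def)

lemma ext_pos [simp]: "0 < a \<Longrightarrow> ext f a = f a" "0 < a \<Longrightarrow> ext f (- a) = - f a"
  by (auto simp: ext_def)

lemma ev_over_cong:
  assumes "\<And>a. f (- a) = - f a" "\<And>a. g (- a) = - g a" "\<And>a. a \<in> Gs \<Longrightarrow> f a = g a" "over Gs w"
  shows "ev f w = ev g w"
  using assms(4)
proof (induction w)
  case (Cons a w)
  have "f a = g a" using Cons.prems assms(1)[of a] assms(2)[of a] assms(3)[of "\<bar>a\<bar>"]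
    by (cases "0 \<le> a") auto
  with Cons show ?case by simp
qed simp

text \<open>The relation \<open>rho i\<close> involves only the letter 3 and \<open>t_i\<close>.\<close>

definition rho_family :: "(int \<Rightarrow> int list) \<Rightarrow> bool" where
  "rho_family rho \<longleftrightarrow> (\<forall>i. over {1, 2, 3} (rho i)) \<and>
     (\<forall>(g :: int \<Rightarrow> int list set sym) g' i j. (\<forall>a. g (- a) = - g a) \<longrightarrow> (\<forall>a. g' (- a) = - g' a) \<longrightarrow>
        g 3 = g' 3 \<longrightarrow> ev g (tw i) = ev g' (tw j) \<longrightarrow> ev g (rho i) = ev g' (rho j))"

definition rho2 :: "int \<Rightarrow> int list" where
  "rho2 i = hrel 3 (tw i @ [3] @ winv (tw i)) (tw i @ [3] @ winv (tw i))"

definition rho3 :: "nat \<Rightarrow> int \<Rightarrow> int list" where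
  "rho3 n i = tw i @ replicate n 3 @ winv (tw i) @ winv (replicate n 3)"

lemma rho_family_2: "rho_family rho2"
  unfolding rho_family_def
proof (intro conjI allI impI)
  fix g g' :: "int \<Rightarrow> int list set sym" and i j
  assume "\<forall>a. g (- a) = - g a" "\<forall>a. g' (- a) = - g' a" "g 3 = g' 3" "ev g (tw i) = ev g' (tw j)"
  then show "ev g (rho2 i) = ev g' (rho2 j)"
    using ev_winv[of g] ev_winv[of g'] by (simp add: rho2_def hrel_def)
qed (simp add: rho2_def over_hrel over_tw)

lemma rho_family_3: "rho_family (rho3 n)"
  unfolding rho_family_def
proof (intro conjI allI impI)
  fix g g' :: "int \<Rightarrow> int list set sym" and i j
  assume "\<forall>a. g (- a) = - g a" "\<forall>a. g' (- a) = - g' a" "g 3 = g' 3" "ev g (tw i) = ev g' (tw j)"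
  then show "ev g (rho3 n i) = ev g' (rho3 n j)"
    using ev_winv[of g] ev_winv[of g'] by (simp add: rho3_def)
qed (auto simp: rho3_def over_tw over_def[of _ "replicate n _"])

lemma ev_rho3:
  assumes "\<And>a. g (- a) = - g a"
  shows "ev g (rho3 n i) = 0 \<longleftrightarrow> ev g (tw i) + zp (int n) (g 3) - ev g (tw i) = zp (int n) (g 3)"
proof -
  have "ev g (rho3 n i) = (ev g (tw i) + zp (int n) (g 3) - ev g (tw i)) - zp (int n) (g 3)"
    using ev_winv[of g, OF assms]
    by (simp add: rho3_def zp_of_nat diff_conv_add_uminus add.assoc del: add_uminus_conv_diff)
  then show ?thesis by simp
qed

definition shift_pairs :: "(int list \<times> int list) set" where
  "shift_pairs = {([3], [3]), ([1], [1]), ([2], [1, 2, -1])}"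

text \<open>Letter 8 acts on \<open>\<langle>x, t, k | rho i (i \<in> \<int>)\<rangle>\<close> by the automorphism \<open>t_i \<mapsto> t_{i+1}\<close>.\<close>

lemma shift_embed:
  assumes rho: "rho_family rho" and w: "over {1, 2, 3} w" "val (range rho \<union> hrels 8 shift_pairs) w = 0"
  shows "val (range rho) w = 0"
proof (rule hnn_embed[of "{1, 2, 3}" "range rho" "{8}" "\<lambda>_. shift_pairs"])
  let ?R = "range rho"
  \<comment> \<open>The endomorphism fixing x and k and sending t to t_s, hence t_i to t_(i+s). Its
    cases s = 1 and s = -1 give the two directions of the isomorphism condition.\<close>
  define g where "g s = ext (\<lambda>a. if a = 2 then zp s (reg ?R 1) + reg ?R 2 - zp s (reg ?R 1) else reg ?R a)" for s
  have g_minus: "g s (- a) = - g s a" for s a by (simp add: g_def ext_minus)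
  have g_tw: "ev (g s) (tw i) = val ?R (tw (i + s))" for s i
    by (simp add: ev_tw[of "g s", OF g_minus] ev_tw[of "reg _", OF reg_minus])
       (simp add: g_def zp_add diff_conv_add_uminus add.assoc minus_add del: add_uminus_conv_diff)
  have g_rel: "ev (g s) r = 0" if r: "r \<in> ?R" for r s
  proof -
    obtain i where i: "r = rho i" using r by auto
    have "ev (g s) (rho i) = val ?R (rho (i + s))"
      using rho g_minus reg_minus g_tw by (auto simp: rho_family_def) (simp add: g_def)
    then show ?thesis by (simp add: i val_relator)
  qed
  show "val ?R u = 0 \<longleftrightarrow> val ?R v = 0" if uv: "(u, v) \<in> gpair shift_pairs" for u v
  proof
    show "val ?R v = 0" if "val ?R u = 0"
      by (rule gpair_hom[of u v shift_pairs "g 1" ?R, OF uv g_minus g_rel _ that])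
         (auto simp: shift_pairs_def g_def reg_minus add_diff_eq)
    show "val ?R u = 0" if "val ?R v = 0"
      by (rule gpair_hom[of v u "shift_pairs\<inverse>" "g (- 1)" ?R, OF gpair_conv[OF uv] g_minus g_rel _ that])
         (auto simp: shift_pairs_def g_def reg_minus zp_minus add.assoc diff_conv_add_uminus simp del: add_uminus_conv_diff)
  qed
qed (use rho w in \<open>auto simp: rho_family_def shift_pairs_def\<close>)

section \<open>Finitely presented groups in which a whole family of relations holds\<close>

fun stage_rels :: "int \<times> (int list \<times> int list) list \<Rightarrow> int list list" where
  "stage_rels (e, ps) = map (\<lambda>(a, b). hrel e a b) ps"

lemma set_stage_rels: "set (stage_rels s) = (case s of (e, ps) \<Rightarrow> hrels e (set ps))"
  by (cases s) simp

declare stage_rels.simps [simp del]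

abbreviation cm :: "int list \<Rightarrow> (int list \<times> int list) list" where
  "cm ps \<equiv> map (\<lambda>p. ([p], [p])) ps"

text \<open>Letters 4, 5, 6 copy x, t, k for the family \<open>rho2\<close>; 7 is t k t^-1, and 8 is
  an element d that commutes with x and k and satisfies x t x^-1 = d t d^-1. Then t_i = d^i t d^-i,
  and since d commutes with k, the relation for i = 0 implies that for every i. Letters 9, 10, 11,
  12 play the parts of x, t, k, d for \<open>rho3\<close>. All these letters commute with
  \<open>ps\<close>. The order of the list makes each letter a stable letter over the previous ones;
  13 and 14 remain for the transfer, and rule letters start at 15.\<close>

definition stages :: "int list \<Rightarrow> nat \<Rightarrow> (int \<times> (int list \<times> int list) list) list" where
  "stages ps n = [(6, cm ps), (7, cm ps @ [([6], [6])]), (5, cm ps @ [([6], [7])]), (8, cm ps @ [([6], [6])]),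
     (4, cm ps @ [([8], [8]), ([5], [8, 5, -8])]),
     (11, cm ps), (10, cm ps @ [(replicate n 11, replicate n 11)]), (12, cm ps @ [([11], [11])]),
     (9, cm ps @ [([12], [12]), ([10], [12, 10, -12])])]"

definition rels_B :: "int list \<Rightarrow> nat \<Rightarrow> int list list" where
  "rels_B ps n = concat (map stage_rels (stages ps n))"

lemma set_rels_B: "set (rels_B ps n) = (\<Union>(e, q)\<in>set (stages ps n). hrels e (set q))"
  by (simp add: rels_B_def set_stage_rels)

text \<open>The relators \<open>RP\<close> stay arbitrary because two towers are compared: one over
  \<open>rels_P\<close>, and one over the same relators together with all \<open>rho2 i\<close> and
  \<open>rho3 n i\<close>.\<close>

locale tower =
  fixes ps :: "int list" and RP :: "int list set" and n :: nat
  assumes ps_pos: "p \<in> set ps \<Longrightarrow> 0 < p \<and> p \<notin> {4..14}" and ps_123: "{1, 2, 3} \<subseteq> set ps"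
    and RP_over: "r \<in> RP \<Longrightarrow> over (set ps) r"
begin

definition B where "B = RP \<union> set (rels_B ps n)"

definition letters_B where "letters_B = {4..12} \<union> set ps"

text \<open>All stages but one are covered by \<open>tfs_conj\<close>: most letters centralize a
  subgroup, while 4 and 9 act on theirs as conjugation by 8 and 12. Only letter 5, carrying 6 to 7,
  needs a separate argument.\<close>

lemma tfs_B:
  assumes tf: "tfs (set ps) RP"
  shows "tfs letters_B B"
proof -
  let ?c = "set (cm ps)"
  have P: "p \<in> set ps \<Longrightarrow> 0 < p" "p \<in> set ps \<Longrightarrow> p \<notin> {4..14}" for p using ps_pos by auto
  define R6 where "R6 = RP \<union> hrels 6 ?c"
  define R7 where "R7 = R6 \<union> hrels 7 (?c \<union> {([6], [6])})"
  define R5 where "R5 = R7 \<union> hrels 5 (?c \<union> {([6], [7])})"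
  define R8 where "R8 = R5 \<union> hrels 8 (?c \<union> {([6], [6])})"
  define R4 where "R4 = R8 \<union> hrels 4 (?c \<union> {([8], [8]), ([5], [8, 5, -8])})"
  define R11 where "R11 = R4 \<union> hrels 11 ?c"
  define R10 where "R10 = R11 \<union> hrels 10 (?c \<union> {(replicate n 11, replicate n 11)})"
  define R12 where "R12 = R10 \<union> hrels 12 (?c \<union> {([11], [11])})"
  define R9 where "R9 = R12 \<union> hrels 9 (?c \<union> {([12], [12]), ([10], [12, 10, -12])})"
  have abs_p: "p \<in> set ps \<Longrightarrow> \<bar>p\<bar> = p" for p using P(1)[of p] by simp
  have t6: "tfs ({6} \<union> set ps) R6"
    unfolding R6_def using tfs_conj[OF tf, of 6 ?c 0] P by fastforce
  have t7: "tfs ({7, 6} \<union> set ps) R7"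
    unfolding R7_def using tfs_conj[OF t6, of 7 "?c \<union> {([6], [6])}" 0] P by fastforce
  have comm: "reg R e + reg R p - reg R e = reg R p" if "hrels e ?c \<subseteq> R" "p \<in> set ps" for R e p
  proof -
    have "val R (hrel e [p] [p]) = 0" using that by (intro val_relator) force
    then show ?thesis using ev_hrel[of "reg R" e "[p]" "[p]", OF reg_minus] by simp
  qed
  have t5: "tfs ({7, 6} \<union> set ps \<union> {5}) (R7 \<union> (\<Union>e\<in>{5}. hrels e (?c \<union> {([6], [7])})))"
  proof (rule tfs_hnn[OF t7])
    \<comment> \<open>The automorphism exchanging 6 and 7, which exists since both commute with
      \<open>ps\<close> and with each other.\<close>
    define g where "g = ext (\<lambda>a. if a = 6 then reg R7 7 else if a = 7 then reg R7 6 else reg R7 a)"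
    have g_minus: "g (- a) = - g a" for a by (simp add: g_def ext_minus)
    have g_ps: "g p = reg R7 p" if "p \<in> set ps" for p
      using P[OF that] by (auto simp: g_def)
    have c6: "reg R7 6 + reg R7 p - reg R7 6 = reg R7 p" if "p \<in> set ps" for p
      by (rule comm) (use that in \<open>auto simp: R7_def R6_def\<close>)
    have c7: "reg R7 7 + reg R7 p - reg R7 7 = reg R7 p" if "p \<in> set ps" for p
      by (rule comm) (use that in \<open>auto simp: R7_def\<close>)
    have c76: "reg R7 7 + reg R7 6 - reg R7 7 = reg R7 6"
    proof -
      have "val R7 (hrel 7 [6] [6]) = 0" by (rule val_relator) (auto simp: R7_def)
      then show ?thesis using ev_hrel[of "reg R7" 7 "[6]" "[6]", OF reg_minus] by simp
    qed
    then have c67: "reg R7 6 + reg R7 7 - reg R7 6 = reg R7 7"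
      by (simp add: diff_eq_eq)
    have g_rel: "ev g r = 0" if "r \<in> R7" for r
    proof -
      consider "r \<in> RP" | p where "p \<in> set ps" "r = hrel 6 [p] [p] \<or> r = hrel 7 [p] [p]" | "r = hrel 7 [6] [6]"
        using \<open>r \<in> R7\<close> by (auto simp: R7_def R6_def)
      then show ?thesis
      proof cases
        case 1
        then have "ev g r = val R7 r"
          using ev_over_cong[of g "reg R7" "set ps", OF g_minus reg_minus g_ps RP_over] by blast
        with 1 show ?thesis using val_relator[of r R7] by (simp add: R7_def R6_def)
      next
        case 2
        have "ev g (hrel 6 [p] [p]) = 0" "ev g (hrel 7 [p] [p]) = 0"
          using 2(1) c6 c7 by (simp_all add: ev_hrel[of g, OF g_minus] g_ps) (simp_all add: g_def)
        then show ?thesis using 2(2) by auto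
      next
        case 3
        then show ?thesis using c67 by (simp add: ev_hrel[of g, OF g_minus]) (simp add: g_def)
      qed
    qed
    show "val R7 u = 0 \<longleftrightarrow> val R7 v = 0" if uv: "(u, v) \<in> gpair (?c \<union> {([6], [7])})" for u v
    proof
      show "val R7 v = 0" if "val R7 u = 0"
        by (rule gpair_hom[of u v _ g R7, OF uv g_minus g_rel _ that]) (auto simp: g_ps, simp add: g_def)
      show "val R7 u = 0" if "val R7 v = 0"
        by (rule gpair_hom[of v u _ g R7, OF gpair_conv[OF uv] g_minus g_rel _ that]) (auto simp: g_ps, simp add: g_def)
    qed
  qed (use P(2)[of 5] in \<open>auto simp: abs_p\<close>)
  then have t5: "tfs ({5, 7, 6} \<union> set ps) R5"
    by (simp add: R5_def Un_commute insert_commute)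
  have t8: "tfs ({8, 5, 7, 6} \<union> set ps) R8"
    unfolding R8_def using tfs_conj[OF t5, of 8 "?c \<union> {([6], [6])}" 0] P by fastforce
  have t4: "tfs ({4, 8, 5, 7, 6} \<union> set ps) R4"
  proof -
    have "reg R8 8 + reg R8 p - reg R8 8 = reg R8 p" if "p \<in> set ps" for p
      by (rule comm) (use that in \<open>auto simp: R8_def\<close>)
    then show ?thesis
      unfolding R4_def using tfs_conj[OF t8, of 4 "?c \<union> {([8], [8]), ([5], [8, 5, -8])}" "reg R8 8"] P
      by (fastforce simp: reg_minus add_diff_eq)
  qed
  have t11: "tfs ({11, 4, 8, 5, 7, 6} \<union> set ps) R11"
    unfolding R11_def using tfs_conj[OF t4, of 11 ?c 0] P by fastforce
  have t10: "tfs ({10, 11, 4, 8, 5, 7, 6} \<union> set ps) R10"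
    unfolding R10_def using tfs_conj[OF t11, of 10 "?c \<union> {(replicate n 11, replicate n 11)}" 0] P 
    by (fastforce simp: over_def[of _ "replicate n _"])
  have t12: "tfs ({12, 10, 11, 4, 8, 5, 7, 6} \<union> set ps) R12"
    unfolding R12_def using tfs_conj[OF t10, of 12 "?c \<union> {([11], [11])}" 0] P by fastforce
  have t9: "tfs ({9, 12, 10, 11, 4, 8, 5, 7, 6} \<union> set ps) R9"
  proof -
    have "reg R12 12 + reg R12 p - reg R12 12 = reg R12 p" if "p \<in> set ps" for p
      by (rule comm) (use that in \<open>auto simp: R12_def\<close>)
    then show ?thesis
      unfolding R9_def using tfs_conj[OF t12, of 9 "?c \<union> {([12], [12]), ([10], [12, 10, -12])}" "reg R12 12"] P
      by (fastforce simp: reg_minus add_diff_eq)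
  qed
  moreover have "R9 = B"
    unfolding B_def set_rels_B stages_def R9_def R12_def R10_def R11_def R4_def R8_def R5_def R7_def R6_def
    by (simp add: image_Un insert_commute Un_ac)
  moreover have "{9, 12, 10, 11, 4, 8, 5, 7, 6} = {4..12::int}" by auto
  ultimately show ?thesis by (simp add: letters_B_def)
qed

end

lemma zp_commute:
  assumes "a + b = b + (a :: 'g::group_add)"
  shows "zp i a + b = b + zp i a"
proof -
  have "b + zp i a - b = zp i a"
    using zp_conj[of b i a] assms by (metis add_diff_cancel)
  then show ?thesis by (simp add: diff_eq_eq)
qed

lemma zp_sum_commute:
  assumes ab: "a + b = b + (a :: 'g::group_add)"
  shows "zp (int n) (a + b) = zp (int n) a + zp (int n) b"
proof (induction n)
  case (Suc n)
  have "zp (int (Suc n)) (a + b) = zp (int n) a + (zp (int n) b + a) + b"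
    using zp_succ[of "int n" "a + b"] Suc.IH by (simp add: add.commute add.assoc)
  also have "zp (int n) b + a = a + zp (int n) b"
    by (rule zp_commute) (simp add: ab)
  finally show ?case
    using zp_succ[of "int n" a] zp_succ[of "int n" b] by (simp add: add.commute[of 1] add.assoc)
qed simp

text \<open>Conjugation by x advances both sides from i to i + 1, the right one because powers of d
  commute with x.\<close>

lemma conj_shift:
  fixes x t d :: "'g::group_add"
  assumes dx: "d + x = x + d" and xt: "x + t - x = d + t - d"
  shows "zp i x + t - zp i x = zp i d + t - zp i d"
proof -
  have f: "zp (i + 1) x + t - zp (i + 1) x = x + (zp i x + t - zp i x) - x" for i
    using zp_add[of 1 i x] by (simp add: add.commute diff_conv_add_uminus add.assoc minus_add del: add_uminus_conv_diff)
  have h: "zp (i + 1) d + t - zp (i + 1) d = x + (zp i d + t - zp i d) - x" for i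
  proof -
    have c: "x + zp i d = zp i d + x" using zp_commute[OF dx] by simp
    have "zp (i + 1) d + t - zp (i + 1) d = zp i d + (d + t - d) - zp i d"
      by (simp add: zp_succ diff_conv_add_uminus add.assoc minus_add del: add_uminus_conv_diff)
    also have "\<dots> = (zp i d + x) + t - (zp i d + x)"
      by (simp only: xt[symmetric]) (simp add: diff_conv_add_uminus add.assoc minus_add del: add_uminus_conv_diff)
    also have "\<dots> = x + (zp i d + t - zp i d) - x"
      by (simp only: c[symmetric]) (simp add: diff_conv_add_uminus add.assoc minus_add del: add_uminus_conv_diff)
    finally show ?thesis .
  qed
  show ?thesis
  proof (induction i rule: int_induct[of _ 0])
    case (step1 i)
    then show ?case by (simp only: f h)
  next
    case (step2 i)
    then show ?case using f[of "i - 1"] h[of "i - 1"] by (simp add: conj_cancel)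
  qed simp
qed

text \<open>The order is reversed at negative letters so that the doubled inverse is the inverse of
  the doubled letter.\<close>

definition dbl :: "(int \<Rightarrow> int) \<Rightarrow> int list \<Rightarrow> int list" where
  "dbl \<alpha> w = concat (map (\<lambda>a. if 0 < a then [\<alpha> a, a] else [a, \<alpha> a]) w)"

definition spairs :: "(int \<Rightarrow> int) \<Rightarrow> (int list \<times> int list) list" where
  "spairs \<alpha> = [([\<alpha> 1], [\<alpha> 1, 1]), ([\<alpha> 2], [\<alpha> 2, 2]), ([\<alpha> 3], [\<alpha> 3, 3])]"

lemma gpair_dbl:
  assumes "over {1, 2, 3} w" and "\<And>a. \<alpha> (- a) = - \<alpha> a"
  shows "(map \<alpha> w, dbl \<alpha> w) \<in> gpair (set (spairs \<alpha>))"
  using assms(1)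
proof (induction w)
  case (Cons a w)
  let ?P = "set (spairs \<alpha>)"
  have IH: "(map \<alpha> w, dbl \<alpha> w) \<in> gpair ?P" using Cons by simp
  show ?case
  proof (cases "0 < a")
    case True
    then have "([\<alpha> a], [\<alpha> a, a]) \<in> ?P" using Cons.prems by (auto simp: spairs_def)
    from gpair_pos[OF this IH] True show ?thesis by (simp add: dbl_def)
  next
    case False
    then have "([\<alpha> (- a)], [\<alpha> (- a), - a]) \<in> ?P" using Cons.prems by (auto simp: spairs_def abs_if split: if_splits)
    from gpair_neg[OF this IH] False show ?thesis by (simp add: dbl_def assms(2))
  qed
qed (simp add: dbl_def gpair_Nil)

lemma gpair_spairs:
  assumes "(u, v) \<in> gpair (set (spairs \<alpha>))" and "\<And>a. \<alpha> (- a) = - \<alpha> a"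
  shows "\<exists>w. over {1, 2, 3} w \<and> u = map \<alpha> w \<and> v = dbl \<alpha> w"
  using assms(1)
proof (induction rule: gpair.induct)
  case gpair_Nil
  show ?case by (rule exI[of _ "[]"]) (simp add: dbl_def)
next
  case (gpair_pos a b u v)
  then obtain w where "over {1, 2, 3} w" "u = map \<alpha> w" "v = dbl \<alpha> w" by blast
  moreover obtain c where "c \<in> {1, 2, 3}" "a = [\<alpha> c]" "b = [\<alpha> c, c]"
    using gpair_pos.hyps(1) by (auto simp: spairs_def)
  ultimately show ?case by (intro exI[of _ "c # w"]) (auto simp: dbl_def)
next
  case (gpair_neg a b u v)
  then obtain w where "over {1, 2, 3} w" "u = map \<alpha> w" "v = dbl \<alpha> w" by blast
  moreover obtain c where "c \<in> {1, 2, 3}" "a = [\<alpha> c]" "b = [\<alpha> c, c]"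
    using gpair_neg.hyps(1) by (auto simp: spairs_def)
  ultimately show ?case by (intro exI[of _ "- c # w"]) (auto simp: dbl_def assms(2))
qed

lemma commute_minus: "a + b = b + a \<Longrightarrow> - a + b = b + - (a :: 'g::group_add)"
  by (metis add.assoc add.right_neutral add_left_imp_eq add.left_neutral right_minus left_minus)

definition \<alpha>2 :: "int \<Rightarrow> int" where "\<alpha>2 = ext (\<lambda>a. a + 3)"
definition \<alpha>3 :: "int \<Rightarrow> int" where "\<alpha>3 = ext (\<lambda>a. a + 8)"

lemma \<alpha>_minus: "\<alpha>2 (- a) = - \<alpha>2 a" "\<alpha>3 (- a) = - \<alpha>3 a"
  by (simp_all add: \<alpha>2_def \<alpha>3_def ext_minus)

lemma \<alpha>_simps [simp]: "\<alpha>2 1 = 4" "\<alpha>2 2 = 5" "\<alpha>2 3 = 6" "\<alpha>3 1 = 9" "\<alpha>3 2 = 10" "\<alpha>3 3 = 11"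
  by (simp_all add: \<alpha>2_def \<alpha>3_def)

definition rels_S :: "int list list" where
  "rels_S = stage_rels (13, spairs \<alpha>2) @ stage_rels (14, spairs \<alpha>3)"

lemma tw_0: "tw 0 = [2]"
  by (simp add: tw_def xp_def)

lemma rho2_0: "rho2 0 = hrel 3 [2, 3, -2] [2, 3, -2]"
  by (simp add: rho2_def tw_0)

context tower
begin

definition G where "G = B \<union> set rels_S"

lemma B_stage:
  assumes "(e, q) \<in> set (stages ps n)" "(a, b) \<in> set q" "B \<subseteq> R"
  shows "reg R e + val R a - reg R e = val R b"
proof -
  have "hrel e a b \<in> B" using assms(1,2) by (force simp: B_def set_rels_B)
  then have "val R (hrel e a b) = 0" using assms(3) by (intro val_relator) auto
  then show ?thesis using ev_hrel[of "reg R", OF reg_minus] by simp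
qed

lemma B_commute:
  assumes "e \<in> {4..12}" "p \<in> set ps" "B \<subseteq> R"
  shows "reg R e + reg R p = reg R p + reg R e"
proof -
  have "e = 4 \<or> e = 5 \<or> e = 6 \<or> e = 7 \<or> e = 8 \<or> e = 9 \<or> e = 10 \<or> e = 11 \<or> e = 12" using assms(1) by auto
  then have "\<exists>q. (e, cm ps @ q) \<in> set (stages ps n)"
    unfolding stages_def by (elim disjE) auto
  then obtain q where "(e, cm ps @ q) \<in> set (stages ps n)" by blast
  from B_stage[OF this, of "[p]" "[p]" R] assms show ?thesis by (simp add: diff_eq_eq)
qed

lemma B_respects:
  assumes g: "\<And>a. g (- a) = - g a"
    and st: "\<And>e q a b. (e, q) \<in> set (stages ps n) \<Longrightarrow> (a, b) \<in> set q \<Longrightarrow> g e + ev g a - g e = ev g b"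
    and RP: "\<And>r. r \<in> RP \<Longrightarrow> ev g r = 0" and r: "r \<in> B"
  shows "ev g r = 0"
proof (cases "r \<in> RP")
  case False
  then obtain e q a b where "(e, q) \<in> set (stages ps n)" "(a, b) \<in> set q" "r = hrel e a b"
    using r by (auto simp: B_def set_rels_B)
  then show ?thesis using st ev_hrel[of g, OF g] by blast
qed (use RP in simp)

lemma ev_zero: "(\<And>a. g (- a) = - g a) \<Longrightarrow> (\<And>p. p \<in> set ps \<Longrightarrow> g p = 0) \<Longrightarrow> over (set ps) w \<Longrightarrow> ev g w = 0"
  using ev_over_cong[of g "\<lambda>_. 0" "set ps" w] by (simp add: sum_list_triv)

text \<open>Killing the added letters respects all stage relations, so the group of
  \<open>RP\<close> is a retract.\<close>

lemma B_retract:
  assumes "over (set ps) w" "val B w = 0"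
  shows "val RP w = 0"
proof -
  define g where "g = ext (\<lambda>a. if a \<in> set ps then reg RP a else 0)"
  have g_minus: "g (- a) = - g a" for a by (simp add: g_def ext_minus)
  have g_ps: "g p = reg RP p" if "p \<in> set ps" for p using that ps_pos by (simp add: g_def)
  have g_0: "g e = 0" if "e \<in> {4..14}" for e using that ps_pos[of e] by (auto simp: g_def)
  have "ev g r = 0" if "r \<in> B" for r
  proof (rule B_respects[where g = g, OF g_minus _ _ that])
    show "ev g r = 0" if "r \<in> RP" for r
      using ev_over_cong[of g "reg RP" "set ps" r, OF g_minus reg_minus g_ps RP_over[OF that]] that
      by (simp add: val_relator)
  qed (auto simp: stages_def g_0 g_minus sum_list_triv)
  then have "ev g w = 0"
    using weq_respects[of g B w "[]", OF g_minus] assms(2) by simp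
  then show ?thesis
    using ev_over_cong[of g "reg RP" "set ps" w, OF g_minus reg_minus g_ps assms(1)] by simp
qed

text \<open>The complementary retraction: letters of \<open>ps\<close> enter the stages only through
  commutation and can be killed too.\<close>

lemma B_kill:
  assumes g: "g = ext (\<lambda>a. if a \<in> {4..12} then reg B a else 0)" and r: "r \<in> B"
  shows "ev g r = 0"
proof -
  have g_minus: "g (- a) = - g a" for a by (simp add: g ext_minus)
  have g_0: "g p = 0" if "p \<in> set ps" for p
    using ps_pos[OF that] by (auto simp: g)
  have g_e: "g e = reg B e" if "e \<in> {4..12}" for e using that by (simp add: g)
  show ?thesis
  proof (rule B_respects[where g = g, OF g_minus _ _ r])
    fix e q a b assume st: "(e, q) \<in> set (stages ps n)" and ab: "(a, b) \<in> set q"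
    have e: "e \<in> {4..12}" using st by (auto simp: stages_def)
    show "g e + ev g a - g e = ev g b"
    proof (cases "\<exists>p\<in>set ps. a = [p] \<and> b = [p]")
      case True
      then show ?thesis using g_0 by auto
    next
      case False
      then have "over {4..12} a \<and> over {4..12} b"
        using st ab by (auto simp: stages_def over_def) blast+
      then have "ev g a = val B a" "ev g b = val B b"
        using ev_over_cong[of g "reg B" "{4..12}", OF g_minus reg_minus g_e] by blast+
      then show ?thesis using B_stage[OF st ab subset_refl] g_e[OF e] by simp
    qed
  qed (use ev_zero[where g = g, OF g_minus g_0] RP_over in blast)
qed

text \<open>Sending 4, 5, 6 to x, t, k, 7 to t k t^-1 and 8 to the shift letter is a homomorphism on
  B, because the shift fixes x and k and acts on t like x. By \<open>shift_embed\<close> its target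
  contains the group of x, t, k with all \<open>rho2 i\<close>, so the copies satisfy no relations
  beyond these.\<close>

lemma B_hom2:
  assumes w: "over {1, 2, 3} w" and "val B (map \<alpha>2 w) = 0"
  shows "val (range rho2) w = 0"
proof (rule shift_embed[OF rho_family_2 w])
  let ?R = "range rho2 \<union> hrels 8 shift_pairs"
  define g where "g = ext (\<lambda>a. if a = 4 then reg ?R 1 else if a = 5 then reg ?R 2 else if a = 6 then reg ?R 3
     else if a = 7 then reg ?R 2 + reg ?R 3 - reg ?R 2 else if a = 8 then reg ?R 8 else 0)"
  have g_minus: "g (- a) = - g a" for a by (simp add: g_def ext_minus)
  have g_0: "g p = 0" if "p \<in> set ps" for p using ps_pos[OF that] by (auto simp: g_def)
  have g_simps: "g 4 = reg ?R 1" "g 5 = reg ?R 2" "g 6 = reg ?R 3" "g 7 = reg ?R 2 + reg ?R 3 - reg ?R 2"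
    "g 8 = reg ?R 8" "g (- 8) = - reg ?R 8" "g 9 = 0" "g 10 = 0" "g 11 = 0" "g 12 = 0" "g (- 12) = 0"
    by (simp_all add: g_def)
  have sh: "reg ?R 8 + val ?R a - reg ?R 8 = val ?R b" if "(a, b) \<in> shift_pairs" for a b
  proof -
    have "val ?R (hrel 8 a b) = 0" using that by (intro val_relator) force
    then show ?thesis using ev_hrel[of "reg ?R", OF reg_minus] by simp
  qed
  have "val ?R (rho2 0) = 0" by (rule val_relator) auto
  then have "val ?R (hrel 3 [2, 3, -2] [2, 3, -2]) = 0" by (simp only: rho2_0)
  then have k: "reg ?R 3 + (reg ?R 2 + reg ?R 3 - reg ?R 2) - reg ?R 3 = reg ?R 2 + reg ?R 3 - reg ?R 2"
    using ev_hrel[of "reg ?R", OF reg_minus] by (simp add: reg_minus add_diff_eq)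
  have k': "(reg ?R 2 + reg ?R 3 - reg ?R 2) + reg ?R 3 - (reg ?R 2 + reg ?R 3 - reg ?R 2) = reg ?R 3"
    using k by (simp only: diff_eq_eq)
  have "ev g r = 0" if "r \<in> B" for r
  proof (rule B_respects[where g = g, OF g_minus _ _ that])
    show "ev g r = 0" if "r \<in> RP" for r
      using ev_zero[where g = g, OF g_minus g_0 RP_over[OF that]] by blast
    fix e q a b assume "(e, q) \<in> set (stages ps n)" and "(a, b) \<in> set q"
    moreover have "reg ?R 8 + reg ?R 3 - reg ?R 8 = reg ?R 3" using sh[of "[3]" "[3]"] by (simp add: shift_pairs_def)
    moreover have x: "reg ?R 8 + reg ?R 1 - reg ?R 8 = reg ?R 1" using sh[of "[1]" "[1]"] by (simp add: shift_pairs_def)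
    moreover have "reg ?R 1 + reg ?R 8 - reg ?R 1 = reg ?R 8" using x by (simp add: diff_eq_eq)
    moreover have "reg ?R 8 + reg ?R 2 - reg ?R 8 = reg ?R 1 + reg ?R 2 - reg ?R 1"
      using sh[of "[2]" "[1, 2, -1]"] by (simp add: shift_pairs_def reg_minus add_diff_eq)
    ultimately show "g e + ev g a - g e = ev g b"
      using k' by (auto simp: stages_def g_simps g_0 sum_list_triv add_diff_eq)
  qed
  then have "ev g (map \<alpha>2 w) = 0"
    using weq_respects[of g B "map \<alpha>2 w" "[]", OF g_minus] assms(2) by simp
  moreover have "ev (g \<circ> \<alpha>2) w = val ?R w"
    by (rule ev_over_cong[where g = "reg ?R", OF _ reg_minus _ w]) (auto simp: g_minus \<alpha>_minus g_simps)
  ultimately show "val ?R w = 0" by simp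
qed

lemma B_hom3:
  assumes w: "over {1, 2, 3} w" and "val B (map \<alpha>3 w) = 0"
  shows "val (range (rho3 n)) w = 0"
proof (rule shift_embed[OF rho_family_3 w])
  let ?R = "range (rho3 n) \<union> hrels 8 shift_pairs"
  define g where "g = ext (\<lambda>a. if a = 9 then reg ?R 1 else if a = 10 then reg ?R 2 else if a = 11 then reg ?R 3
     else if a = 12 then reg ?R 8 else 0)"
  have g_minus: "g (- a) = - g a" for a by (simp add: g_def ext_minus)
  have g_0: "g p = 0" if "p \<in> set ps" for p using ps_pos[OF that] by (auto simp: g_def)
  have g_simps: "g 9 = reg ?R 1" "g 10 = reg ?R 2" "g 11 = reg ?R 3" 
    "g 12 = reg ?R 8" "g (- 12) = - reg ?R 8" "g 4 = 0" "g 5 = 0" "g 6 = 0" "g 7 = 0" "g 8 = 0" "g (- 8) = 0"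
    by (simp_all add: g_def)
  have sh: "reg ?R 8 + val ?R a - reg ?R 8 = val ?R b" if "(a, b) \<in> shift_pairs" for a b
  proof -
    have "val ?R (hrel 8 a b) = 0" using that by (intro val_relator) force
    then show ?thesis using ev_hrel[of "reg ?R", OF reg_minus] by simp
  qed
  have "val ?R (rho3 n 0) = 0" by (rule val_relator) auto
  then have k: "reg ?R 2 + zp (int n) (reg ?R 3) - reg ?R 2 = zp (int n) (reg ?R 3)"
    using ev_rho3[of "reg ?R" n 0, OF reg_minus] by (simp add: tw_0)
  have "ev g r = 0" if "r \<in> B" for r
  proof (rule B_respects[where g = g, OF g_minus _ _ that])
    show "ev g r = 0" if "r \<in> RP" for r
      using ev_zero[where g = g, OF g_minus g_0 RP_over[OF that]] by blast
    fix e q a b assume "(e, q) \<in> set (stages ps n)" and "(a, b) \<in> set q"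
    moreover have "reg ?R 8 + reg ?R 3 - reg ?R 8 = reg ?R 3" using sh[of "[3]" "[3]"] by (simp add: shift_pairs_def)
    moreover have x: "reg ?R 8 + reg ?R 1 - reg ?R 8 = reg ?R 1" using sh[of "[1]" "[1]"] by (simp add: shift_pairs_def)
    moreover have "reg ?R 1 + reg ?R 8 - reg ?R 1 = reg ?R 8" using x by (simp add: diff_eq_eq)
    moreover have "reg ?R 8 + reg ?R 2 - reg ?R 8 = reg ?R 1 + reg ?R 2 - reg ?R 1"
      using sh[of "[2]" "[1, 2, -1]"] by (simp add: shift_pairs_def reg_minus add_diff_eq)
    ultimately show "g e + ev g a - g e = ev g b"
      using k by (auto simp: stages_def g_simps g_0 add_diff_eq zp_of_nat)
  qed
  then have "ev g (map \<alpha>3 w) = 0"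
    using weq_respects[of g B "map \<alpha>3 w" "[]", OF g_minus] assms(2) by simp
  moreover have "ev (g \<circ> \<alpha>3) w = val ?R w"
    by (rule ev_over_cong[where g = "reg ?R", OF _ reg_minus _ w]) (auto simp: g_minus \<alpha>_minus g_simps)
  ultimately show "val ?R w = 0" by simp
qed

lemma val_dbl:
  assumes "over {1, 2, 3} w" "B \<subseteq> R" and \<alpha>: "\<And>a. \<alpha> (- a) = - \<alpha> a" "\<And>a. a \<in> {1, 2, 3} \<Longrightarrow> \<alpha> a \<in> {4..12}"
  shows "val R (dbl \<alpha> w) = val R (map \<alpha> w) + val R w"
  using assms(1)
proof (induction w)
  case (Cons a w)
  have c: "reg R (\<alpha> b) + reg R p = reg R p + reg R (\<alpha> b)" if "\<bar>b\<bar> \<in> {1, 2, 3}" "p \<in> {1, 2, 3}" for b p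
  proof -
    have "reg R (\<alpha> \<bar>b\<bar>) + reg R p = reg R p + reg R (\<alpha> \<bar>b\<bar>)"
      using B_commute[OF \<alpha>(2) _ assms(2)] that ps_123 by blast
    then show ?thesis
      using \<alpha>(1)[of b] commute_minus[of "reg R (- \<alpha> b)" "reg R p"] by (auto simp: abs_if reg_minus split: if_splits)
  qed
  have cw: "val R (map \<alpha> u) + reg R p = reg R p + val R (map \<alpha> u)" if "over {1, 2, 3} u" "p \<in> {1, 2, 3}" for u p
    using that(1)
  proof (induction u)
    case (Cons b u)
    then have "val R (map \<alpha> (b # u)) + reg R p = (reg R (\<alpha> b) + reg R p) + val R (map \<alpha> u)"
      by (simp add: add.assoc)
    also have "\<dots> = reg R p + val R (map \<alpha> (b # u))"
      using c[of b p] Cons.prems that(2) by (simp add: add.assoc)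
    finally show ?case .
  qed simp
  have IH: "val R (dbl \<alpha> w) = val R (map \<alpha> w) + val R w" using Cons by simp
  have a: "\<bar>a\<bar> \<in> {1, 2, 3}" using Cons.prems by simp
  show ?case
  proof (cases "0 < a")
    case True
    have "val R (dbl \<alpha> (a # w)) = reg R (\<alpha> a) + ((reg R a + val R (map \<alpha> w)) + val R w)"
      using IH True by (simp add: dbl_def add.assoc)
    also have "reg R a + val R (map \<alpha> w) = val R (map \<alpha> w) + reg R a"
      using cw[of w a] a True Cons.prems by simp
    finally show ?thesis by (simp add: add.assoc)
  next
    case False
    then have neg: "a < 0" using a by auto
    have "val R (dbl \<alpha> (a # w)) = (reg R a + val R (map \<alpha> (a # w))) + val R w"
      using IH False by (simp add: dbl_def add.assoc)
    also have "reg R a + val R (map \<alpha> (a # w)) = val R (map \<alpha> (a # w)) + reg R a"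
      using cw[of "a # w" "- a"] commute_minus[of "reg R (- a)" "val R (map \<alpha> (a # w))"] a neg Cons.prems
      by (simp add: reg_minus abs_if)
    finally show ?thesis by (simp add: add.assoc)
  qed
qed (simp add: dbl_def)

end

lemma ev_rho2:
  assumes "\<And>a. g (- a) = - g a"
  shows "ev g (rho2 i) = 0 \<longleftrightarrow>
    g 3 + (ev g (tw i) + g 3 - ev g (tw i)) - g 3 = ev g (tw i) + g 3 - ev g (tw i)"
  unfolding rho2_def ev_hrel[of g, OF assms] using ev_winv[of g, OF assms] by (simp add: add_diff_eq)

lemma ev_wpow: "ev g (wpow m w) = zp (int m) (ev g w)"
proof (induction m)
  case (Suc m)
  then show ?case using zp_add[of 1 "int m" "ev g w"] by simp
qed simp

context tower
begin

text \<open>If the copy of \<open>w\<close> is trivial, so is \<open>w\<close> by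
  \<open>hom\<close>, hence also their product. Conversely, killing the letters of \<open>ps\<close>
  recovers the copy from the product.\<close>

lemma S_iso:
  assumes uv: "(u, v) \<in> gpair (set (spairs \<alpha>))"
    and \<alpha>: "\<And>a. \<alpha> (- a) = - \<alpha> a" "\<And>a. a \<in> {1, 2, 3} \<Longrightarrow> \<alpha> a \<in> {4..12}"
    and hom: "\<And>w. over {1, 2, 3} w \<Longrightarrow> val B (map \<alpha> w) = 0 \<Longrightarrow> val RP w = 0"
  shows "val B u = 0 \<longleftrightarrow> val B v = 0"
proof
  assume u: "val B u = 0"
  obtain w where w: "over {1, 2, 3} w" "u = map \<alpha> w" "v = dbl \<alpha> w"
    using gpair_spairs[where \<alpha> = \<alpha>, OF uv \<alpha>(1)] by blast
  have "val RP w = 0" using hom w u by simp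
  then have "val B w = 0"
    using weq_mono[of RP B w "[]"] by (simp add: B_def val_relator)
  then show "val B v = 0" using val_dbl[where \<alpha> = \<alpha>, OF w(1) subset_refl \<alpha>] u w by simp
next
  assume v: "val B v = 0"
  define g where "g = ext (\<lambda>a. if a \<in> {4..12} then reg B a else 0)"
  have g_minus: "g (- a) = - g a" for a by (simp add: g_def ext_minus)
  have "\<alpha> 1 \<in> {4..12}" "\<alpha> 2 \<in> {4..12}" "\<alpha> 3 \<in> {4..12}" using \<alpha>(2) by auto
  then have "ev g a = val B b" if "(a, b) \<in> (set (spairs \<alpha>))\<inverse>" for a b
    using that by (auto simp: spairs_def g_def)
  then show "val B u = 0"
    using gpair_hom[OF gpair_conv[OF uv] g_minus B_kill[OF g_def], of B] v by blast
qed

lemma G_eq: "G = B \<union> (\<Union>e\<in>{13, 14}. hrels e (set (spairs (if e = 13 then \<alpha>2 else \<alpha>3))))"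
  by (auto simp: G_def rels_S_def set_stage_rels)

lemma over_B: "r \<in> B \<Longrightarrow> over letters_B r"
proof -
  have B: "over letters_B [p]" if "p \<in> set ps" for p
    using that ps_pos[of p] by (simp add: letters_B_def)
  have "over letters_B (hrel e a b)" if "(e, q) \<in> set (stages ps n)" "(a, b) \<in> set q" for e q a b
    using that B by (auto simp: stages_def over_hrel) (auto simp: letters_B_def over_def[of _ "replicate n _"])
  moreover have "over letters_B r" if "r \<in> RP" for r
    using RP_over[OF that] by (rule over_mono) (auto simp: letters_B_def)
  ultimately show "r \<in> B \<Longrightarrow> over letters_B r"
    by (auto simp: B_def set_rels_B)
qed

lemma S_over:
  assumes "(a, b) \<in> set (spairs (if e = 13 then \<alpha>2 else \<alpha>3))"
  shows "over letters_B a \<and> over letters_B b"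
  using assms ps_123 by (auto simp: spairs_def letters_B_def split: if_splits)

lemma \<alpha>_range: "a \<in> {1, 2, 3} \<Longrightarrow> \<alpha>2 a \<in> {4..12}" "a \<in> {1, 2, 3} \<Longrightarrow> \<alpha>3 a \<in> {4..12}"
  by auto

text \<open>The stable letter conjugates the copy of \<open>w\<close> to the copy times
  \<open>w\<close>; if the first is trivial, both factors of the second are.\<close>

lemma S_transfer:
  assumes w: "over {1, 2, 3} w" and e: "(e :: int) = 13 \<and> \<alpha> = \<alpha>2 \<or> e = 14 \<and> \<alpha> = \<alpha>3" and R: "G \<subseteq> R"
    and 0: "val R (map \<alpha> w) = 0"
  shows "val R w = 0"
proof -
  have \<alpha>: "\<alpha> (- a) = - \<alpha> a" "a \<in> {1, 2, 3} \<Longrightarrow> \<alpha> a \<in> {4..12}" for a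
    using e \<alpha>_minus \<alpha>_range by auto
  have "B \<subseteq> R" using R by (auto simp: G_def)
  from val_dbl[where \<alpha> = \<alpha>, OF w this \<alpha>] 0 have d: "val R (dbl \<alpha> w) = val R w" by simp
  have "reg R e + val R (map \<alpha> w) - reg R e = val R (dbl \<alpha> w)"
  proof (rule gpair_ev[where g = "reg R", OF gpair_dbl[where \<alpha> = \<alpha>, OF w \<alpha>(1)] _ reg_minus])
    fix a b assume "(a, b) \<in> set (spairs \<alpha>)"
    then have "hrel e a b \<in> R" using R e by (auto simp: G_eq)
    then show "reg R e + val R a - reg R e = val R b"
      using ev_hrel[of "reg R" e a b, OF reg_minus] val_relator by blast
  qed
  then show ?thesis using 0 d by simp
qed

text \<open>With t_i = d^i t d^-i and d commuting with k, conjugating the relation between 6 and 7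
  by d^i gives the relation for t_i.\<close>

lemma rho2_E:
  assumes R: "B \<subseteq> R"
  shows "val R (map \<alpha>2 (rho2 i)) = 0"
proof -
  let ?x = "reg R 4" and ?t = "reg R 5" and ?k = "reg R 6" and ?k' = "reg R 7" and ?d = "reg R 8"
  let ?z = "zp i ?d"
  define g where "g = (\<lambda>a. reg R (\<alpha>2 a))"
  have g_minus: "g (- a) = - g a" for a by (simp add: g_def \<alpha>_minus reg_minus)
  note st = B_stage[OF _ _ R]
  have k': "?t + ?k - ?t = ?k'" using st[of 5 _ "[6]" "[7]"] by (auto simp: stages_def)
  have kk: "?k' + ?k - ?k' = ?k" using st[of 7 _ "[6]" "[6]"] by (auto simp: stages_def)
  have dk: "?d + ?k - ?d = ?k" using st[of 8 _ "[6]" "[6]"] by (auto simp: stages_def)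
  have xd: "?x + ?d - ?x = ?d" using st[of 4 _ "[8]" "[8]"] by (auto simp: stages_def)
  have xt: "?x + ?t - ?x = ?d + ?t - ?d"
    using st[of 4 _ "[5]" "[8, 5, -8]"] by (auto simp: stages_def reg_minus add_diff_eq)
  have "?d + ?x = ?x + ?d" using xd by (simp add: diff_eq_eq)
  then have T: "ev g (tw i) = ?z + ?t - ?z"
    using conj_shift[OF _ xt, of i] by (simp add: ev_tw[of g, OF g_minus]) (simp add: g_def)
  have zk: "?z + ?k = ?k + ?z" by (rule zp_commute) (use dk in \<open>simp add: diff_eq_eq\<close>)
  then have zk': "- ?z + ?k = ?k + - ?z" by (rule commute_minus)
  have c: "ev g (tw i) + ?k - ev g (tw i) = ?z + ?k' - ?z"
  proof -
    have "ev g (tw i) + ?k - ev g (tw i) = ?z + (?t + ((- ?z + ?k) + ?z) - ?t) - ?z"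
      unfolding T by (simp add: diff_conv_add_uminus add.assoc minus_add del: add_uminus_conv_diff)
    also have "\<dots> = ?z + ?k' - ?z"
      unfolding zk' k'[symmetric] by (simp add: diff_conv_add_uminus add.assoc minus_add del: add_uminus_conv_diff)
    finally show ?thesis .
  qed
  have "?k + (?z + ?k' - ?z) - ?k = (?k + ?z) + ?k' - (?k + ?z)"
    by (simp add: diff_conv_add_uminus add.assoc minus_add del: add_uminus_conv_diff)
  also have "\<dots> = ?z + (?k + ?k' - ?k) - ?z"
    unfolding zk[symmetric] by (simp add: diff_conv_add_uminus add.assoc minus_add del: add_uminus_conv_diff)
  also have "?k + ?k' - ?k = ?k'" using kk by (simp add: diff_eq_eq)
  finally have "ev g (rho2 i) = 0"
    unfolding ev_rho2[of g, OF g_minus] using c by (simp add: g_def)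
  then show ?thesis by (simp add: g_def comp_def)
qed

lemma rho3_E:
  assumes R: "B \<subseteq> R"
  shows "val R (map \<alpha>3 (rho3 n i)) = 0"
proof -
  let ?x = "reg R 9" and ?t = "reg R 10" and ?k = "reg R 11" and ?d = "reg R 12"
  let ?z = "zp i ?d" and ?q = "zp (int n) (reg R 11)"
  define g where "g = (\<lambda>a. reg R (\<alpha>3 a))"
  have g_minus: "g (- a) = - g a" for a by (simp add: g_def \<alpha>_minus reg_minus)
  note st = B_stage[OF _ _ R]
  have tk: "?t + ?q - ?t = ?q"
    using st[of 10 _ "replicate n 11" "replicate n 11"] by (auto simp: stages_def zp_of_nat)
  have dk: "?d + ?k - ?d = ?k" using st[of 12 _ "[11]" "[11]"] by (auto simp: stages_def)
  have xd: "?x + ?d - ?x = ?d" using st[of 9 _ "[12]" "[12]"] by (auto simp: stages_def)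
  have xt: "?x + ?t - ?x = ?d + ?t - ?d"
    using st[of 9 _ "[10]" "[12, 10, -12]"] by (auto simp: stages_def reg_minus add_diff_eq)
  have "?d + ?x = ?x + ?d" using xd by (simp add: diff_eq_eq)
  then have T: "ev g (tw i) = ?z + ?t - ?z"
    using conj_shift[OF _ xt, of i] by (simp add: ev_tw[of g, OF g_minus]) (simp add: g_def)
  have "?z + ?k = ?k + ?z" by (rule zp_commute) (use dk in \<open>simp add: diff_eq_eq\<close>)
  then have zq: "?q + ?z = ?z + ?q" by (intro zp_commute) simp
  then have zq': "- ?z + ?q = ?q + - ?z" by (intro commute_minus) simp
  have "ev g (tw i) + ?q - ev g (tw i) = ?z + (?t + ((- ?z + ?q) + ?z) - ?t) - ?z"
    unfolding T by (simp add: diff_conv_add_uminus add.assoc minus_add del: add_uminus_conv_diff)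
  also have "\<dots> = ?z + (?t + ?q - ?t) - ?z"
    unfolding zq' by (simp add: diff_conv_add_uminus add.assoc minus_add del: add_uminus_conv_diff)
  also have "\<dots> = ?q" unfolding tk zq[symmetric] by simp
  finally have "ev g (rho3 n i) = 0"
    unfolding ev_rho3[of g, OF g_minus] by (simp add: g_def)
  then show ?thesis by (simp add: g_def comp_def)
qed

text \<open>By \<open>rho2\<close> the factors k^-1 and t_i k t_i^-1 commute, so the n-th power is
  k^-n t_i k^n t_i^-1, which \<open>rho3\<close> makes trivial.\<close>

lemma torsion_element:
  assumes R: "G \<subseteq> R"
  shows "val R (wpow n ([-3] @ tw i @ [3] @ winv (tw i))) = 0"
proof -
  let ?T = "val R (tw i)" and ?k = "reg R 3"
  let ?k' = "?T + ?k - ?T"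
  have B: "B \<subseteq> R" using R by (auto simp: G_def)
  have "over {1, 2, 3} (rho2 i)" "over {1, 2, 3} (rho3 n i)"
    using rho_family_2 rho_family_3 by (auto simp: rho_family_def)
  then have "val R (rho2 i) = 0" "val R (rho3 n i) = 0"
    using S_transfer[of "rho2 i" 13 \<alpha>2 R] S_transfer[of "rho3 n i" 14 \<alpha>3 R] rho2_E[OF B] rho3_E[OF B] R by auto
  then have k: "?k + ?k' - ?k = ?k'" and q: "?T + zp (int n) ?k - ?T = zp (int n) ?k"
    using ev_rho2[of "reg R" i, OF reg_minus] ev_rho3[of "reg R" n i, OF reg_minus] by auto
  have "?k + ?k' = ?k' + ?k" using k by (simp only: diff_eq_eq)
  then have c: "- ?k + ?k' = ?k' + - ?k" by (rule commute_minus)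
  have "val R ([-3] @ tw i @ [3] @ winv (tw i)) = - ?k + ?k'"
    by (simp add: reg_minus add_diff_eq)
  then have "val R (wpow n ([-3] @ tw i @ [3] @ winv (tw i))) = zp (int n) (- ?k + ?k')"
    by (simp only: ev_wpow)
  also have "\<dots> = zp (int n) (- ?k) + zp (int n) ?k'" by (rule zp_sum_commute[OF c])
  also have "zp (int n) ?k' = zp (int n) ?k" using q by (simp only: zp_conj)
  also have "zp (int n) (- ?k) = - zp (int n) ?k"
    using zp_mult[of "-1" "int n" ?k] zp_minus[of 1 ?k] zp_minus[of "int n" ?k] by simp
  finally show ?thesis by simp
qed

end

locale tower_rho = tower +
  assumes rho2_RP: "val RP (rho2 i) = 0" and rho3_RP: "val RP (rho3 n i) = 0"
begin

text \<open>Relations among the copies follow from the two families, which \<open>RP\<close>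
  implies; this supplies the hypothesis \<open>hom\<close> of \<open>S_iso\<close>.\<close>

lemma S_iso':
  assumes e: "e \<in> {13, 14}" and uv: "(u, v) \<in> gpair (set (spairs (if e = 13 then \<alpha>2 else \<alpha>3)))"
  shows "val B u = 0 \<longleftrightarrow> val B v = 0"
proof -
  have "val RP w = 0" if "over {1, 2, 3} w" "val B (map \<alpha>2 w) = 0" for w
    using weq_mono[of "range rho2" RP w "[]"] B_hom2[OF that] rho2_RP by auto
  moreover have "val RP w = 0" if "over {1, 2, 3} w" "val B (map \<alpha>3 w) = 0" for w
    using weq_mono[of "range (rho3 n)" RP w "[]"] B_hom3[OF that] rho3_RP by auto
  ultimately show ?thesis
    using S_iso[OF uv] \<alpha>_minus \<alpha>_range by (auto split: if_splits)
qed

lemma tfs_G: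
  assumes "tfs (set ps) RP"
  shows "tfs (letters_B \<union> {13, 14}) G"
  unfolding G_eq
proof (rule tfs_hnn[OF tfs_B[OF assms]])
  show "letters_B \<inter> {13, 14} = {}" using ps_pos[of 13] ps_pos[of 14] by (auto simp: letters_B_def)
  show "over letters_B a \<and> over letters_B b" if "(a, b) \<in> set (spairs (if e = 13 then \<alpha>2 else \<alpha>3))" for e a b
    using S_over[OF that] .
qed (use S_iso' in auto)

lemma G_embed:
  assumes w: "over (set ps) w" "val G w = 0"
  shows "val RP w = 0"
proof -
  have "val B w = 0"
  proof (rule hnn_embed[of letters_B B "{13, 14}" "\<lambda>e. set (spairs (if e = 13 then \<alpha>2 else \<alpha>3))"])
    show "0 < a" if "a \<in> letters_B" for a using that ps_pos by (auto simp: letters_B_def)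
    show "letters_B \<inter> {13, 14} = {}" using ps_pos[of 13] ps_pos[of 14] by (auto simp: letters_B_def)
    show "over letters_B a \<and> over letters_B b" if "(a, b) \<in> set (spairs (if e = 13 then \<alpha>2 else \<alpha>3))" for e a b
      using S_over[OF that] .
    show "over letters_B w" using w(1) by (rule over_mono) (auto simp: letters_B_def)
    show "val (B \<union> (\<Union>e\<in>{13, 14}. hrels e (set (spairs (if e = 13 then \<alpha>2 else \<alpha>3))))) w = 0"
      using w(2) by (simp only: G_eq)
  qed (use S_iso' over_B in auto)
  then show ?thesis by (rule B_retract[OF w(1)])
qed

end

section \<open>Separating points outside the reachable set\<close>

text \<open>The wreath product Z wr Z with arbitrary functions as first components. With x the shift
  and t the indicator function of 0, t_i becomes the indicator function of i, so membership
  questions about the t_i turn into questions about supports.\<close>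

datatype wr = Wr "int \<Rightarrow> int" int

instantiation wr :: group_add
begin

definition zero_wr :: wr where "zero_wr = Wr (\<lambda>_. 0) 0"
fun plus_wr :: "wr \<Rightarrow> wr \<Rightarrow> wr" where "plus_wr (Wr f p) (Wr g q) = Wr (\<lambda>i. f i + g (i - p)) (p + q)"
fun uminus_wr :: "wr \<Rightarrow> wr" where "uminus_wr (Wr f p) = Wr (\<lambda>i. - f (i + p)) (- p)"
definition minus_wr :: "wr \<Rightarrow> wr \<Rightarrow> wr" where "minus_wr a b = a + - b"

instance
proof
  fix a b c :: wr
  show "a + b + c = a + (b + c)"
    by (cases a; cases b; cases c) (auto simp: fun_eq_iff algebra_simps)
  show "0 + a = a" by (cases a) (simp add: zero_wr_def)
  show "a + 0 = a" by (cases a) (simp add: zero_wr_def)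
  show "- a + a = 0" by (cases a) (simp add: zero_wr_def)
  show "a + - b = a - b" by (simp add: minus_wr_def)
qed

end

definition delta :: "int \<Rightarrow> int \<Rightarrow> int" where "delta i u = of_bool (u = i)"

definition wr_base :: "int \<Rightarrow> wr" where
  "wr_base = ext (\<lambda>a. if a = 1 then Wr (\<lambda>_. 0) 1 else if a = 2 then Wr (delta 0) 0 else 0)"

lemma wr_base_minus: "wr_base (- a) = - wr_base a"
  by (simp add: wr_base_def ext_minus)

lemma zp_wr: "zp i (Wr (\<lambda>_. 0) 1) = Wr (\<lambda>_. 0) i"
proof (induction i rule: int_induct[of _ 0])
  case (step1 i)
  then show ?case by (simp add: zp_succ)
next
  case (step2 i)
  then show ?case by (simp add: zp_pred minus_wr_def)
qed (simp add: zero_wr_def)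

lemma ev_wr_xp: "ev wr_base (xp i) = Wr (\<lambda>_. 0) i"
  using ev_xp[of wr_base i, OF wr_base_minus] by (simp add: wr_base_def zp_wr)

lemma ev_wr_tw: "ev wr_base (tw i) = Wr (delta i) 0"
  using ev_tw[of wr_base i, OF wr_base_minus]
  by (simp add: wr_base_def zp_wr minus_wr_def delta_def fun_eq_iff)

definition spread :: "int \<Rightarrow> int \<Rightarrow> (int \<Rightarrow> int) \<Rightarrow> int \<Rightarrow> int" where
  "spread m j h u = (if m dvd (u - j) then h ((u - j) div m) else 0)"

lemma spread_at: "m \<noteq> 0 \<Longrightarrow> spread m j h (m * v + j) = h v"
  by (simp add: spread_def)

lemma spread_shift:
  assumes "0 < m"
  shows "spread m j h (u - m * z) = spread m j (\<lambda>v. h (v - z)) u"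
proof -
  have e: "u - m * z - j = (u - j) + m * (- z)" by simp
  have "m dvd (u - j) + m * (- z) \<longleftrightarrow> m dvd (u - j)"
    by (rule dvd_add_left_iff) simp
  then show ?thesis unfolding spread_def e using assms by (simp del: mult_minus_right)
qed

text \<open>The isomorphism extending x^m to x^a and t_j to t_b. Both sides spread the same
  \<open>h\<close>, so the value at m v + j moves to a v + b.\<close>

fun rule_graph :: "rule \<Rightarrow> (wr \<times> wr) set" where
  "rule_graph (m, j, a, b) = {(Wr (spread (int m) (int j) h) (int m * z), Wr (spread (int a) (int b) h) (int a * z)) | h z. True}"

lemma spread_inj:
  assumes "Wr (spread m j h) (m * z) = 0" "0 < m"
  shows "Wr (spread a b h) (a * z) = 0"
proof -
  have "z = 0" using assms by (simp add: zero_wr_def)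
  moreover have "h v = 0" for v
    using assms spread_at[of m j h v] by (auto simp: zero_wr_def dest!: fun_cong[of _ _ "m * v + j"])
  ultimately show ?thesis by (simp add: zero_wr_def spread_def fun_eq_iff)
qed

locale rules =
  fixes rs :: "rule list" and bs :: "nat list"
  assumes rs_pos: "(m, j, a, b) \<in> set rs \<Longrightarrow> 0 < m \<and> 0 < a"
begin

abbreviation "D \<equiv> reach rs bs"

definition St where "St = {e. \<exists>i<length rs. \<bar>e\<bar> = rl i}"

definition rg where "rg e = rule_graph (rs ! nat (\<bar>e\<bar> - 15))"

definition Phi where
  "Phi e = (if e \<in> St then (if 0 < e then rg e else (rg e)\<inverse>)
            else {(0, 0)})"

text \<open>Closure of \<open>reach\<close> under the rules in both directions is exactly what lets
  every rule letter preserve this subgroup.\<close>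

definition H where "H = {Wr f 0 | f. \<forall>u. f u \<noteq> 0 \<longrightarrow> u \<in> D}"

lemma rule_graph_props:
  assumes r: "r \<in> set rs"
  shows "(0, 0) \<in> rule_graph r"
    "(p, q) \<in> rule_graph r \<Longrightarrow> (p', q') \<in> rule_graph r \<Longrightarrow> (p + p', q + q') \<in> rule_graph r"
    "(p, q) \<in> rule_graph r \<Longrightarrow> (- p, - q) \<in> rule_graph r"
    "(0, q) \<in> rule_graph r \<Longrightarrow> q = 0" "(p, 0) \<in> rule_graph r \<Longrightarrow> p = 0"
    "(p, q) \<in> rule_graph r \<Longrightarrow> p \<in> H \<longleftrightarrow> q \<in> H"
proof -
  obtain m' j' a' b' where r': "r = (m', j', a', b')" by (cases r)
  define m j a b where "m = int m'" and "j = int j'" and "a = int a'" and "b = int b'"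
  then have mj: "rule_graph r = {(Wr (spread m j h) (m * z), Wr (spread a b h) (a * z)) | h z. True}"
    by (simp add: r')
  then have mjI: "p = Wr (spread m j h) (m * z) \<Longrightarrow> q = Wr (spread a b h) (a * z) \<Longrightarrow> (p, q) \<in> rule_graph r" for p q h z
    by blast
  have pos: "0 < m" "0 < a" using rs_pos r r' by (auto simp: m_def a_def)
  show "(0, 0) \<in> rule_graph r"
    by (rule mjI[of _ "\<lambda>_. 0" 0]) (simp_all add: zero_wr_def spread_def fun_eq_iff)
  show "(p + p', q + q') \<in> rule_graph r" if pq: "(p, q) \<in> rule_graph r" "(p', q') \<in> rule_graph r"
  proof -
    obtain h z where 1: "p = Wr (spread m j h) (m * z)" "q = Wr (spread a b h) (a * z)"
      using pq(1) by (auto simp: mj)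
    obtain h' z' where 2: "p' = Wr (spread m j h') (m * z')" "q' = Wr (spread a b h') (a * z')"
      using pq(2) by (auto simp: mj)
    have "spread k l h u + spread k l h' (u - k * z) = spread k l (\<lambda>v. h v + h' (v - z)) u" if "0 < k" for k l u
      unfolding spread_shift[OF that] by (simp add: spread_def)
    then show ?thesis
      using pos by (intro mjI[of _ "\<lambda>v. h v + h' (v - z)" "z + z'"]) (simp_all add: 1 2 fun_eq_iff distrib_left)
  qed
  show "(- p, - q) \<in> rule_graph r" if pq: "(p, q) \<in> rule_graph r"
  proof -
    obtain h z where 1: "p = Wr (spread m j h) (m * z)" "q = Wr (spread a b h) (a * z)"
      using pq by (auto simp: mj)
    have "- spread k l h (u + k * z) = spread k l (\<lambda>v. - h (v + z)) u" if "0 < k" for k l u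
      using spread_shift[OF that, of l h u "- z"] by (simp add: spread_def)
    then show ?thesis
      using pos by (intro mjI[of _ "\<lambda>v. - h (v + z)" "- z"]) (simp_all add: 1 fun_eq_iff)
  qed
  show "q = 0" if pq: "(0, q) \<in> rule_graph r"
  proof -
    obtain h z where "Wr (spread m j h) (m * z) = 0" "q = Wr (spread a b h) (a * z)"
      using pq unfolding mj by auto
    then show ?thesis using spread_inj[OF _ pos(1)] by simp
  qed
  show "p = 0" if pq: "(p, 0) \<in> rule_graph r"
  proof -
    obtain h z where "p = Wr (spread m j h) (m * z)" "Wr (spread a b h) (a * z) = 0"
      using pq unfolding mj by auto
    then show ?thesis using spread_inj[OF _ pos(2)] by simp
  qed
  show "p \<in> H \<longleftrightarrow> q \<in> H" if pq: "(p, q) \<in> rule_graph r"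
  proof -
    obtain h z where 1: "p = Wr (spread m j h) (m * z)" "q = Wr (spread a b h) (a * z)"
      using pq by (auto simp: mj)
    have sp: "(\<forall>u. spread k l h u \<noteq> 0 \<longrightarrow> u \<in> D) \<longleftrightarrow> (\<forall>v. h v \<noteq> 0 \<longrightarrow> k * v + l \<in> D)" if "0 < k" for k l
    proof
      assume "\<forall>u. spread k l h u \<noteq> 0 \<longrightarrow> u \<in> D"
      then show "\<forall>v. h v \<noteq> 0 \<longrightarrow> k * v + l \<in> D" using spread_at[of k l h] that by fastforce
    next
      assume *: "\<forall>v. h v \<noteq> 0 \<longrightarrow> k * v + l \<in> D"
      show "\<forall>u. spread k l h u \<noteq> 0 \<longrightarrow> u \<in> D"
      proof (intro allI impI)
        fix u assume "spread k l h u \<noteq> 0"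
        then have "k dvd (u - l)" "h ((u - l) div k) \<noteq> 0" by (auto simp: spread_def split: if_splits)
        then show "u \<in> D" using * by fastforce
      qed
    qed
    have "m * v + j \<in> D \<longleftrightarrow> a * v + b \<in> D" for v
      using r r' by (auto simp: m_def j_def a_def b_def intro: reach_fwd reach_bwd)
    then have "(\<forall>u. spread m j h u \<noteq> 0 \<longrightarrow> u \<in> D) \<longleftrightarrow> (\<forall>u. spread a b h u \<noteq> 0 \<longrightarrow> u \<in> D)"
      unfolding sp[OF pos(1)] sp[OF pos(2)] by simp
    then show ?thesis using pos by (auto simp: H_def 1)
  qed
qed

lemma rule_at: "e \<in> St \<Longrightarrow> rs ! nat (\<bar>e\<bar> - 15) \<in> set rs"
  by (auto simp: St_def rl_def)

lemma wr_base_St: "\<bar>a\<bar> \<in> {1, 2} \<Longrightarrow> a \<notin> St"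
  by (auto simp: St_def rl_def)

sublocale hnn St Phi wr_base H
proof
  fix e :: int
  note rg = rule_graph_props[OF rule_at[of e], folded rg_def]
  note [simp] = rg(1-5)
  have rg_minus: "rg (- e) = rg e" by (simp add: rg_def)
  show "0 \<notin> St" by (auto simp: St_def rl_def)
  show "e \<in> St \<Longrightarrow> - e \<in> St" by (simp add: St_def)
  show "(0, 0) \<in> Phi e"
    by (cases "0 < e") (simp_all add: Phi_def)
  show "(a + a', b + b') \<in> Phi e" if "(a, b) \<in> Phi e" "(a', b') \<in> Phi e" for a b a' b'
    using that by (cases "0 < e") (auto simp: Phi_def split: if_splits)
  show "(- a, - b) \<in> Phi e" if "(a, b) \<in> Phi e" for a b
    using that by (cases "0 < e") (auto simp: Phi_def split: if_splits)
  show "(b, a) \<in> Phi (- e)" if "(a, b) \<in> Phi e" for a b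
    using that by (auto simp: Phi_def St_def rl_def rg_minus split: if_splits)
  show "b = 0" if "(0, b) \<in> Phi e" for b
    using that by (cases "0 < e") (auto simp: Phi_def split: if_splits)
  show "b \<in> H" if "(a, b) \<in> Phi e" "a \<in> H" for a b
    using that rg(6)
    by (cases "0 < e") (auto simp: Phi_def split: if_splits)
  show "wr_base (- x) = - wr_base x" for x by (rule wr_base_minus)
  show "0 \<in> H" by (auto simp: H_def zero_wr_def)
  show "a + b \<in> H" if "a \<in> H" "b \<in> H" for a b
    using that by (auto simp: H_def) (metis add_0)
  show "- a \<in> H" if "a \<in> H" for a
    using that by (auto simp: H_def)
qed

lemma xt_base: "over {1, 2} w \<Longrightarrow> set w \<inter> St = {}"
  using wr_base_St by (auto simp: over_def)

text \<open>The same rule letters extend Z wr Z to an HNN extension satisfying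
  \<open>rels_K\<close>, because the graphs contain the pairs for x and for t.\<close>

lemma wact_rels_K:
  assumes "val (set (rels_K rs)) u = val (set (rels_K rs)) v"
  shows "wact u (0, []) = wact v (0, [])"
proof (rule wact_sound)
  show "weq (set (rels_K rs)) u v" using assms by (simp add: val_eq_iff)
  show "valid (0, [])" by (simp add: valid_def)
  fix r s assume r: "r \<in> set (rels_K rs)" and s: "valid s"
  then obtain i p q where i: "i < length rs" "(p, q) \<in> set (rule_pairs (rs ! i))" "r = hrel (rl i) p q"
    by (auto simp: rels_K_def)
  obtain m j a b where mj: "rs ! i = (m, j, a, b)" by (cases "rs ! i")
  have St: "rl i \<in> St" using i(1) by (auto simp: St_def rl_def)
  have "over {1, 2} p \<and> over {1, 2} q" using i(2) mj by (auto simp: over_xp over_tw)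
  then have pq: "set p \<inter> St = {}" "set q \<inter> St = {}" using xt_base by auto
  have PhiE: "Phi (rl i) = rule_graph (rs ! i)" using St by (simp add: Phi_def rg_def rl_def)
  have pq': "p = xp (int m) \<and> q = xp (int a) \<or> p = tw (int j) \<and> q = tw (int b)"
    using i(2) by (auto simp: mj)
  have pos: "0 < m" "0 < a" using rs_pos[of m j a b] nth_mem[OF i(1)] mj by auto
  have "(Wr (\<lambda>_. 0) (int m), Wr (\<lambda>_. 0) (int a)) \<in> rule_graph (rs ! i)"
    by (auto simp: mj spread_def fun_eq_iff intro!: exI[of _ "\<lambda>_. 0"] exI[of _ 1])
  moreover have "delta (int k) = spread (int c) (int k) (delta 0)" if "0 < c" for c k
  proof
    fix u
    have "int c dvd (u - int k) \<Longrightarrow> (u - int k) div int c = 0 \<longleftrightarrow> u = int k"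
      using that by (auto elim!: dvdE)
    then show "delta (int k) u = spread (int c) (int k) (delta 0) u"
      by (auto simp: delta_def spread_def)
  qed
  then have "(Wr (delta (int j)) 0, Wr (delta (int b)) 0) \<in> rule_graph (rs ! i)"
  proof -
    assume d: "\<And>c k. 0 < c \<Longrightarrow> delta (int k) = spread (int c) (int k) (delta 0)"
    have "Wr (delta (int j)) 0 = Wr (spread (int m) (int j) (delta 0)) (int m * 0)"
      "Wr (delta (int b)) 0 = Wr (spread (int a) (int b) (delta 0)) (int a * 0)"
      using d[OF pos(1), of j] d[OF pos(2), of b] by simp_all
    then show ?thesis unfolding mj rule_graph.simps by blast
  qed
  ultimately have "(ev wr_base p, ev wr_base q) \<in> Phi (rl i)"
    unfolding PhiE using pq' by (auto simp only: ev_wr_xp ev_wr_tw)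
  then show "wact r s = s"
    unfolding i(3) hrel_def by (intro wact_relator[OF St pq _ s])
qed

text \<open>Kept as a closed set of words, so that its translates are the left cosets of the
  subgroup and lie in the domain of the regular representation.\<close>

definition L where
  "L = {w. \<exists>ws. (\<forall>v\<in>set ws. v \<in> set (gens_L rs bs) \<or> winv v \<in> set (gens_L rs bs)) \<and>
              weq (set (rels_K rs)) w (concat ws)}"

text \<open>The generators of \<open>L\<close> are stable letters and elements t_s whose image lies
  in \<open>H\<close>, so by \<open>wact_in_H\<close> products of them leave the group component in
  \<open>H\<close>. For t_i this means that the indicator function of i is supported on
  \<open>D\<close>.\<close>

lemma tw_notin_L:
  assumes i: "i \<notin> D"
  shows "tw i \<notin> L"
proof
  assume "tw i \<in> L"
  then obtain ws where ws: "\<And>v. v \<in> set ws \<Longrightarrow> v \<in> set (gens_L rs bs) \<or> winv v \<in> set (gens_L rs bs)"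
    and eq: "weq (set (rels_K rs)) (tw i) (concat ws)" by (auto simp: L_def)
  have "in_H (wact (concat ws) (0, []))"
  proof (rule wact_in_H)
    fix v assume v: "v \<in> set ws"
    have H: "Wr (delta (int s)) 0 \<in> H" "- Wr (delta (int s)) 0 \<in> H" if "s \<in> set bs" for s
      using reach_base[OF that] by (auto simp: H_def delta_def)
    obtain u where u: "u \<in> set (gens_L rs bs)" "v = u \<or> v = winv u"
      using ws[OF v] by (metis winv_simps(4))
    from u(1) consider s where "s \<in> set bs" "u = tw (int s)" | k where "k < length rs" "u = [rl k]"
      by (auto simp: gens_L_def)
    then show "(\<exists>e\<in>St. v = [e]) \<or> (set v \<inter> St = {} \<and> ev wr_base v \<in> H)"
    proof cases
      case 1
      have "over {1, 2} v" using 1 u(2) by (auto simp: over_tw)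
      moreover have "ev wr_base v \<in> H"
        using 1 u(2) H ev_winv[of wr_base, OF wr_base_minus] by (auto simp: ev_wr_tw)
      ultimately show ?thesis using xt_base by blast
    next
      case 2
      then show ?thesis using u(2) by (auto simp: St_def rl_def)
    qed
  qed (auto simp: in_H_def H_0)
  moreover have "wact (concat ws) (0, []) = wact (tw i) (0, [])"
    using eq wact_rels_K by (metis val_eq_iff)
  moreover have "wact (tw i) (0, []) = (Wr (delta i) 0, [])"
    using wact_base[OF xt_base, of "tw i" 0 "[]"] by (simp add: over_tw ev_wr_tw)
  ultimately have "Wr (delta i) 0 \<in> H" by (simp add: in_H_def)
  then show False using i by (auto simp: H_def delta_def)
qed

lemma L_closed: "wclosed (set (rels_K rs)) L"
  by (auto simp: wclosed_def L_def) (meson weq_sym weq_trans)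

lemma L_Nil: "[] \<in> L"
  unfolding L_def by (auto intro!: exI[of _ "[]"] weq_refl)

lemma L_gens: assumes "w \<in> set (gens_L rs bs)" shows "ltrans w L = L"
proof -
  have "winv w @ v \<in> L" if v: "v \<in> L" and w: "w \<in> set (gens_L rs bs) \<or> winv w \<in> set (gens_L rs bs)" for v w
  proof -
    obtain ws where ws: "\<forall>v\<in>set ws. v \<in> set (gens_L rs bs) \<or> winv v \<in> set (gens_L rs bs)"
      "weq (set (rels_K rs)) v (concat ws)" using v by (auto simp: L_def)
    have "weq (set (rels_K rs)) (winv w @ v) (concat (winv w # ws))"
      using weq_append[OF ws(2), of "winv w" "[]"] by simp
    then show ?thesis using ws(1) w unfolding L_def by (force intro!: exI[of _ "winv w # ws"])
  qed
  note step = this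
  have "v \<in> L" if "winv w @ v \<in> L" for v
  proof -
    have "w @ winv w @ v \<in> L" using step[OF that, of "winv w"] assms by simp
    moreover have "weq (set (rels_K rs)) ([] @ (w @ winv w) @ v) ([] @ [] @ v)"
      by (rule weq_append[OF weq_winv_self])
    ultimately show ?thesis using L_closed by (auto simp: wclosed_def)
  qed
  with step[OF _ disjI1[OF assms]] show ?thesis unfolding ltrans_def by blast
qed

end

lemma sound_act:
  assumes "weq R u v"
    and V: "\<And>a s. s \<in> V \<Longrightarrow> f a s \<in> V" and inv: "\<And>a s. s \<in> V \<Longrightarrow> f a (f (- a) s) = s"
    and rel: "\<And>r s. r \<in> R \<Longrightarrow> s \<in> V \<Longrightarrow> foldr f r s = s" and s: "s \<in> V"
  shows "foldr f u s = foldr f v s"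
proof -
  have V': "s \<in> V \<Longrightarrow> foldr f w s \<in> V" for w s by (induction w) (auto simp: V)
  show ?thesis using assms(1) s
    by (induction arbitrary: s rule: weq.induct) (simp_all add: V' inv rel)
qed

definition rels_Pinf :: "rule list \<Rightarrow> nat list \<Rightarrow> nat \<Rightarrow> int list set" where
  "rels_Pinf rs bs n = set (rels_P rs bs) \<union> range rho2 \<union> range (rho3 n)"

context rules
begin

text \<open>The letters other than 3 translate the sets of words closed under the relators of \<open>rels_K\<close>,
  and the letter 3 increments the second component at the coset \<open>L\<close>.\<close>

definition vact :: "nat \<Rightarrow> int \<Rightarrow> int list set \<times> int \<Rightarrow> int list set \<times> int" where
  "vact n a s = (if a = 3 then (fst s, (snd s + of_bool (fst s = L)) mod int n)
     else if a = -3 then (fst s, (snd s - of_bool (fst s = L)) mod int n) else (ltrans [a] (fst s), snd s))"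

definition V where "V n = {s. wclosed (set (rels_K rs)) (fst s) \<and> 0 \<le> snd s \<and> snd s < int n}"

lemma vact_no3: "set w \<inter> {3, -3} = {} \<Longrightarrow> foldr (vact n) w (X, c) = (ltrans w X, c)"
proof (induction w)
  case (Cons a w)
  then show ?case using ltrans_append[of "[a]" w X] by (simp add: vact_def)
qed simp

lemma vact_3: "vact n 3 (X, c) = (X, (c + of_bool (X = L)) mod int n)"
  "vact n (-3) (X, c) = (X, (c - of_bool (X = L)) mod int n)"
  by (simp_all add: vact_def)

lemma vact_3n:
  assumes "0 \<le> c" "c < int n"
  shows "foldr (vact n) (replicate m 3) (X, c) = (X, (c + int m * of_bool (X = L)) mod int n)"
    "foldr (vact n) (replicate m (-3)) (X, c) = (X, (c - int m * of_bool (X = L)) mod int n)"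
  by (induction m) (use assms in \<open>simp_all add: vact_3 algebra_simps mod_simps\<close>)

lemma vact_V: "0 < n \<Longrightarrow> s \<in> V n \<Longrightarrow> vact n a s \<in> V n"
  by (auto simp: V_def vact_def wclosed_ltrans)

lemma ltrans_cancel:
  assumes "wclosed R X" shows "ltrans w (ltrans (winv w) X) = X" "ltrans (winv w) (ltrans w X) = X"
  using ltrans_weq[OF assms weq_winv_self[of R w]] ltrans_weq[OF assms weq_winv_self[of R "winv w"]]
  by (simp_all flip: ltrans_append)

lemma vact_inv: "s \<in> V n \<Longrightarrow> vact n a (vact n (- a) s) = s"
  using ltrans_cancel(1)[of "set (rels_K rs)" "fst s" "[a]"]
  by (cases s) (auto simp: V_def vact_def mod_simps)

lemma tw_no3: "set (tw i) \<inter> {3, -3} = {}" "set (winv (tw i)) \<inter> {3, -3} = {}"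
  by (auto simp: tw_def xp_def winv_def split: if_splits)

lemma letters_K_no3: "over (letters_K rs) w \<Longrightarrow> set w \<inter> {3, -3} = {}"
  by (auto simp: over_def letters_K_def rl_def)

text \<open>The letter 3 and its conjugates by t_i change only the counter, each at one translate of
  \<open>L\<close>. Such maps commute, which gives \<open>rho2\<close>, and their n-th powers vanish
  modulo n, which gives \<open>rho3\<close>. Generators of \<open>L\<close> fix \<open>L\<close>, so
  3 commutes with them.\<close>

lemma vact_relator:
  assumes r: "r \<in> rels_Pinf rs bs n" and s: "s \<in> V n"
  shows "foldr (vact n) r s = s"
proof -
  let ?R = "set (rels_K rs)"
  obtain X c where Xc: "s = (X, c)" by (cases s)
  have X: "wclosed ?R X" and c: "0 \<le> c" "c < int n" using s by (auto simp: V_def Xc)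
  have cl: "ltrans w X = L \<longleftrightarrow> X = L" if "w \<in> set (gens_L rs bs) \<or> winv w \<in> set (gens_L rs bs)" for w
  proof -
    have "ltrans w L = L"
      using that L_gens[of w] L_gens[of "winv w"] ltrans_cancel(2)[OF L_closed, of "winv w"] by auto
    moreover have "ltrans (winv w) L = L"
      using that L_gens[of w] L_gens[of "winv w"] ltrans_cancel(2)[OF L_closed, of w] by auto
    ultimately show ?thesis using ltrans_cancel(2)[OF X, of w] by metis
  qed
  from r consider "r \<in> ?R" | w where "w \<in> set (gens_L rs bs)" "r = hrel 3 w w" | i where "r = rho2 i" | i where "r = rho3 n i"
    by (auto simp: rels_Pinf_def rels_P_def)
  then show ?thesis
  proof cases
    case 1
    have "over (letters_K rs) r" using tfs_K[OF rs_pos] 1 by (simp add: tfs_def)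
    then have "foldr (vact n) r s = (ltrans r X, c)" unfolding Xc using letters_K_no3 vact_no3 by blast
    moreover have "ltrans r X = X" using ltrans_weq[OF X, of r "[]"] weq_rel[OF 1, of "[]" "[]"] by simp
    ultimately show ?thesis by (simp add: Xc)
  next
    case 2
    have no3: "set w \<inter> {3, -3} = {}" "set (winv w) \<inter> {3, -3} = {}"
      using over_gens_L[OF 2(1)] letters_K_no3[of w] letters_K_no3[of "winv w"] by simp_all
    have "ltrans (winv w) X = L \<longleftrightarrow> X = L" using cl[of "winv w"] 2(1) by simp
    then show ?thesis
      using c by (simp add: 2(2) hrel_def Xc vact_no3[OF no3(1)] vact_no3[OF no3(2)] vact_3 ltrans_cancel[OF X] mod_simps)
  next
    case 3
    note t = vact_no3[OF tw_no3(1)[of i]] vact_no3[OF tw_no3(2)[of i]] 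
    have "winv [3] = [- 3 :: int]" by simp
    then show ?thesis
      using c by (simp add: 3 rho2_def hrel_def Xc t vact_3 ltrans_cancel[OF X] mod_simps algebra_simps)
  next
    case 4
    note t = vact_no3[OF tw_no3(1)[of i]] vact_no3[OF tw_no3(2)[of i]] 
    have "winv (replicate n 3) = replicate n (- 3)" by (simp add: winv_def)
    then show ?thesis
      using c by (simp add: 4 rho3_def Xc t vact_3n ltrans_cancel[OF X] del: foldr_replicate)
  qed
qed

text \<open>Since t_i^-1 moves \<open>L\<close>, the inner letter 3 does nothing at
  \<open>(L, 0)\<close>; only the outer inverse counts, and -1 is nonzero modulo n for n at least
  2.\<close>

lemma separation:
  assumes n: "2 \<le> n" and i: "i \<notin> D"
  shows "val (rels_Pinf rs bs n) ([-3] @ tw i @ [3] @ winv (tw i)) \<noteq> 0"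
proof
  assume "val (rels_Pinf rs bs n) ([-3] @ tw i @ [3] @ winv (tw i)) = 0"
  then have w: "weq (rels_Pinf rs bs n) ([-3] @ tw i @ [3] @ winv (tw i)) []"
    by (simp only: val_eq_0_iff)
  have L: "(L, 0) \<in> V n" using n L_closed by (simp add: V_def)
  have "foldr (vact n) ([-3] @ tw i @ [3] @ winv (tw i)) (L, 0) = foldr (vact n) [] (L, 0)"
    by (rule sound_act[OF w, of "V n"]) (use n vact_V vact_inv vact_relator L in auto)
  moreover have "ltrans (winv (tw i)) L \<noteq> L"
  proof
    assume "ltrans (winv (tw i)) L = L"
    then have "ltrans (tw i) L = L" using ltrans_cancel(1)[OF L_closed, of "tw i"] by simp
    moreover have "tw i \<in> ltrans (tw i) L"
      using L_closed L_Nil weq_winv_self[of "set (rels_K rs)" "winv (tw i)"]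
      by (auto simp: ltrans_def wclosed_def dest: weq_sym)
    ultimately show False using tw_notin_L[OF i] by simp
  qed
  ultimately have "(- 1) mod int n = 0"
    using n by (simp add: vact_no3[OF tw_no3(1)[of i]] vact_no3[OF tw_no3(2)[of i]] vact_3 ltrans_cancel[OF L_closed])
  then show False using n by (simp add: zmod_minus1)
qed

end

section \<open>The finite presentation\<close>

definition pres :: "rule list \<Rightarrow> nat list \<Rightarrow> nat \<Rightarrow> int list list" where
  "pres rs bs n = rels_P rs bs @ rels_B (letters_P rs) n @ rels_S"

definition pres_gens :: "rule list \<Rightarrow> nat" where "pres_gens rs = 14 + length rs"

context rules
begin

lemma rels_P_over: "r \<in> set (rels_P rs bs) \<Longrightarrow> over (set (letters_P rs)) r"
  using tfs_P[OF rs_pos, where bs = bs] by (auto simp: tfs_def set_letters_P)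

lemma letters_P_pos: "p \<in> set (letters_P rs) \<Longrightarrow> 0 < p \<and> p \<notin> {4..14}"
  by (auto simp: letters_P_def rl_def)

lemma tower_P: "tower (letters_P rs) (set (rels_P rs bs))"
  by unfold_locales (use letters_P_pos rels_P_over in \<open>auto simp: letters_P_def\<close>)

lemma gens_eq: "{4..12} \<union> set (letters_P rs) \<union> {13, 14} = {1..int (pres_gens rs)}"
proof -
  have "rl ` {..<k} = {15..14 + int k}" for k
    by (induction k) (auto simp: rl_def lessThan_Suc)
  then have letters: "set (letters_P rs) = {1, 2, 3} \<union> {15..14 + int (length rs)}"
    by (auto simp: set_letters_P letters_K_def)
  show ?thesis unfolding letters pres_gens_def by (rule set_eqI) (simp, presburger)
qed

lemma set_pres: "set (pres rs bs n) = tower.G (letters_P rs) (set (rels_P rs bs)) n"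
  using tower.G_def[OF tower_P] tower.B_def[OF tower_P] by (auto simp: pres_def)

lemma pres_torsion_free:
  assumes D: "D = UNIV"
  shows "tfs {1..int (pres_gens rs)} (set (pres rs bs n))"
proof -
  let ?R = "set (rels_P rs bs)"
  interpret T: tower_rho "letters_P rs" ?R n
  proof (intro tower_rho.intro[OF tower_P] tower_rho_axioms.intro)
    fix i
    let ?T = "val ?R (tw i)" and ?k = "reg ?R 3"
    have "?k + ?T - ?k = ?T" using k_commutes[OF subset_refl, of i rs bs] D by simp
    then have c: "?k + ?T = ?T + ?k" by (simp only: diff_eq_eq)
    then have "?T + ?k - ?T = ?k" by (simp add: diff_eq_eq)
    then show "val ?R (rho2 i) = 0"
      unfolding ev_rho2[of "reg ?R", OF reg_minus] by simp
    have "zp (int n) ?k + ?T = ?T + zp (int n) ?k" by (rule zp_commute[OF c])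
    then show "val ?R (rho3 n i) = 0"
      unfolding ev_rho3[of "reg ?R", OF reg_minus] by (simp add: diff_eq_eq)
  qed
  have "tfs (set (letters_P rs)) ?R"
    unfolding set_letters_P by (rule tfs_P) (rule rs_pos)
  from T.tfs_G[OF this] show ?thesis
    by (simp only: T.letters_B_def gens_eq set_pres)
qed

text \<open>The torsion element is nontrivial because it survives in the tower over
  \<open>rels_Pinf\<close>, a quotient of the presented group: both families hold there by force, so
  \<open>G_embed\<close> applies and \<open>separation\<close> decides.\<close>

lemma pres_torsion:
  assumes n: "2 \<le> n" and i: "i \<notin> D"
  shows "\<exists>w. over {1..int (pres_gens rs)} w \<and> val (set (pres rs bs n)) (wpow n w) = 0 \<and> val (set (pres rs bs n)) w \<noteq> 0"
proof -
  let ?w = "[-3] @ tw i @ [3] @ winv (tw i)"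
  interpret T: tower "letters_P rs" "set (rels_P rs bs)" n by (rule tower_P)
  interpret I: tower_rho "letters_P rs" "rels_Pinf rs bs n" n
  proof
    show "val (rels_Pinf rs bs n) (rho2 i) = 0" "val (rels_Pinf rs bs n) (rho3 n i) = 0" for i
      by (rule val_relator; simp add: rels_Pinf_def)+
    show "over (set (letters_P rs)) r" if "r \<in> rels_Pinf rs bs n" for r
      using that rels_P_over rho_family_2 rho_family_3[of n] over_mono[of "{1, 2, 3}" r "set (letters_P rs)"] 
      by (auto simp: rels_Pinf_def rho_family_def letters_P_def)
  qed (use letters_P_pos in \<open>auto simp: letters_P_def\<close>)
  have ov: "over (set (letters_P rs)) ?w"
    using T.ps_123 by (simp add: over_tw)
  have "val I.G ?w \<noteq> 0" using separation[OF n i] I.G_embed[OF ov] by blast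
  moreover have "val I.G w = val I.G []" if "val T.G w = val T.G []" for w
  proof (rule weq_mono[OF _ that])
    have "T.G \<subseteq> I.G"
      unfolding T.G_def I.G_def T.B_def I.B_def by (auto simp: rels_Pinf_def)
    then show "val I.G r = 0" if "r \<in> T.G" for r using that by (intro val_relator) blast
  qed
  ultimately have "val T.G ?w \<noteq> 0" by (metis list.simps(8) sum_list.Nil)
  moreover have "val T.G (wpow n ?w) = 0" by (rule T.torsion_element[OF subset_refl])
  moreover have "over {1..int (pres_gens rs)} ?w"
    using over_mono[OF ov] gens_eq by blast
  ultimately show ?thesis unfolding set_pres by blast
qed

end

lemma valid_word_iff: "valid_word n w \<longleftrightarrow> over {1..int n} w"
  by (force simp: valid_word_def over_def)

lemma A_torsion_free_pres_iff:
  "A_torsion_free_pres A n R \<longleftrightarrow>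
     (\<forall>w k. over {1..int n} w \<longrightarrow> k \<in> A \<longrightarrow> val (set R) (wpow k w) = 0 \<longrightarrow> val (set R) w = 0)"
  by (simp add: A_torsion_free_pres_def valid_word_iff word_eq_iff_weq val_eq_0_iff wpow_def)

text \<open>A single n from \<open>A\<close> suffices: either the group is torsion-free altogether,
  or it has a nontrivial element whose n-th power is trivial.\<close>

theorem pres_A_torsion_free_iff:
  assumes "\<And>m j a b. (m, j, a, b) \<in> set rs \<Longrightarrow> 0 < m \<and> 0 < a" and A: "\<forall>k\<in>A. 2 \<le> k" "n \<in> A"
  shows "valid_pres (pres_gens rs) (pres rs bs n)"
    and "A_torsion_free_pres A (pres_gens rs) (pres rs bs n) \<longleftrightarrow> reach rs bs = UNIV"
proof -
  interpret rules rs bs by unfold_locales (use assms(1) in auto)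
  have n: "2 \<le> n" using A by auto
  interpret T: tower "letters_P rs" "set (rels_P rs bs)" n by (rule tower_P)
  have "over (T.letters_B \<union> {13, 14}) r" if r: "r \<in> T.G" for r
  proof (cases "r \<in> T.B")
    case True
    then show ?thesis by (rule over_mono[OF T.over_B]) auto
  next
    case False
    have "r \<in> (\<Union>e\<in>{13, 14}. hrels e (set (spairs (if e = 13 then \<alpha>2 else \<alpha>3))))"
      using r[unfolded T.G_eq] False by (simp only: Un_iff simp_thms)
    then obtain e a b where e: "e \<in> {13, 14}" "(a, b) \<in> set (spairs (if e = 13 then \<alpha>2 else \<alpha>3))" "r = hrel e a b"
      by (elim UN_E imageE) (metis case_prod_conv surj_pair)
    then have "over (T.letters_B \<union> {13, 14}) a" "over (T.letters_B \<union> {13, 14}) b"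
      using T.S_over[OF e(2)] over_mono[of T.letters_B] by blast+
    with e show ?thesis by (auto simp: over_hrel)
  qed
  then show "valid_pres (pres_gens rs) (pres rs bs n)"
    unfolding valid_pres_def valid_word_iff set_pres T.letters_B_def gens_eq by blast
  show "A_torsion_free_pres A (pres_gens rs) (pres rs bs n) \<longleftrightarrow> reach rs bs = UNIV"
  proof
    assume "A_torsion_free_pres A (pres_gens rs) (pres rs bs n)"
    then show "reach rs bs = UNIV"
      using pres_torsion[OF n] A(2) unfolding A_torsion_free_pres_iff by blast
  next
    assume "reach rs bs = UNIV"
    then have "torsion_free {1..int (pres_gens rs)} (set (pres rs bs n))"
      using pres_torsion_free by (simp add: tfs_def)
    moreover have "0 < k" if "k \<in> A" for k using bspec[OF A(1) that] by simp
    ultimately show "A_torsion_free_pres A (pres_gens rs) (pres rs bs n)"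
      unfolding A_torsion_free_pres_iff torsion_free_def by blast
  qed
qed

section \<open>Primitive recursive functions\<close>

text \<open>The rule \<open>pr_ext\<close> frees later definitions from caring about argument lists
  of the wrong length.\<close>

inductive pr :: "nat \<Rightarrow> (nat list \<Rightarrow> nat) \<Rightarrow> bool" where
  pr_zero: "pr n (\<lambda>xs. 0)"
| pr_succ: "pr (Suc n) (\<lambda>xs. Suc (hd xs))"
| pr_proj: "i < n \<Longrightarrow> pr n (\<lambda>xs. xs ! i)"
| pr_comp: "pr (length gs) f \<Longrightarrow> \<forall>g\<in>set gs. pr n g \<Longrightarrow> pr n (\<lambda>xs. f (map (\<lambda>g. g xs) gs))"
| pr_prim: "pr n f \<Longrightarrow> pr (Suc (Suc n)) g \<Longrightarrow>
    pr (Suc n) (\<lambda>xs. rec_nat (f (tl xs)) (\<lambda>i y. g (i # y # tl xs)) (hd xs))"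
| pr_ext: "pr n f \<Longrightarrow> (\<forall>xs. length xs = n \<longrightarrow> f xs = g xs) \<Longrightarrow> pr n g"

lemma pr_recf: "pr n f \<Longrightarrow> \<exists>p. \<forall>xs. length xs = n \<longrightarrow> eval p xs (f xs)"
proof (induction rule: pr.induct)
  case (pr_zero n)
  show ?case using eval_Zero by blast
next
  case (pr_succ n)
  have "eval Succ xs (Suc (hd xs))" if "length xs = Suc n" for xs
    using that eval_Succ[of "hd xs" "tl xs"] by (cases xs) auto
  then show ?case by blast
next
  case (pr_proj i n)
  then show ?case using eval_Proj by blast
next
  case (pr_comp gs f n)
  from pr_comp obtain p where p: "\<And>xs. length xs = length gs \<Longrightarrow> eval p xs (f xs)" by blast
  from pr_comp(3) have "\<forall>g\<in>set gs. \<exists>q. \<forall>xs. length xs = n \<longrightarrow> eval q xs (g xs)" by blast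
  then obtain q where q: "\<And>g xs. g \<in> set gs \<Longrightarrow> length xs = n \<Longrightarrow> eval (q g) xs (g xs)" by metis
  have "eval (Comp p (map q gs)) xs (f (map (\<lambda>g. g xs) gs))" if "length xs = n" for xs
    by (rule eval_Comp[of xs _ "map (\<lambda>g. g xs) gs"]) (use p q that in \<open>auto simp: list_all2_conv_all_nth\<close>)
  then show ?case by blast
next
  case (pr_prim n f g)
  then obtain p q where p: "\<And>xs. length xs = n \<Longrightarrow> eval p xs (f xs)"
    and q: "\<And>xs. length xs = Suc (Suc n) \<Longrightarrow> eval q xs (g xs)" by blast
  have "eval (Prim p q) (m # xs) (rec_nat (f xs) (\<lambda>i y. g (i # y # xs)) m)" if "length xs = n" for m xs
  proof (induction m)
    case 0
    show ?case using eval_Prim0[OF p[OF that]] by simp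
  next
    case (Suc m)
    show ?case using eval_PrimS[OF Suc q] that by simp
  qed
  then have "eval (Prim p q) xs (rec_nat (f (tl xs)) (\<lambda>i y. g (i # y # tl xs)) (hd xs))" if "length xs = Suc n" for xs
    using that by (cases xs) auto
  then show ?case by blast
qed auto

inductive_cases evalE: "eval Zero xs v" "eval Succ xs v" "eval (Proj i) xs v" "eval (Comp f gs) xs v"
  "eval (Prim f g) (0 # xs) v" "eval (Prim f g) (Suc n # xs) v" "eval (Mu f) xs v"

lemma eval_deterministic: "eval p xs v \<Longrightarrow> eval p xs v' \<Longrightarrow> v = v'"
proof (induction arbitrary: v' rule: eval.induct)
  case (eval_Comp xs gs ys f z)
  from eval_Comp.prems obtain ys' where ys': "list_all2 (\<lambda>g y. eval g xs y) gs ys'" "eval f ys' v'"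
    by (rule evalE(4))
  have "ys = ys'"
    by (rule nth_equalityI) (use eval_Comp.IH(1) ys'(1) in \<open>auto simp: list_all2_conv_all_nth\<close>)
  then show ?case using eval_Comp.IH(2) ys'(2) by simp
next
  case (eval_Prim0 f xs y g)
  from eval_Prim0.prems have "eval f xs v'" by (rule evalE(5))
  then show ?case by (rule eval_Prim0.IH)
next
  case (eval_PrimS f g n xs y z)
  from eval_PrimS.prems obtain y' where "eval (Prim f g) (n # xs) y'" "eval g (n # y' # xs) v'"
    by (rule evalE(6))
  then show ?case using eval_PrimS.IH by metis
next
  case (eval_Mu f n xs)
  from eval_Mu.prems have n': "eval f (v' # xs) 0" "\<forall>m<v'. \<exists>v. eval f (m # xs) v \<and> 0 < v"
    by (auto elim: evalE(7))
  show ?case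
  proof (rule linorder_cases[of n v'])
    assume "n < v'"
    then obtain v where "eval f (n # xs) v" "0 < v" using n'(2) by blast
    then show ?thesis using eval_Mu.IH(1) by fastforce
  next
    assume "v' < n"
    then show ?thesis using eval_Mu.IH(2) n'(1) by fastforce
  qed
qed (blast elim: evalE)+

lemma pr_comp1: "pr 1 (\<lambda>xs. f (xs ! 0)) \<Longrightarrow> pr n g \<Longrightarrow> pr n (\<lambda>xs. f (g xs))"
  using pr_comp[of "[g]" "\<lambda>xs. f (xs ! 0)" n] by simp

lemma pr_Suc: "pr n f \<Longrightarrow> pr n (\<lambda>xs. Suc (f xs))"
proof (rule pr_comp1[of Suc])
  show "pr 1 (\<lambda>xs. Suc (xs ! 0))"
    unfolding One_nat_def by (rule pr_ext[OF pr_succ]) (auto simp: length_Suc_conv)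
qed

lemma pr_const: "pr n (\<lambda>xs. c)"
  by (induction c) (auto intro: pr_zero pr_Suc)

lemma pr_lift: assumes "pr n a" shows "pr (Suc (Suc n)) (\<lambda>zs. a (tl (tl zs)))"
proof -
  have "pr (Suc (Suc n)) (\<lambda>xs. a (map (\<lambda>g. g xs) (map (\<lambda>i xs. xs ! Suc (Suc i)) [0..<n])))"
    by (rule pr_comp) (use assms in \<open>auto intro: pr_proj\<close>)
  then show ?thesis
  proof (rule pr_ext, intro allI impI)
    fix xs :: "nat list" assume "length xs = Suc (Suc n)"
    then have "map (\<lambda>g. g xs) (map (\<lambda>i xs. xs ! Suc (Suc i)) [0..<n]) = tl (tl xs)"
      by (intro nth_equalityI) (auto simp: nth_tl)
    then show "a (map (\<lambda>g. g xs) (map (\<lambda>i xs. xs ! Suc (Suc i)) [0..<n])) = a (tl (tl xs))" by simp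
  qed
qed

lemma pr_rec:
  assumes "pr n a" "pr (Suc (Suc n)) b" "pr n c"
  shows "pr n (\<lambda>xs. rec_nat (a xs) (\<lambda>i y. b (i # y # xs)) (c xs))"
proof -
  let ?gs = "c # map (\<lambda>i xs. xs ! i) [0..<n]"
  have "pr (length ?gs) (\<lambda>xs. rec_nat (a (tl xs)) (\<lambda>i y. b (i # y # tl xs)) (hd xs))"
    using pr_prim[OF assms(1,2)] by simp
  then have "pr n (\<lambda>xs. (\<lambda>xs. rec_nat (a (tl xs)) (\<lambda>i y. b (i # y # tl xs)) (hd xs)) (map (\<lambda>g. g xs) ?gs))"
    by (rule pr_comp) (use assms(3) in \<open>auto intro: pr_proj\<close>)
  then show ?thesis
  proof (rule pr_ext, intro allI impI)
    fix xs :: "nat list" assume "length xs = n"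
    then have "map (\<lambda>g. g xs) (map (\<lambda>i xs. xs ! i) [0..<n]) = xs"
      by (intro nth_equalityI) auto
    then show "(\<lambda>xs. rec_nat (a (tl xs)) (\<lambda>i y. b (i # y # tl xs)) (hd xs)) (map (\<lambda>g. g xs) ?gs)
        = rec_nat (a xs) (\<lambda>i y. b (i # y # xs)) (c xs)" by simp
  qed
qed

lemma pr_fst_arg: "pr (Suc (Suc n)) (\<lambda>zs. zs ! 0)" and pr_snd_arg: "pr (Suc (Suc n)) (\<lambda>zs. zs ! 1)"
  by (auto intro: pr_proj)

lemma pr_add: assumes "pr n a" "pr n b" shows "pr n (\<lambda>xs. a xs + b xs)"
proof -
  have "rec_nat u (\<lambda>i y. Suc y) v = u + v" for u v :: nat by (induction v) auto
  then show ?thesis using pr_rec[OF assms(1) pr_Suc[OF pr_snd_arg] assms(2)] by simp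
qed

lemma pr_mult: assumes "pr n a" "pr n b" shows "pr n (\<lambda>xs. a xs * b xs)"
proof -
  have "rec_nat 0 (\<lambda>i y. y + u) v = u * v" for u v :: nat by (induction v) auto
  then show ?thesis using pr_rec[OF pr_zero pr_add[OF pr_snd_arg pr_lift[OF assms(1)]] assms(2)] by simp
qed

lemma pr_pred: assumes "pr n a" shows "pr n (\<lambda>xs. a xs - 1)"
proof -
  have "rec_nat 0 (\<lambda>i y. i) v = v - 1" for v :: nat by (cases v) auto
  then show ?thesis using pr_rec[OF pr_zero pr_fst_arg assms] by simp
qed

lemma pr_diff: assumes "pr n a" "pr n b" shows "pr n (\<lambda>xs. a xs - b xs)"
proof -
  have "rec_nat u (\<lambda>i y. y - 1) v = u - v" for u v :: nat by (induction v) auto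
  then show ?thesis using pr_rec[OF assms(1) pr_pred[OF pr_snd_arg] assms(2)] by simp
qed

lemma pr_triangle: assumes "pr n a" shows "pr n (\<lambda>xs. triangle (a xs))"
proof -
  have "rec_nat 0 (\<lambda>i y. y + Suc i) v = triangle v" for v by (induction v) auto
  then show ?thesis using pr_rec[OF pr_zero pr_add[OF pr_snd_arg pr_Suc[OF pr_fst_arg]] assms] by simp
qed

text \<open>The index of the diagonal containing the number \<open>i\<close>.\<close>

definition diag :: "nat \<Rightarrow> nat" where
  "diag = rec_nat 0 (\<lambda>i y. y + (1 - ((Suc i - triangle (Suc y)) + (triangle (Suc y) - Suc i))))"

text \<open>The truncated differences in \<open>diag\<close> add 1 exactly when \<open>Suc i\<close>
  is the triangular number that opens the next diagonal.\<close>

lemma diag_bounds: "triangle (diag i) \<le> i \<and> i < triangle (Suc (diag i))"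
proof (induction i)
  case (Suc i)
  then show ?case by (cases "Suc i = triangle (Suc (diag i))") (auto simp: diag_def)
qed (simp add: diag_def)

lemma triangle_mono: "m \<le> n \<Longrightarrow> triangle m \<le> triangle n"
  by (induction rule: dec_induct) auto

lemma diag_prod_encode: "diag (prod_encode (a, b)) = a + b"
proof -
  have "triangle (a + b) \<le> prod_encode (a, b) \<and> prod_encode (a, b) < triangle (Suc (a + b))"
    by (simp add: prod_encode_def)
  then have "\<not> Suc (diag (prod_encode (a, b))) \<le> a + b" "\<not> Suc (a + b) \<le> diag (prod_encode (a, b))"
    using diag_bounds[of "prod_encode (a, b)"] triangle_mono by (meson le_less_trans not_less order.trans)+
  then show ?thesis by simp
qed

abbreviation pe :: "nat \<Rightarrow> nat \<Rightarrow> nat" where "pe a b \<equiv> prod_encode (a, b)"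
abbreviation p1 :: "nat \<Rightarrow> nat" where "p1 x \<equiv> fst (prod_decode x)"
abbreviation p2 :: "nat \<Rightarrow> nat" where "p2 x \<equiv> snd (prod_decode x)"

lemma p1_eq: "p1 x = x - triangle (diag x)" and p2_eq: "p2 x = diag x - p1 x"
proof -
  obtain a b where x: "x = pe a b" by (metis prod_decode_inverse surj_pair)
  show "p1 x = x - triangle (diag x)" by (simp add: x diag_prod_encode) (simp add: prod_encode_def)
  show "p2 x = diag x - p1 x" by (simp add: x diag_prod_encode)
qed

lemma pr_pe: "pr n a \<Longrightarrow> pr n b \<Longrightarrow> pr n (\<lambda>xs. pe (a xs) (b xs))"
  by (simp add: prod_encode_def pr_add pr_triangle)

lemma pr_diag: assumes "pr n a" shows "pr n (\<lambda>xs. diag (a xs))"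
proof -
  have t: "pr (Suc (Suc n)) (\<lambda>zs. triangle (Suc (zs ! 1)))" by (intro pr_triangle pr_Suc pr_snd_arg)
  have i: "pr (Suc (Suc n)) (\<lambda>zs. Suc (zs ! 0))" by (intro pr_Suc pr_fst_arg)
  have "pr (Suc (Suc n)) (\<lambda>zs. zs ! 1 + (1 - ((Suc (zs ! 0) - triangle (Suc (zs ! 1))) + (triangle (Suc (zs ! 1)) - Suc (zs ! 0)))))"
    by (intro pr_add pr_snd_arg pr_diff[OF pr_const] pr_diff t i)
  from pr_rec[OF pr_zero this assms] show ?thesis by (simp add: diag_def)
qed

lemma pr_p1: "pr n a \<Longrightarrow> pr n (\<lambda>xs. p1 (a xs))"
  unfolding p1_eq by (intro pr_diff pr_triangle pr_diag)

lemma pr_p2: "pr n a \<Longrightarrow> pr n (\<lambda>xs. p2 (a xs))"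
  unfolding p2_eq by (intro pr_diff pr_diag pr_p1)

text \<open>Unary primitive recursive functions, with tuples coded by \<open>prod_encode\<close>.\<close>

definition U :: "(nat \<Rightarrow> nat) \<Rightarrow> bool" where "U f \<longleftrightarrow> pr 1 (\<lambda>xs. f (xs ! 0))"

lemma U_pr: "U f \<Longrightarrow> pr n g \<Longrightarrow> pr n (\<lambda>xs. f (g xs))"
  unfolding U_def by (rule pr_comp1)

lemma U_computable: assumes "U f" shows "computable f"
proof -
  obtain p where p: "\<forall>xs. length xs = 1 \<longrightarrow> eval p xs (f (xs ! 0))"
    using assms pr_recf unfolding U_def by blast
  have "eval p [x] (f x)" for x using p[rule_format, of "[x]"] by simp
  then show ?thesis unfolding computable_def by blast
qed

lemma U_id: "U (\<lambda>x. x)" and U_const: "U (\<lambda>x. c)" and U_Suc: "U f \<Longrightarrow> U (\<lambda>x. Suc (f x))"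
  by (simp_all add: U_def pr_proj pr_const pr_Suc)

lemma U_comp: "U f \<Longrightarrow> U g \<Longrightarrow> U (\<lambda>x. f (g x))"
  unfolding U_def by (rule pr_comp1)

lemma U_add: "U f \<Longrightarrow> U g \<Longrightarrow> U (\<lambda>x. f x + g x)"
  and U_mult: "U f \<Longrightarrow> U g \<Longrightarrow> U (\<lambda>x. f x * g x)"
  and U_diff: "U f \<Longrightarrow> U g \<Longrightarrow> U (\<lambda>x. f x - g x)"
  and U_pe: "U f \<Longrightarrow> U g \<Longrightarrow> U (\<lambda>x. pe (f x) (g x))"
  and U_p1: "U f \<Longrightarrow> U (\<lambda>x. p1 (f x))"
  and U_p2: "U f \<Longrightarrow> U (\<lambda>x. p2 (f x))"
  by (simp_all add: U_def pr_add pr_mult pr_diff pr_pe pr_p1 pr_p2)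

lemma U_iter: assumes "U f" "U n" "U g" shows "U (\<lambda>x. (f ^^ n x) (g x))"
proof -
  have "rec_nat u (\<lambda>i y. f y) v = (f ^^ v) u" for u v by (induction v) auto
  then show ?thesis
    using pr_rec[of 1 "\<lambda>xs. g (xs ! 0)" "\<lambda>zs. f (zs ! 1)" "\<lambda>xs. n (xs ! 0)"] assms U_pr[OF assms(1) pr_snd_arg]
    by (simp add: U_def)
qed

section \<open>Projections of primitive recursive predicates\<close>

text \<open>The recursively enumerable predicates. Their closure under conjunction, disjunction,
  existential quantification and reachability replaces the construction of explicit
  \<open>recf\<close> programs.\<close>

definition sig :: "(nat \<Rightarrow> bool) \<Rightarrow> bool" where
  "sig P \<longleftrightarrow> (\<exists>f. U f \<and> (\<forall>x. P x \<longleftrightarrow> (\<exists>z. f (pe x z) = 0)))"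

lemma sigI: "U f \<Longrightarrow> (\<And>x. P x \<longleftrightarrow> (\<exists>z. f (pe x z) = 0)) \<Longrightarrow> sig P"
  unfolding sig_def by blast

lemma sigE: assumes "sig P" obtains f where "U f" "\<And>x. P x \<longleftrightarrow> (\<exists>z. f (pe x z) = 0)"
  using assms unfolding sig_def by blast

lemma sig_eq: assumes "U f" "U g" shows "sig (\<lambda>x. f x = g x)"
proof (rule sigI)
  show "U (\<lambda>u. (f (p1 u) - g (p1 u)) + (g (p1 u) - f (p1 u)))"
    by (intro U_add U_diff U_comp[OF assms(1)] U_comp[OF assms(2)] U_p1 U_id)
qed auto

lemma sig_comp: assumes "sig P" "U g" shows "sig (\<lambda>x. P (g x))"
proof (rule sigE[OF assms(1)])
  fix f assume f: "U f" "\<And>x. P x \<longleftrightarrow> (\<exists>z. f (pe x z) = 0)"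
  show ?thesis
    by (rule sigI[of "\<lambda>u. f (pe (g (p1 u)) (p2 u))"])
       (intro U_comp[OF f(1)] U_pe U_comp[OF assms(2)] U_p1 U_p2 U_id, simp add: f(2))
qed

lemma sig_and: assumes "sig P" "sig Q" shows "sig (\<lambda>x. P x \<and> Q x)"
proof (rule sigE[OF assms(1)], rule sigE[OF assms(2)])
  fix f g assume f: "U f" "\<And>x. P x \<longleftrightarrow> (\<exists>z. f (pe x z) = 0)" and g: "U g" "\<And>x. Q x \<longleftrightarrow> (\<exists>z. g (pe x z) = 0)"
  show ?thesis
  proof (rule sigI[of "\<lambda>u. f (pe (p1 u) (p1 (p2 u))) + g (pe (p1 u) (p2 (p2 u)))"])
    show "U (\<lambda>u. f (pe (p1 u) (p1 (p2 u))) + g (pe (p1 u) (p2 (p2 u))))"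
      by (intro U_add U_comp[OF f(1)] U_comp[OF g(1)] U_pe U_p1 U_p2 U_id)
    have "(\<exists>z. f (pe x z) = 0) \<and> (\<exists>z. g (pe x z) = 0) \<longleftrightarrow> (\<exists>z. f (pe x (p1 z)) = 0 \<and> g (pe x (p2 z)) = 0)" for x
      by (metis prod_encode_inverse fst_conv snd_conv)
    then show "P x \<and> Q x \<longleftrightarrow> (\<exists>z. f (pe (p1 (pe x z)) (p1 (p2 (pe x z)))) + g (pe (p1 (pe x z)) (p2 (p2 (pe x z)))) = 0)" for x
      by (simp add: f(2) g(2))
  qed
qed

lemma sig_or: assumes "sig P" "sig Q" shows "sig (\<lambda>x. P x \<or> Q x)"
proof (rule sigE[OF assms(1)], rule sigE[OF assms(2)])
  fix f g assume f: "U f" "\<And>x. P x \<longleftrightarrow> (\<exists>z. f (pe x z) = 0)" and g: "U g" "\<And>x. Q x \<longleftrightarrow> (\<exists>z. g (pe x z) = 0)"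
  show ?thesis
    by (rule sigI[of "\<lambda>u. f u * g u"]) (intro U_mult f(1) g(1), auto simp: f(2) g(2))
qed

lemma sig_ex: assumes "sig (\<lambda>u. P (p1 u) (p2 u))" shows "sig (\<lambda>x. \<exists>y. P x y)"
proof (rule sigE[OF assms])
  fix f assume f: "U f" "\<And>u. P (p1 u) (p2 u) \<longleftrightarrow> (\<exists>z. f (pe u z) = 0)"
  show ?thesis
  proof (rule sigI[of "\<lambda>u. f (pe (pe (p1 u) (p1 (p2 u))) (p2 (p2 u)))"])
    show "U (\<lambda>u. f (pe (pe (p1 u) (p1 (p2 u))) (p2 (p2 u))))"
      by (intro U_comp[OF f(1)] U_pe U_p1 U_p2 U_id)
    have "P x y \<longleftrightarrow> (\<exists>z. f (pe (pe x y) z) = 0)" for x y using f(2)[of "pe x y"] by simp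
    then have "(\<exists>y. P x y) \<longleftrightarrow> (\<exists>z. f (pe (pe x (p1 z)) (p2 z)) = 0)" for x
      by (metis prod_encode_inverse fst_conv snd_conv)
    then show "(\<exists>y. P x y) \<longleftrightarrow> (\<exists>z. f (pe (pe (p1 (pe x z)) (p1 (p2 (pe x z)))) (p2 (p2 (pe x z)))) = 0)" for x
      by simp
  qed
qed

text \<open>The witness codes a list of proposed next states, each with a certificate for the single
  step. \<open>h\<close> consumes one entry and moves only if the certificate checks; a false entry
  leaves the state as it is. So every number is an admissible list and only genuine paths are
  traced.\<close>

lemma sig_rtranclp:
  assumes Q: "sig (\<lambda>u. Q (p1 u) (p2 u))" and ab: "U a" "U b"
  shows "sig (\<lambda>x. Q\<^sup>*\<^sup>* (a x) (b x))"
proof (rule sigE[OF Q])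
  fix f assume f: "U f" "\<And>u. Q (p1 u) (p2 u) \<longleftrightarrow> (\<exists>z. f (pe u z) = 0)"
  have Q: "Q s s' \<longleftrightarrow> (\<exists>z. f (pe (pe s s') z) = 0)" for s s'
    using f(2)[of "pe s s'"] by simp
  define g where "g w s = (1 - f (pe (pe s (p1 w)) (p2 w))) * p1 w + (1 - (1 - f (pe (pe s (p1 w)) (p2 w)))) * s" for w s
  define h where "h u = pe (p2 (p1 u - 1)) (g (p1 (p1 u - 1)) (p2 u))" for u
  have g: "g w s = (if f (pe (pe s (p1 w)) (p2 w)) = 0 then p1 w else s)" for w s
    by (simp add: g_def)
  have "U (\<lambda>u. g (p1 (p1 u - 1)) (p2 u))"
    unfolding g_def by (intro U_add U_mult U_diff U_const U_comp[OF f(1)] U_pe U_p1 U_p2 U_id)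
  then have U_h: "U h" unfolding h_def by (intro U_pe U_p1 U_p2 U_diff U_const U_id)
  have h_pe: "h (pe l s) = pe (p2 (l - 1)) (g (p1 (l - 1)) s)" for l s by (simp add: h_def)
  have sound: "Q\<^sup>*\<^sup>* s (p2 ((h ^^ n) (pe l s)))" for n l s
  proof (induction n arbitrary: l s)
    case (Suc n)
    have "Q\<^sup>*\<^sup>* s (g (p1 (l - 1)) s)"
      using Q by (auto simp: g)
    then show ?case
      using Suc[of "g (p1 (l - 1)) s" "p2 (l - 1)"] by (simp only: funpow_Suc_right o_apply h_pe)
  qed simp
  have complete: "\<exists>l n. p2 ((h ^^ n) (pe l s)) = s'" if "Q\<^sup>*\<^sup>* s s'" for s s'
    using that
  proof (induction rule: converse_rtranclp_induct)
    case base
    show ?case by (intro exI[of _ 0]) simp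
  next
    case (step s s1)
    then obtain l n where ln: "p2 ((h ^^ n) (pe l s1)) = s'" by blast
    obtain z where z: "f (pe (pe s s1) z) = 0" using step(1) Q by blast
    have "h (pe (Suc (pe (pe s1 z) l)) s) = pe l s1" by (simp add: h_def g z)
    then have "p2 ((h ^^ Suc n) (pe (Suc (pe (pe s1 z) l)) s)) = s'"
      using ln by (simp only: funpow_Suc_right o_apply)
    then show ?case by blast
  qed
  have "Q\<^sup>*\<^sup>* s s' \<longleftrightarrow> (\<exists>z. p2 ((h ^^ p2 z) (pe (p1 z) s)) = s')" for s s'
    using sound complete by (metis prod_encode_inverse fst_conv snd_conv)
  moreover have "sig (\<lambda>x. \<exists>z. p2 ((h ^^ p2 z) (pe (p1 z) (a x))) = b x)"
    by (rule sig_ex) (intro sig_eq U_p2 U_iter U_h U_pe U_p1 U_id U_comp[OF ab(1)] U_comp[OF ab(2)])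
  ultimately show ?thesis by simp
qed

lemma sig_nz: "U f \<Longrightarrow> sig (\<lambda>x. f x \<noteq> 0)"
  using sig_eq[of "\<lambda>x. 1 - f x" "\<lambda>x. 0"] U_diff[OF U_const] U_const by (simp add: Suc_le_eq)

definition tlc :: "nat \<Rightarrow> nat" where "tlc l = p2 (l - 1)"
definition hdc :: "nat \<Rightarrow> nat" where "hdc l = p1 (l - 1)"

lemma U_tlc: "U f \<Longrightarrow> U (\<lambda>x. tlc (f x))" and U_hdc: "U f \<Longrightarrow> U (\<lambda>x. hdc (f x))"
  unfolding tlc_def hdc_def by (intro U_p1 U_p2 U_diff U_const; assumption)+

lemma list_decode_nz: "l \<noteq> 0 \<Longrightarrow> list_decode l = hdc l # list_decode (tlc l)"
  by (cases l) (auto simp: hdc_def tlc_def split: prod.split)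

lemma list_decode_eq_Nil: "list_decode l = [] \<longleftrightarrow> l = 0"
  by (metis list_decode_nz list.discI list_decode.simps(1))

lemma list_decode_tlc: "list_decode (tlc l) = tl (list_decode l)"
  by (cases "l = 0") (auto simp: list_decode_nz, simp add: tlc_def prod_decode_def prod_decode_aux.simps)

lemma list_decode_tlc_iter: "list_decode ((tlc ^^ i) l) = drop i (list_decode l)"
  by (induction i) (simp_all add: list_decode_tlc drop_Suc tl_drop)

definition sig_graph :: "recf \<Rightarrow> bool" where
  "sig_graph p \<longleftrightarrow> sig (\<lambda>u. eval p (list_decode (p1 u)) (p2 u))"

lemma sig_eval: "sig_graph p \<Longrightarrow> U F \<Longrightarrow> U V \<Longrightarrow> sig (\<lambda>u. eval p (list_decode (F u)) (V u))"
  using sig_comp[of _ "\<lambda>u. pe (F u) (V u)", OF _ U_pe] unfolding sig_graph_def by fastforce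

lemma sig_eval_list:
  assumes "\<And>g. g \<in> set gs \<Longrightarrow> sig_graph g"
  shows "sig (\<lambda>u. list_all2 (\<lambda>g y. eval g (list_decode (p1 u)) y) gs (list_decode (p2 u)))"
  using assms
proof (induction gs)
  case Nil
  have "sig (\<lambda>u. p2 u = 0)" by (intro sig_eq U_p2 U_id U_const)
  then show ?case by (simp add: list_decode_eq_Nil)
next
  case (Cons g gs)
  let ?P = "\<lambda>gs u. list_all2 (\<lambda>g y. eval g (list_decode (p1 u)) y) gs (list_decode (p2 u))"
  have eq: "?P (g # gs) u \<longleftrightarrow> p2 u \<noteq> 0 \<and> eval g (list_decode (p1 u)) (hdc (p2 u)) \<and> ?P gs (pe (p1 u) (tlc (p2 u)))" for u
    by (cases "p2 u = 0") (auto simp: list_decode_nz)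
  have "sig (\<lambda>u. ?P gs (pe (p1 u) (tlc (p2 u))))"
    by (rule sig_comp[where g = "\<lambda>u. pe (p1 u) (tlc (p2 u))", OF Cons.IH])
       (use Cons.prems in \<open>(intro U_pe U_p1 U_p2 U_tlc U_id | simp)+\<close>)
  moreover have "sig (\<lambda>u. eval g (list_decode (p1 u)) (hdc (p2 u)))"
    by (intro sig_eval U_p1 U_p2 U_hdc U_id) (simp add: Cons.prems)
  ultimately have "sig (\<lambda>u. p2 u \<noteq> 0 \<and> eval g (list_decode (p1 u)) (hdc (p2 u)) \<and> ?P gs (pe (p1 u) (tlc (p2 u))))"
    by (intro sig_and sig_nz U_p2 U_id)
  with eq show ?case by presburger
qed

lemma sig_graph_Prim:
  assumes f: "sig_graph f" and g: "sig_graph g"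
  shows "sig_graph (Prim f g)"
proof -
  \<comment> \<open>A state consists of the arguments, the stage and the current value;
    \<open>Q\<close> is one stage of the recursion. A list with head a and tail code l has code
    \<open>Suc (pe a l)\<close>.\<close>
  define Q where "Q s s' \<longleftrightarrow> p1 s' = p1 s \<and> p1 (p2 s') = Suc (p1 (p2 s)) \<and>
    eval g (list_decode (Suc (pe (p1 (p2 s)) (Suc (pe (p2 (p2 s)) (p1 s)))))) (p2 (p2 s'))" for s s'
  have U_p1p1: "U (\<lambda>u. p1 (p1 u))" by (intro U_p1 U_id)
  have Q: "sig (\<lambda>u. Q (p1 u) (p2 u))"
    unfolding Q_def by (intro sig_and sig_eq sig_eval[OF g] U_Suc U_pe U_p1 U_p2 U_id)
  have fwd: "\<exists>y0. eval f l y0 \<and> Q\<^sup>*\<^sup>* (pe (list_encode l) (pe 0 y0)) (pe (list_encode l) (pe n v))"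
    if "eval (Prim f g) (n # l) v" for n l v
    using that
  proof (induction n arbitrary: v)
    case 0
    then show ?case by (auto elim: evalE(5))
  next
    case (Suc n)
    from Suc.prems obtain y where y: "eval (Prim f g) (n # l) y" "eval g (n # y # l) v" by (rule evalE(6))
    then have "Q (pe (list_encode l) (pe n y)) (pe (list_encode l) (pe (Suc n) v))"
      by (simp add: Q_def)
    with Suc.IH[OF y(1)] show ?case by (meson rtranclp.rtrancl_into_rtrancl)
  qed
  have bwd: "p1 s = list_encode l \<and> eval (Prim f g) (p1 (p2 s) # l) (p2 (p2 s))"
    if "Q\<^sup>*\<^sup>* (pe (list_encode l) (pe 0 y0)) s" "eval f l y0" for l y0 s
    using that
  proof (induction rule: rtranclp_induct)
    case (step s s')
    then show ?case using eval_PrimS by (auto simp: Q_def)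
  qed (auto intro: eval_Prim0)
  have "eval (Prim f g) (list_decode (p1 u)) (p2 u) \<longleftrightarrow>
      p1 u \<noteq> 0 \<and> (\<exists>y0. eval f (list_decode (tlc (p1 u))) y0 \<and>
        Q\<^sup>*\<^sup>* (pe (tlc (p1 u)) (pe 0 y0)) (pe (tlc (p1 u)) (pe (hdc (p1 u)) (p2 u))))" for u
  proof (cases "p1 u = 0")
    case True
    then show ?thesis by (auto elim: eval.cases)
  next
    case False
    let ?n = "hdc (p1 u)" and ?l = "list_decode (tlc (p1 u))" and ?v = "p2 u"
    have "eval (Prim f g) (?n # ?l) ?v \<longleftrightarrow>
       (\<exists>y0. eval f ?l y0 \<and> Q\<^sup>*\<^sup>* (pe (tlc (p1 u)) (pe 0 y0)) (pe (tlc (p1 u)) (pe ?n ?v)))"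
      using fwd[of ?n ?l ?v] bwd[of ?l _ "pe (tlc (p1 u)) (pe ?n ?v)"] by auto
    with False show ?thesis by (simp add: list_decode_nz)
  qed
  moreover have "sig (\<lambda>u. p1 u \<noteq> 0 \<and> (\<exists>y0. eval f (list_decode (tlc (p1 u))) y0 \<and>
        Q\<^sup>*\<^sup>* (pe (tlc (p1 u)) (pe 0 y0)) (pe (tlc (p1 u)) (pe (hdc (p1 u)) (p2 u)))))"
    by (intro sig_and sig_nz sig_ex sig_eval[OF f] sig_rtranclp[OF Q] U_pe U_p1 U_p2 U_tlc U_hdc U_const U_id)
  ultimately show ?thesis by (simp add: sig_graph_def)
qed

lemma sig_graph_Mu:
  assumes f: "sig_graph f"
  shows "sig_graph (Mu f)"
proof -
  \<comment> \<open>A state (arguments, m) records that \<open>f\<close> is defined and positive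
    below m.\<close>
  define Q where "Q s s' \<longleftrightarrow> p1 s' = p1 s \<and> p2 s' = Suc (p2 s) \<and>
    (\<exists>v. eval f (list_decode (Suc (pe (p2 s) (p1 s)))) (Suc v))" for s s'
  have Q: "sig (\<lambda>u. Q (p1 u) (p2 u))"
    unfolding Q_def by (intro sig_and sig_eq sig_ex sig_eval[OF f] U_Suc U_pe U_p1 U_p2 U_id)
  have fwd: "Q\<^sup>*\<^sup>* (pe (list_encode l) 0) (pe (list_encode l) n)"
    if "\<forall>m<n. \<exists>v. eval f (m # l) v \<and> 0 < v" for n l
    using that
  proof (induction n)
    case (Suc n)
    then obtain v where "eval f (n # l) (Suc v)" by (metis lessI gr0_conv_Suc)
    then have "Q (pe (list_encode l) n) (pe (list_encode l) (Suc n))" by (auto simp: Q_def)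
    with Suc show ?case by (meson less_SucI rtranclp.rtrancl_into_rtrancl)
  qed simp
  have bwd: "p1 s = list_encode l \<and> (\<forall>m<p2 s. \<exists>v. eval f (m # l) v \<and> 0 < v)"
    if "Q\<^sup>*\<^sup>* (pe (list_encode l) 0) s" for l s
    using that
    by (induction rule: rtranclp_induct) (auto simp: Q_def less_Suc_eq)
  have "eval (Mu f) (list_decode (p1 u)) (p2 u) \<longleftrightarrow>
      eval f (list_decode (Suc (pe (p2 u) (p1 u)))) 0 \<and> Q\<^sup>*\<^sup>* (pe (p1 u) 0) (pe (p1 u) (p2 u))" for u
    using fwd[of "p2 u" "list_decode (p1 u)"] bwd[of "list_decode (p1 u)" "pe (p1 u) (p2 u)"]
    by (auto elim!: evalE(7) intro: eval_Mu)
  moreover have "sig (\<lambda>u. eval f (list_decode (Suc (pe (p2 u) (p1 u)))) 0 \<and> Q\<^sup>*\<^sup>* (pe (p1 u) 0) (pe (p1 u) (p2 u)))"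
    by (intro sig_and sig_eval[OF f] sig_rtranclp[OF Q] U_Suc U_pe U_p1 U_p2 U_const U_id)
  ultimately show ?thesis by (simp add: sig_graph_def)
qed

lemma sig_graph: "sig_graph p"
proof (induction p)
  case Zero
  have "eval Zero xs v \<longleftrightarrow> v = 0" for xs v by (auto elim: evalE intro: eval_Zero)
  then show ?case unfolding sig_graph_def by (simp add: sig_eq[OF U_p2[OF U_id] U_const])
next
  case Succ
  have "eval Succ (list_decode l) v \<longleftrightarrow> l \<noteq> 0 \<and> v = Suc (hdc l)" for l v
    by (cases "l = 0") (auto simp: list_decode_nz elim: evalE intro: eval_Succ)
  then show ?case unfolding sig_graph_def
    by (simp only:) (intro sig_and sig_nz sig_eq U_Suc U_hdc U_p1 U_p2 U_id)
next
  case (Proj i)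
  have "eval (Proj i) xs v \<longleftrightarrow> drop i xs \<noteq> [] \<and> v = hd (drop i xs)" for xs v
    by (auto elim!: evalE simp: hd_drop_conv_nth not_le intro: eval_Proj)
  then have "eval (Proj i) (list_decode l) v \<longleftrightarrow> list_decode ((tlc ^^ i) l) \<noteq> [] \<and> v = hd (list_decode ((tlc ^^ i) l))" for l v
    by (simp only: list_decode_tlc_iter)
  moreover have "list_decode m \<noteq> [] \<and> v = hd (list_decode m) \<longleftrightarrow> m \<noteq> 0 \<and> v = hdc m" for m v
    by (cases "m = 0") (simp_all add: list_decode_nz)
  ultimately have "eval (Proj i) (list_decode l) v \<longleftrightarrow> (tlc ^^ i) l \<noteq> 0 \<and> v = hdc ((tlc ^^ i) l)" for l v
    by simp
  then show ?case unfolding sig_graph_def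
    by (simp only:) (intro sig_and sig_nz sig_eq U_iter U_hdc U_tlc U_const U_p1 U_p2 U_id)
next
  case (Comp f gs)
  let ?P = "\<lambda>u. list_all2 (\<lambda>g y. eval g (list_decode (p1 u)) y) gs (list_decode (p2 u))"
  have "eval (Comp f gs) xs z \<longleftrightarrow> (\<exists>y. list_all2 (\<lambda>g y. eval g xs y) gs (list_decode y) \<and> eval f (list_decode y) z)" for xs z
    by (auto elim!: evalE(4) intro: eval_Comp) (metis list_encode_inverse)
  then have "eval (Comp f gs) (list_decode (p1 u)) (p2 u) \<longleftrightarrow> (\<exists>y. ?P (pe (p1 u) y) \<and> eval f (list_decode y) (p2 u))" for u
    by simp
  moreover have "sig (\<lambda>u. \<exists>y. ?P (pe (p1 u) y) \<and> eval f (list_decode y) (p2 u))"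
  proof (rule sig_ex, rule sig_and)
    show "sig (\<lambda>u. ?P (pe (p1 (p1 u)) (p2 u)))"
      by (rule sig_comp[where g = "\<lambda>u. pe (p1 (p1 u)) (p2 u)", OF sig_eval_list[OF Comp(2)]])
         (intro U_pe U_p1 U_p2 U_id | simp)+
    show "sig (\<lambda>u. eval f (list_decode (p2 u)) (p2 (p1 u)))"
      by (intro sig_eval Comp(1) U_p1 U_p2 U_id)
  qed
  ultimately show ?case by (simp add: sig_graph_def)
qed (simp_all add: sig_graph_Prim sig_graph_Mu)

lemma r_e_sig: "r_e A \<Longrightarrow> sig (\<lambda>x. x \<in> A)"
proof -
  assume "r_e A"
  then obtain p where "\<forall>x. x \<in> A \<longleftrightarrow> (\<exists>v. eval p [x] v)" unfolding r_e_def by blast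
  then have "x \<in> A \<longleftrightarrow> (\<exists>v. eval p (list_decode (Suc (pe x 0))) v)" for x by simp
  moreover have "sig (\<lambda>x. \<exists>v. eval p (list_decode (Suc (pe x 0))) v)"
    by (intro sig_ex sig_eval[OF sig_graph] U_Suc U_pe U_p1 U_p2 U_const U_id)
  ultimately show ?thesis by presburger
qed

lemma Pi02_sig:
  assumes "Pi02 X"
  obtains f where "U f" "\<And>x. x \<in> X \<longleftrightarrow> (\<forall>y. \<exists>z. f (pe (pe x y) z) = 0)"
proof -
  from assms obtain p where "\<forall>x. x \<in> X \<longleftrightarrow> (\<forall>y. \<exists>z. eval p [x, y, z] 0)" unfolding Pi02_def by blast
  then have X: "x \<in> X \<longleftrightarrow> (\<forall>y. \<exists>z. eval p (list_decode (Suc (pe x (Suc (pe y (Suc (pe z 0))))))) 0)" for x by simp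
  have "sig (\<lambda>u. \<exists>z. eval p (list_decode (Suc (pe (p1 u) (Suc (pe (p2 u) (Suc (pe z 0))))))) 0)"
    by (intro sig_ex sig_eval[OF sig_graph] U_Suc U_pe U_p1 U_p2 U_const U_id)
  then obtain f where f: "U f" "\<And>u. (\<exists>z. eval p (list_decode (Suc (pe (p1 u) (Suc (pe (p2 u) (Suc (pe z 0))))))) 0) \<longleftrightarrow> (\<exists>z. f (pe u z) = 0)"
    by (rule sigE) blast
  have "x \<in> X \<longleftrightarrow> (\<forall>y. \<exists>z. f (pe (pe x y) z) = 0)" for x
    unfolding X using f(2)[of "pe x _"] by simp
  with f(1) show ?thesis by (rule that)
qed

text \<open>The universal variable also carries the witness for \<open>P\<close>, which leaves a
  primitive recursive matrix; being primitive recursive, it is total, as \<open>Pi02\<close>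
  demands.\<close>

lemma Pi02I:
  assumes P: "sig P" and Q: "sig Q" and X: "\<And>x. x \<in> X \<longleftrightarrow> (\<forall>y. P (pe x y) \<longrightarrow> Q (pe x y))"
  shows "Pi02 X"
proof (rule sigE[OF P], rule sigE[OF Q])
  fix f g assume f: "U f" "\<And>x. P x \<longleftrightarrow> (\<exists>z. f (pe x z) = 0)" and g: "U g" "\<And>x. Q x \<longleftrightarrow> (\<exists>z. g (pe x z) = 0)"
  define h where "h x y z = (1 - f (pe (pe x (p1 y)) (p2 y))) * g (pe (pe x (p1 y)) z)" for x y z
  have a: "pr 3 (\<lambda>xs. xs ! 0)" "pr 3 (\<lambda>xs. xs ! 1)" "pr 3 (\<lambda>xs. xs ! 2)" by (auto intro: pr_proj)
  have "pr 3 (\<lambda>xs. h (xs ! 0) (xs ! 1) (xs ! 2))"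
    unfolding h_def by (intro pr_mult pr_diff pr_const U_pr[OF f(1)] U_pr[OF g(1)] pr_pe pr_p1 pr_p2 a)
  then obtain p where "\<forall>xs. length xs = 3 \<longrightarrow> eval p xs (h (xs ! 0) (xs ! 1) (xs ! 2))"
    using pr_recf by blast
  then have p: "eval p [x, y, z] (h x y z)" for x y z by (auto dest: spec[of _ "[x, y, z]"])
  have "eval p [x, y, z] 0 \<longleftrightarrow> h x y z = 0" for x y z
    using p[of x y z] eval_deterministic by fastforce
  moreover have h_0: "h x y z = 0 \<longleftrightarrow> (f (pe (pe x (p1 y)) (p2 y)) = 0 \<longrightarrow> g (pe (pe x (p1 y)) z) = 0)" for x y z
    by (cases "f (pe (pe x (p1 y)) (p2 y))") (simp_all add: h_def)
  moreover have "x \<in> X \<longleftrightarrow> (\<forall>y. \<exists>z. h x y z = 0)" for x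
  proof -
    have "x \<in> X \<longleftrightarrow> (\<forall>y c. f (pe (pe x y) c) = 0 \<longrightarrow> (\<exists>z. g (pe (pe x y) z) = 0))"
      unfolding X f(2) g(2) by blast
    also have "\<dots> \<longleftrightarrow> (\<forall>y. f (pe (pe x (p1 y)) (p2 y)) = 0 \<longrightarrow> (\<exists>z. g (pe (pe x (p1 y)) z) = 0))"
      by (metis prod_encode_inverse fst_conv snd_conv)
    also have "\<dots> \<longleftrightarrow> (\<forall>y. \<exists>z. h x y z = 0)" by (simp add: h_0)
    finally show ?thesis .
  qed
  ultimately show ?thesis unfolding Pi02_def using p by metis
qed

section \<open>Loop programs\<close>

text \<open>\<open>Lp r c\<close> is the loop \<open>while r \<noteq> 0 do (r := r - 1; c)\<close>; \<open>Load r\<close> adds an external parameter.\<close>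

datatype com = Skip | Inc nat | Load nat | Sq com com | Lp nat com

primrec run :: "nat \<Rightarrow> com \<Rightarrow> (nat \<Rightarrow> nat) \<Rightarrow> nat \<Rightarrow> nat" where
  "run x Skip \<sigma> = \<sigma>"
| "run x (Inc r) \<sigma> = \<sigma>(r := Suc (\<sigma> r))"
| "run x (Load r) \<sigma> = \<sigma>(r := \<sigma> r + x)"
| "run x (Sq a b) \<sigma> = run x b (run x a \<sigma>)"
| "run x (Lp r c) \<sigma> = ((\<lambda>\<sigma>. run x c (\<sigma>(r := \<sigma> r - 1))) ^^ \<sigma> r) \<sigma>"

text \<open>\<open>run\<close> fixes the number of rounds on entry to a loop. This agrees with
  testing the register before each round, as the small steps do, because the body is required to
  leave that register unchanged.\<close>

primrec wfc :: "com \<Rightarrow> bool" where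
  "wfc Skip \<longleftrightarrow> True"
| "wfc (Inc r) \<longleftrightarrow> True"
| "wfc (Load r) \<longleftrightarrow> True"
| "wfc (Sq a b) \<longleftrightarrow> wfc a \<and> wfc b"
| "wfc (Lp r c) \<longleftrightarrow> (\<forall>x \<sigma>. run x c \<sigma> r = \<sigma> r) \<and> wfc c"

definition clear :: "nat \<Rightarrow> com" where "clear r = Lp r Skip"

lemma run_clear [simp]: "run x (clear r) \<sigma> = \<sigma>(r := 0)"
proof -
  have "((\<lambda>\<sigma>. \<sigma>(r := \<sigma> r - 1)) ^^ k) \<sigma> = \<sigma>(r := \<sigma> r - k)" for k
    by (induction k) (auto simp: fun_eq_iff)
  then show ?thesis by (simp add: clear_def)
qed

lemma wfc_clear [simp]: "wfc (clear r)"
  by (simp add: clear_def)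

definition copy :: "nat \<Rightarrow> nat \<Rightarrow> nat \<Rightarrow> com" where
  "copy a out b = Sq (clear out) (Sq (clear b) (Sq (Lp a (Inc b)) (Lp b (Sq (Inc a) (Inc out)))))"

lemma run_copy [simp]:
  assumes "a \<noteq> out" "a \<noteq> b" "out \<noteq> b"
  shows "run x (copy a out b) \<sigma> = \<sigma>(out := \<sigma> a, b := 0)"
proof -
  have 1: "((\<lambda>\<sigma>. run x (Inc b) (\<sigma>(a := \<sigma> a - 1))) ^^ k) \<sigma> = \<sigma>(a := \<sigma> a - k, b := \<sigma> b + k)" for k \<sigma>
    using assms by (induction k) (auto simp: fun_eq_iff)
  have 2: "((\<lambda>\<sigma>. run x (Sq (Inc a) (Inc out)) (\<sigma>(b := \<sigma> b - 1))) ^^ k) \<sigma> = \<sigma>(b := \<sigma> b - k, a := \<sigma> a + k, out := \<sigma> out + k)" for k \<sigma>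
    using assms by (induction k) (auto simp: fun_eq_iff)
  have L1: "run x (Lp a (Inc b)) \<sigma> = \<sigma>(a := 0, b := \<sigma> b + \<sigma> a)" for \<sigma>
    unfolding run.simps(5) 1 by simp
  have L2: "run x (Lp b (Sq (Inc a) (Inc out))) \<sigma> = \<sigma>(b := 0, a := \<sigma> a + \<sigma> b, out := \<sigma> out + \<sigma> b)" for \<sigma>
    unfolding run.simps(5) 2 by simp
  have "run x (copy a out b) \<sigma> = run x (Lp b (Sq (Inc a) (Inc out))) (run x (Lp a (Inc b)) (run x (clear b) (run x (clear out) \<sigma>)))"
    unfolding copy_def by (simp only: run.simps(4))
  then show ?thesis
    unfolding L1 L2 using assms by (auto simp: fun_eq_iff)
qed

lemma wfc_copy [simp]: "a \<noteq> out \<Longrightarrow> a \<noteq> b \<Longrightarrow> out \<noteq> b \<Longrightarrow> wfc (copy a out b)"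
  by (simp add: copy_def)

text \<open>Registers from \<open>b\<close> on are scratch space. Nothing is assumed about their
  initial contents, since the machine will be started in every store.\<close>

definition computes :: "nat \<Rightarrow> (nat list \<Rightarrow> nat) \<Rightarrow> bool" where
  "computes n f \<longleftrightarrow> (\<forall>ins out b. length ins = n \<longrightarrow> (\<forall>r\<in>set ins. r < b \<and> r \<noteq> out) \<longrightarrow> out < b \<longrightarrow>
     (\<exists>c. wfc c \<and> (\<forall>x \<sigma>. run x c \<sigma> out = f (map \<sigma> ins) \<and> (\<forall>r<b. r \<noteq> out \<longrightarrow> run x c \<sigma> r = \<sigma> r))))"

lemma computesI:
  assumes "\<And>ins out b. length ins = n \<Longrightarrow> \<forall>r\<in>set ins. r < b \<and> r \<noteq> out \<Longrightarrow> out < b \<Longrightarrow>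
     \<exists>c. wfc c \<and> (\<forall>x \<sigma>. run x c \<sigma> out = f (map \<sigma> ins) \<and> (\<forall>r<b. r \<noteq> out \<longrightarrow> run x c \<sigma> r = \<sigma> r))"
  shows "computes n f"
  unfolding computes_def by (intro allI impI) (rule assms)

lemma computesE:
  assumes "computes n f" "length ins = n" "\<forall>r\<in>set ins. r < b \<and> r \<noteq> out" "out < b"
  obtains c where "wfc c" "\<And>x \<sigma>. run x c \<sigma> out = f (map \<sigma> ins)" "\<And>x \<sigma> r. r < b \<Longrightarrow> r \<noteq> out \<Longrightarrow> run x c \<sigma> r = \<sigma> r"
proof -
  from assms(1)[unfolded computes_def, THEN spec, THEN spec, THEN spec, THEN mp, OF assms(2), THEN mp, OF assms(3), THEN mp, OF assms(4)]
  obtain c where "wfc c \<and> (\<forall>x \<sigma>. run x c \<sigma> out = f (map \<sigma> ins) \<and> (\<forall>r<b. r \<noteq> out \<longrightarrow> run x c \<sigma> r = \<sigma> r))" ..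
  then show ?thesis by (intro that[of c]) simp_all
qed

lemma computes_list:
  assumes "\<forall>g\<in>set gs. computes n g" "length ins = n" "\<forall>r\<in>set ins. r < j" "j + length gs \<le> b"
  shows "\<exists>c. wfc c \<and> (\<forall>x \<sigma>. (\<forall>i<length gs. run x c \<sigma> (j + i) = (gs ! i) (map \<sigma> ins)) \<and>
    (\<forall>r<b. r < j \<or> j + length gs \<le> r \<longrightarrow> run x c \<sigma> r = \<sigma> r))"
  using assms(1,3,4)
proof (induction gs arbitrary: j)
  case Nil
  show ?case by (intro exI[of _ Skip]) simp
next
  case (Cons g gs)
  have "computes n g" using Cons.prems(1) by simp
  then obtain c where c: "wfc c" "\<And>x \<sigma>. run x c \<sigma> j = g (map \<sigma> ins)" "\<And>x \<sigma> r. r < b \<Longrightarrow> r \<noteq> j \<Longrightarrow> run x c \<sigma> r = \<sigma> r"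
    by (rule computesE[where ins = ins and b = b and out = j]) (use Cons.prems assms(2) in auto)
  have "\<forall>g\<in>set gs. computes n g" "\<forall>r\<in>set ins. r < Suc j" "Suc j + length gs \<le> b"
    using Cons.prems by auto
  from Cons.IH[OF this] obtain d where d: "wfc d"
    "\<And>x \<sigma> i. i < length gs \<Longrightarrow> run x d \<sigma> (Suc j + i) = (gs ! i) (map \<sigma> ins)"
    "\<And>x \<sigma> r. r < b \<Longrightarrow> r < Suc j \<or> Suc j + length gs \<le> r \<Longrightarrow> run x d \<sigma> r = \<sigma> r" by blast
  have ins: "map (run x c \<sigma>) ins = map \<sigma> ins" for x \<sigma>
    using c(3) Cons.prems by fastforce
  show ?case
  proof (intro exI[of _ "Sq c d"] conjI allI impI)
    show "wfc (Sq c d)" using c d by simp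
    fix x \<sigma>
    show "run x (Sq c d) \<sigma> (j + i) = ((g # gs) ! i) (map \<sigma> ins)" if "i < length (g # gs)" for i
    proof (cases i)
      case 0
      then show ?thesis using d(3)[of j x "run x c \<sigma>"] c(2) Cons.prems(3) by simp
    next
      case (Suc k)
      then show ?thesis using d(2)[of k x "run x c \<sigma>"] that ins by simp
    qed
    show "run x (Sq c d) \<sigma> r = \<sigma> r" if "r < b" "r < j \<or> j + length (g # gs) \<le> r" for r
      using d(3)[of r x "run x c \<sigma>"] c(3)[of r x \<sigma>] that by auto
  qed
qed

lemma computes_pr: "pr n f \<Longrightarrow> computes n f"
proof (induction rule: pr.induct)
  case (pr_zero n)
  show ?case by (rule computesI, rule_tac x = "clear out" in exI) simp
next
  case (pr_succ n)
  show ?case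
  proof (rule computesI)
    fix ins :: "nat list" and out b assume *: "length ins = Suc n" "\<forall>r\<in>set ins. r < b \<and> r \<noteq> out" "out < b"
    then obtain r0 rest where "ins = r0 # rest" by (cases ins) auto
    with * show "\<exists>c. wfc c \<and> (\<forall>x \<sigma>. run x c \<sigma> out = Suc (hd (map \<sigma> ins)) \<and> (\<forall>r<b. r \<noteq> out \<longrightarrow> run x c \<sigma> r = \<sigma> r))"
      by (intro exI[of _ "Sq (copy r0 out b) (Inc out)"]) auto
  qed
next
  case (pr_proj i n)
  show ?case
  proof (rule computesI)
    fix ins :: "nat list" and out b assume *: "length ins = n" "\<forall>r\<in>set ins. r < b \<and> r \<noteq> out" "out < b"
    define a where "a = ins ! i"
    have a: "a < b" "a \<noteq> out" "\<And>\<sigma>. map \<sigma> ins ! i = \<sigma> a" using * pr_proj by (auto simp: a_def)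
    show "\<exists>c. wfc c \<and> (\<forall>x \<sigma>. run x c \<sigma> out = map \<sigma> ins ! i \<and> (\<forall>r<b. r \<noteq> out \<longrightarrow> run x c \<sigma> r = \<sigma> r))"
      unfolding a(3) by (intro exI[of _ "copy a out b"]) (use a(1,2) *(3) in auto)
  qed
next
  case (pr_comp gs f n)
  show ?case
  proof (rule computesI)
    fix ins :: "nat list" and out b assume *: "length ins = n" "\<forall>r\<in>set ins. r < b \<and> r \<noteq> out" "out < b"
    let ?k = "length gs"
    have "\<forall>g\<in>set gs. computes n g" using pr_comp by blast
    then obtain c where c: "wfc c" "\<And>x \<sigma> i. i < ?k \<Longrightarrow> run x c \<sigma> (b + i) = (gs ! i) (map \<sigma> ins)"
      "\<And>x \<sigma> r. r < b + ?k \<Longrightarrow> r < b \<or> b + ?k \<le> r \<Longrightarrow> run x c \<sigma> r = \<sigma> r"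
      using computes_list[of gs n ins b "b + ?k"] * by blast
    obtain d where d: "wfc d" "\<And>x \<sigma>. run x d \<sigma> out = f (map \<sigma> [b..<b + ?k])"
      "\<And>x \<sigma> r. r < b + ?k \<Longrightarrow> r \<noteq> out \<Longrightarrow> run x d \<sigma> r = \<sigma> r"
      by (rule computesE[OF pr_comp.IH(1), of "[b..<b + ?k]" "b + ?k" out]) (use * in auto)
    have "map (run x c \<sigma>) [b..<b + ?k] = map (\<lambda>g. g (map \<sigma> ins)) gs" for x \<sigma>
      by (rule nth_equalityI) (auto simp: c(2))
    then show "\<exists>c. wfc c \<and> (\<forall>x \<sigma>. run x c \<sigma> out = f (map (\<lambda>g. g (map \<sigma> ins)) gs) \<and> (\<forall>r<b. r \<noteq> out \<longrightarrow> run x c \<sigma> r = \<sigma> r))"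
      by (intro exI[of _ "Sq c d"]) (auto simp: c d)
  qed
next
  case (pr_prim n f g)
  show ?case
  proof (rule computesI)
    fix ins :: "nat list" and out b assume *: "length ins = Suc n" "\<forall>r\<in>set ins. r < b \<and> r \<noteq> out" "out < b"
    then obtain r0 rest where ins: "ins = r0 # rest" by (cases ins) auto
    have r0: "r0 < b" "r0 \<noteq> out" and rest: "\<And>r. r \<in> set rest \<Longrightarrow> r < b \<and> r \<noteq> out" using * ins by auto
    obtain c where c: "wfc c" "\<And>x \<sigma>. run x c \<sigma> out = f (map \<sigma> rest)" "\<And>x \<sigma> r. r < Suc (Suc (Suc b)) \<Longrightarrow> r \<noteq> out \<Longrightarrow> run x c \<sigma> r = \<sigma> r"
      by (rule computesE[OF pr_prim.IH(1), of rest "Suc (Suc (Suc b))" out]) (use * ins rest in fastforce)+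
    obtain d where d: "wfc d" "\<And>x \<sigma>. run x d \<sigma> (Suc (Suc b)) = g (map \<sigma> ((Suc b) # out # rest))"
      "\<And>x \<sigma> r. r < Suc (Suc (Suc b)) \<Longrightarrow> r \<noteq> Suc (Suc b) \<Longrightarrow> run x d \<sigma> r = \<sigma> r"
      by (rule computesE[OF pr_prim.IH(2), of "(Suc b) # out # rest" "Suc (Suc (Suc b))" "Suc (Suc b)"]) (use * ins rest in fastforce)+
    \<comment> \<open>Register \<open>b\<close> counts the remaining rounds, \<open>Suc b\<close>
      holds the stage, the next one receives the new value, and the one after that is scratch for
      \<open>copy\<close>.\<close>
    define body where "body = Sq d (Sq (copy (Suc (Suc b)) out (Suc (Suc (Suc b)))) (Inc (Suc b)))"
    define F where "F x \<sigma> = run x body (\<sigma>(b := \<sigma> b - 1))" for x \<sigma>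
    have body: "run x body \<sigma> = (run x d \<sigma>)(out := run x d \<sigma> (Suc (Suc b)), Suc (Suc (Suc b)) := 0, Suc b := Suc (run x d \<sigma> (Suc b)))" for x \<sigma>
      using *(3) by (simp add: body_def)
    have F: "F x \<sigma> out = g (\<sigma> (Suc b) # \<sigma> out # map \<sigma> rest)" "F x \<sigma> (Suc b) = Suc (\<sigma> (Suc b))"
      "r < b \<Longrightarrow> r \<noteq> out \<Longrightarrow> F x \<sigma> r = \<sigma> r" for x \<sigma> r
    proof -
      have m: "map (\<sigma>(b := \<sigma> b - Suc 0)) rest = map \<sigma> rest" using rest by fastforce
      show "F x \<sigma> out = g (\<sigma> (Suc b) # \<sigma> out # map \<sigma> rest)" using *(3) by (simp add: F_def body d(2) m)
      show "F x \<sigma> (Suc b) = Suc (\<sigma> (Suc b))" using *(3) d(3)[of "Suc b"] by (simp add: F_def body)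
      show "F x \<sigma> r = \<sigma> r" if "r < b" "r \<noteq> out" using that d(3)[of r] by (simp add: F_def body)
    qed
    let ?rec = "\<lambda>\<sigma>. rec_nat (f (map \<sigma> rest)) (\<lambda>i y. g (i # y # map \<sigma> rest))"
    have iter: "(F x ^^ i) \<sigma> out = rec_nat (\<sigma> out) (\<lambda>i y. g (i # y # map \<sigma> rest)) i \<and> (F x ^^ i) \<sigma> (Suc b) = i \<and>
        (\<forall>r<b. r \<noteq> out \<longrightarrow> (F x ^^ i) \<sigma> r = \<sigma> r)" if "\<sigma> (Suc b) = 0" for x \<sigma> i
    proof (induction i)
      case (Suc i)
      have m: "map ((F x ^^ i) \<sigma>) rest = map \<sigma> rest" using Suc rest by auto
      show ?case using Suc by (simp add: F m)
    qed (simp add: that)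
    let ?c = "Sq (copy r0 b (Suc (Suc (Suc b)))) (Sq c (Sq (clear (Suc b)) (Lp b body)))"
    have "run x ?c \<sigma> out = ?rec \<sigma> (\<sigma> r0) \<and> (\<forall>r<b. r \<noteq> out \<longrightarrow> run x ?c \<sigma> r = \<sigma> r)" for x \<sigma>
    proof -
      define \<sigma>0 where "\<sigma>0 = \<sigma>(b := \<sigma> r0, Suc (Suc (Suc b)) := 0)"
      define \<sigma>1 where "\<sigma>1 = (run x c \<sigma>0)(Suc b := 0)"
      have m0: "map \<sigma>0 rest = map \<sigma> rest" using rest by (fastforce simp: \<sigma>0_def)
      have "\<sigma>1 out = f (map \<sigma> rest)" using *(3) by (simp add: \<sigma>1_def c(2) m0)
      moreover have same: "\<sigma>1 r = \<sigma> r" if "r < b" "r \<noteq> out" for r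
        using that c(3)[of r] by (simp add: \<sigma>1_def \<sigma>0_def)
      moreover have m1: "map \<sigma>1 rest = map \<sigma> rest" using same rest by auto
      moreover have "\<sigma>1 b = \<sigma> r0" using *(3) c(3)[of b] by (simp add: \<sigma>1_def \<sigma>0_def)
      moreover have eq: "run x ?c \<sigma> = (F x ^^ \<sigma>1 b) \<sigma>1"
        using r0 by (simp add: \<sigma>1_def \<sigma>0_def F_def[abs_def])
      moreover have "\<sigma>1 (Suc b) = 0" by (simp add: \<sigma>1_def)
      ultimately show ?thesis using iter[where \<sigma> = \<sigma>1 and x = x and i = "\<sigma>1 b"]
        unfolding eq by (simp add: m1)
    qed
    moreover have "wfc ?c"
    proof -
      have "run x body \<sigma> b = \<sigma> b" for x \<sigma> using *(3) d(3)[of b] by (simp add: body)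
      moreover have "wfc body" using *(3) d(1) by (simp add: body_def)
      ultimately show ?thesis using r0 c(1) by simp
    qed
    ultimately show "\<exists>c. wfc c \<and> (\<forall>x \<sigma>. run x c \<sigma> out = rec_nat (f (tl (map \<sigma> ins))) (\<lambda>i y. g (i # y # tl (map \<sigma> ins))) (hd (map \<sigma> ins)) \<and>
        (\<forall>r<b. r \<noteq> out \<longrightarrow> run x c \<sigma> r = \<sigma> r))"
      by (intro exI[of _ ?c]) (simp add: ins)
  qed
next
  case (pr_ext n f g)
  then show ?case by (simp add: computes_def)
qed

section \<open>Small steps\<close>

type_synonym config = "com list option \<times> (nat \<Rightarrow> nat)"

text \<open>The program \<open>bd\<close> is repeated until register 3 contains 0; register 1 counts the rounds.\<close>

fun step :: "nat \<Rightarrow> com \<Rightarrow> config \<Rightarrow> config" where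
  "step x bd (None, \<sigma>) = (None, \<sigma>)"
| "step x bd (Some [], \<sigma>) = (if \<sigma> 3 = 0 then (None, \<sigma>) else (Some [bd], \<sigma>(1 := Suc (\<sigma> 1))))"
| "step x bd (Some (Skip # k), \<sigma>) = (Some k, \<sigma>)"
| "step x bd (Some (Inc r # k), \<sigma>) = (Some k, \<sigma>(r := Suc (\<sigma> r)))"
| "step x bd (Some (Load r # k), \<sigma>) = (Some k, \<sigma>(r := \<sigma> r + x))"
| "step x bd (Some (Sq a b # k), \<sigma>) = (Some (a # b # k), \<sigma>)"
| "step x bd (Some (Lp r c # k), \<sigma>) =
    (if \<sigma> r = 0 then (Some k, \<sigma>) else (Some (c # Lp r c # k), \<sigma>(r := \<sigma> r - 1)))"

definition leads :: "nat \<Rightarrow> com \<Rightarrow> config \<Rightarrow> config \<Rightarrow> bool" where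
  "leads x bd s s' \<longleftrightarrow> (\<exists>n. (step x bd ^^ n) s = s')"

definition halts :: "nat \<Rightarrow> com \<Rightarrow> config \<Rightarrow> bool" where
  "halts x bd s \<longleftrightarrow> (\<exists>n. fst ((step x bd ^^ n) s) = None)"

lemma leads_refl: "leads x bd s s"
  unfolding leads_def by (rule exI[of _ 0]) simp

lemma leads_trans: "leads x bd s s' \<Longrightarrow> leads x bd s' s'' \<Longrightarrow> leads x bd s s''"
  unfolding leads_def by (metis comp_apply funpow_add)

lemma leads_step: "leads x bd (step x bd s) s' \<Longrightarrow> leads x bd s s'"
  unfolding leads_def by (metis comp_apply funpow_Suc_right)

lemma step_None: "fst s = None \<Longrightarrow> (step x bd ^^ n) s = s"
  by (induction n) (cases s; simp)+

text \<open>Steps are deterministic and a halted configuration is a fixed point. The direction from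
  \<open>s\<close> to \<open>s'\<close> will allow the rules to be read backwards.\<close>

lemma halts_leads: assumes "leads x bd s s'" shows "halts x bd s \<longleftrightarrow> halts x bd s'"
proof
  from assms obtain m where m: "(step x bd ^^ m) s = s'" by (auto simp: leads_def)
  show "halts x bd s" if "halts x bd s'"
    using that m unfolding halts_def by (metis comp_apply funpow_add)
  assume "halts x bd s"
  then obtain n where n: "fst ((step x bd ^^ n) s) = None" by (auto simp: halts_def)
  have "(step x bd ^^ n) s' = (step x bd ^^ m) ((step x bd ^^ n) s)"
    by (simp flip: m comp_apply[of "_ ^^ _" "_ ^^ _" s] funpow_add add: add.commute)
  also have "\<dots> = (step x bd ^^ n) s" using step_None[OF n] by simp
  finally show "halts x bd s'" using n unfolding halts_def by metis
qed

lemma halts_step: "halts x bd (step x bd s) \<longleftrightarrow> halts x bd s"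
  using halts_leads[OF leads_step[OF leads_refl]] by blast

lemma leads_run: "wfc c \<Longrightarrow> leads x bd (Some (c # k), \<sigma>) (Some k, run x c \<sigma>)"
proof (induction c arbitrary: k \<sigma>)
  case (Sq a b)
  have "leads x bd (Some (a # b # k), \<sigma>) (Some k, run x (Sq a b) \<sigma>)"
    using leads_trans[OF Sq.IH(1) Sq.IH(2)] Sq.prems by simp
  then show ?case using leads_step[of x bd "(Some (Sq a b # k), \<sigma>)"] by simp
next
  case (Lp r c)
  have pres: "run x c \<sigma> r = \<sigma> r" for \<sigma> using Lp.prems by simp
  have "leads x bd (Some (Lp r c # k), \<sigma>) (Some k, ((\<lambda>\<sigma>. run x c (\<sigma>(r := \<sigma> r - 1))) ^^ n) \<sigma>)" if "\<sigma> r = n" for n \<sigma>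
    using that
  proof (induction n arbitrary: \<sigma>)
    case 0
    then show ?case using leads_step[of x bd "(Some (Lp r c # k), \<sigma>)", OF leads_refl] by simp
  next
    case (Suc n)
    let ?s = "\<sigma>(r := \<sigma> r - 1)"
    have "leads x bd (Some (c # Lp r c # k), ?s) (Some (Lp r c # k), run x c ?s)"
      using Lp.IH Lp.prems by simp
    moreover have "run x c ?s r = n" using pres Suc.prems by simp
    ultimately have "leads x bd (Some (c # Lp r c # k), ?s) (Some k, ((\<lambda>\<sigma>. run x c (\<sigma>(r := \<sigma> r - 1))) ^^ n) (run x c ?s))"
      using Suc.IH leads_trans by blast
    then show ?case using leads_step[of x bd "(Some (Lp r c # k), \<sigma>)"] Suc.prems
      by (simp only: funpow_Suc_right comp_apply) (simp add: Suc.prems)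
  qed
  then show ?case by simp
qed (rule leads_step, simp add: leads_refl)+

lemma leads_all: "\<forall>c\<in>set k. wfc c \<Longrightarrow> \<exists>\<sigma>'. leads x bd (Some k, \<sigma>) (Some [], \<sigma>')"
proof (induction k arbitrary: \<sigma>)
  case Nil
  show ?case using leads_refl by blast
next
  case (Cons c k)
  then show ?case using leads_run[of c x bd k \<sigma>] leads_trans by (metis list.set_intros)
qed

text \<open>The stacks that can occur while \<open>c\<close> runs on top of \<open>k\<close>. They
  are finitely many and become the control states of the machine.\<close>

primrec conts :: "com \<Rightarrow> com list \<Rightarrow> com list set" where
  "conts Skip k = {Skip # k}"
| "conts (Inc r) k = {Inc r # k}"
| "conts (Load r) k = {Load r # k}"
| "conts (Sq a b) k = {Sq a b # k} \<union> conts a (b # k) \<union> conts b k"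
| "conts (Lp r c) k = {Lp r c # k} \<union> conts c (Lp r c # k)"

lemma conts_self: "c # k \<in> conts c k"
  by (cases c) auto

lemma finite_conts: "finite (conts c k)"
  by (induction c arbitrary: k) auto

lemma conts_wfc: "wfc c \<Longrightarrow> \<forall>d\<in>set k. wfc d \<Longrightarrow> l \<in> conts c k \<Longrightarrow> \<forall>d\<in>set l. wfc d"
proof (induction c arbitrary: k)
  case (Sq a b)
  have w: "\<forall>d\<in>set (b # k). wfc d" "\<forall>d\<in>set (Sq a b # k). wfc d" using Sq.prems by simp_all
  from Sq.prems(3) consider "l = Sq a b # k" | "l \<in> conts a (b # k)" | "l \<in> conts b k" by auto
  then show ?case
  proof cases
    case 1
    then show ?thesis using w(2) by blast
  next
    case 2
    then show ?thesis using Sq.IH(1)[OF _ w(1)] Sq.prems(1) by simp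
  next
    case 3
    then show ?thesis using Sq.IH(2)[OF _ Sq.prems(2)] Sq.prems(1) by simp
  qed
next
  case (Lp r c)
  have w: "\<forall>d\<in>set (Lp r c # k). wfc d" using Lp.prems(1,2) unfolding list.set ball_simps by blast
  from Lp.prems(3) consider "l = Lp r c # k" | "l \<in> conts c (Lp r c # k)" by auto
  then show ?case
  proof cases
    case 1
    then show ?thesis using w by blast
  next
    case 2
    then show ?thesis using Lp.IH[OF _ w] Lp.prems(1) unfolding wfc.simps by blast
  qed
qed simp_all

lemma conts_step:
  "l \<in> conts c k \<Longrightarrow> \<exists>l'. fst (step x bd (Some l, \<sigma>)) = Some l' \<and> (l' \<in> conts c k \<or> l' = k)"
proof (induction c arbitrary: k)
  case (Sq a b)
  then consider "l = Sq a b # k" | "l \<in> conts a (b # k)" | "l \<in> conts b k" by auto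
  then show ?case
  proof cases
    case 1
    then show ?thesis using conts_self[of a "b # k"] by simp
  next
    case 2
    from Sq.IH(1)[OF this] show ?thesis using conts_self[of b k] by auto
  next
    case 3
    from Sq.IH(2)[OF this] show ?thesis by auto
  qed
next
  case (Lp r c)
  then consider "l = Lp r c # k" | "l \<in> conts c (Lp r c # k)" by auto
  then show ?case
  proof cases
    case 1
    then show ?thesis using conts_self[of c "Lp r c # k"] by simp
  next
    case 2
    from Lp.IH[OF this] show ?thesis by auto
  qed
qed auto

text \<open>The parameter is reloaded in every round, since register 2 may contain anything at the
  start.\<close>

definition loop_body :: "com \<Rightarrow> com" where
  "loop_body c = Sq (clear 2) (Sq (Load 2) c)"

text \<open>From any store the current stack is exhausted first, and then register 3 may still hold
  a stale value. If it does not stop the search, one round makes it correct for the current z, and z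
  grows by 1 per round. As z may start beyond all small zeros, \<open>inf\<close> provides a later
  one.\<close>

lemma halts_iff:
  assumes c: "wfc c" "\<And>x \<sigma>. run x c \<sigma> 3 = f [\<sigma> 2, \<sigma> 0, \<sigma> 1]" "\<And>x \<sigma> r. r < 4 \<Longrightarrow> r \<noteq> 3 \<Longrightarrow> run x c \<sigma> r = \<sigma> r"
    and inf: "\<And>x y z z'. f [x, y, z] = 0 \<Longrightarrow> \<exists>z\<ge>z'. f [x, y, z] = 0"
  shows "(\<forall>y. \<exists>z. f [x, y, z] = 0) \<longleftrightarrow>
    (\<forall>k \<sigma>. (\<forall>d\<in>set k. wfc d) \<longrightarrow> halts x (loop_body c) (Some k, \<sigma>))" (is "?A \<longleftrightarrow> ?B")
    and "\<lbrakk>\<forall>z. f [x, y, z] \<noteq> 0; \<sigma> 0 = y; \<sigma> 3 \<noteq> 0\<rbrakk> \<Longrightarrow> \<not> halts x (loop_body c) (Some [], \<sigma>)"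
proof -
  let ?bd = "loop_body c"
  have wf: "wfc ?bd" using c(1) by (simp add: loop_body_def)
  have run: "run x ?bd \<sigma> 0 = \<sigma> 0" "run x ?bd \<sigma> 1 = \<sigma> 1" "run x ?bd \<sigma> 3 = f [x, \<sigma> 0, \<sigma> 1]" for x \<sigma>
    by (simp_all add: loop_body_def c(2,3))
  have round: "\<exists>\<sigma>' n. (step x ?bd ^^ Suc n) (Some [], \<sigma>) = (Some [], \<sigma>') \<and> \<sigma>' 0 = \<sigma> 0 \<and> \<sigma>' 1 = Suc (\<sigma> 1) \<and> \<sigma>' 3 = f [x, \<sigma> 0, Suc (\<sigma> 1)]"
    if "\<sigma> 3 \<noteq> 0" for x \<sigma>
  proof -
    let ?s = "\<sigma>(1 := Suc (\<sigma> 1))"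
    obtain n where n: "(step x ?bd ^^ n) (Some [?bd], ?s) = (Some [], run x ?bd ?s)"
      using leads_run[OF wf, of x ?bd "[]" ?s] by (auto simp: leads_def)
    then have "(step x ?bd ^^ Suc n) (Some [], \<sigma>) = (Some [], run x ?bd ?s)"
      using that by (simp only: funpow_Suc_right comp_apply) simp
    then show ?thesis using run[of x ?s] by auto
  qed
  show 2: "\<not> halts x ?bd (Some [], \<sigma>)" if "\<forall>z. f [x, y, z] \<noteq> 0" "\<sigma> 0 = y" "\<sigma> 3 \<noteq> 0" for x y \<sigma>
  proof -
    have "fst ((step x ?bd ^^ n) (Some [], \<sigma>)) \<noteq> None" if "\<sigma> 0 = y" "\<sigma> 3 \<noteq> 0" for n \<sigma>
      using that
    proof (induction n arbitrary: \<sigma> rule: less_induct)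
      case (less n)
      obtain \<sigma>' m where m: "(step x ?bd ^^ Suc m) (Some [], \<sigma>) = (Some [], \<sigma>')" "\<sigma>' 0 = \<sigma> 0" "\<sigma>' 3 = f [x, \<sigma> 0, Suc (\<sigma> 1)]"
        using round[where \<sigma> = \<sigma> and x = x, OF less.prems(2)] by blast
      have \<sigma>': "\<sigma>' 0 = y" "\<sigma>' 3 \<noteq> 0" using m less.prems \<open>\<forall>z. f [x, y, z] \<noteq> 0\<close> by auto
      show ?case
      proof (cases "Suc m \<le> n")
        case True
        then have "(step x ?bd ^^ n) (Some [], \<sigma>) = (step x ?bd ^^ (n - Suc m)) (Some [], \<sigma>')"
          using funpow_add[of "n - Suc m" "Suc m" "step x ?bd"] m(1) by simp
        then show ?thesis using less.IH[of "n - Suc m" \<sigma>'] True \<sigma>' by simp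
      next
        case False
        show ?thesis
        proof
          assume N: "fst ((step x ?bd ^^ n) (Some [], \<sigma>)) = None"
          have "(step x ?bd ^^ Suc m) (Some [], \<sigma>) = (step x ?bd ^^ (Suc m - n)) ((step x ?bd ^^ n) (Some [], \<sigma>))"
            using False funpow_add[of "Suc m - n" n "step x ?bd"] by simp
          then show False using step_None[OF N] m(1) N by simp
        qed
      qed
    qed
    then show ?thesis using that(2,3) by (simp add: halts_def)
  qed
  show "?A \<longleftrightarrow> ?B"
  proof
    assume ?B
    show ?A
    proof (rule ccontr)
      assume "\<not> ?A"
      then obtain y where "\<forall>z. f [x, y, z] \<noteq> 0" by metis
      from 2[OF this, of "\<lambda>r. if r = 0 then y else 1"] \<open>?B\<close> show False by auto
    qed
  next
    assume ?A
    have hb: "halts x ?bd (Some [], \<sigma>)" if "f [x, \<sigma> 0, \<sigma> 1 + d] = 0" "\<sigma> 3 = f [x, \<sigma> 0, \<sigma> 1]" for d \<sigma>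
      using that
    proof (induction d arbitrary: \<sigma>)
      case 0
      then have "halts x ?bd (step x ?bd (Some [], \<sigma>))" by (auto simp: halts_def intro: exI[of _ 0])
      then show ?case by (simp only: halts_step)
    next
      case (Suc d)
      show ?case
      proof (cases "\<sigma> 3 = 0")
        case True
        then have "halts x ?bd (step x ?bd (Some [], \<sigma>))" by (auto simp: halts_def intro: exI[of _ 0])
        then show ?thesis by (simp only: halts_step)
      next
        case False
        from round[where \<sigma> = \<sigma> and x = x, OF this] obtain \<sigma>' where
          "leads x ?bd (Some [], \<sigma>) (Some [], \<sigma>')" "\<sigma>' 0 = \<sigma> 0" "\<sigma>' 1 = Suc (\<sigma> 1)" "\<sigma>' 3 = f [x, \<sigma> 0, Suc (\<sigma> 1)]"
          unfolding leads_def by blast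
        then show ?thesis using Suc.IH[of \<sigma>'] Suc.prems halts_leads by simp
      qed
    qed
    have ha: "halts x ?bd (Some [], \<sigma>)" for \<sigma>
    proof (cases "\<sigma> 3 = 0")
      case True
      then have "halts x ?bd (step x ?bd (Some [], \<sigma>))" by (auto simp: halts_def intro: exI[of _ 0])
      then show ?thesis by (simp only: halts_step)
    next
      case False
      from round[where \<sigma> = \<sigma> and x = x, OF this] obtain \<sigma>' where s':
        "leads x ?bd (Some [], \<sigma>) (Some [], \<sigma>')" "\<sigma>' 0 = \<sigma> 0" "\<sigma>' 1 = Suc (\<sigma> 1)" "\<sigma>' 3 = f [x, \<sigma> 0, Suc (\<sigma> 1)]"
        unfolding leads_def by blast
      obtain z where "z \<ge> \<sigma>' 1" "f [x, \<sigma>' 0, z] = 0" using \<open>?A\<close> inf by blast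
      then have "f [x, \<sigma>' 0, \<sigma>' 1 + (z - \<sigma>' 1)] = 0" by simp
      from hb[OF this] s' show ?thesis using halts_leads by simp
    qed
    show ?B
    proof (intro allI impI)
      fix k \<sigma> assume "\<forall>d\<in>set k. wfc d"
      then obtain \<sigma>' where "leads x ?bd (Some k, \<sigma>) (Some [], \<sigma>')" using leads_all by blast
      then show "halts x ?bd (Some k, \<sigma>)" using ha halts_leads by blast
    qed
  qed
qed

section \<open>Loop programs as systems of affine rules\<close>

definition pn :: "nat \<Rightarrow> nat" where "pn = enumerate {p. prime p}"

lemma prime_pn: "prime (pn r)"
  using enumerate_in_set[OF primes_infinite] by (simp add: pn_def)

lemma pn_eq_iff: "pn a = pn b \<longleftrightarrow> a = b"
  using strict_mono_eq[OF strict_mono_enumerate[OF primes_infinite]] by (simp add: pn_def)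

text \<open>The store coded by a nonzero integer.\<close>

definition sg :: "int \<Rightarrow> nat \<Rightarrow> nat" where "sg q r = multiplicity (int (pn r)) q"

lemma sg_mult:
  assumes "q \<noteq> 0" shows "sg (int (pn r) * q) = (sg q)(r := Suc (sg q r))"
proof
  fix r'
  have p: "prime (int (pn r'))" "prime (int (pn r))" using prime_pn by simp_all
  have "sg (int (pn r) * q) r' = multiplicity (int (pn r')) (int (pn r)) + sg q r'"
    unfolding sg_def using p assms by (intro prime_elem_multiplicity_mult_distrib) auto
  moreover have "multiplicity (int (pn r')) (int (pn r)) = of_bool (r = r')"
    using p pn_eq_iff[of r r'] by (auto simp: prime_multiplicity_other)
  ultimately show "sg (int (pn r) * q) r' = ((sg q)(r := Suc (sg q r))) r'" by auto
qed

lemma sg_power: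
  assumes "q \<noteq> 0" shows "sg (int (pn r) ^ x * q) = (sg q)(r := sg q r + x)"
proof (induction x)
  case (Suc x)
  have "int (pn r) ^ x * q \<noteq> 0" using assms prime_pn[of r] by auto
  from sg_mult[OF this, of r] Suc show ?case by (simp add: mult.assoc fun_eq_iff)
qed simp

lemma sg_0_iff: "q \<noteq> 0 \<Longrightarrow> sg q r = 0 \<longleftrightarrow> \<not> int (pn r) dvd q"
  unfolding sg_def using prime_pn[of r] by (intro multiplicity_eq_zero_iff) (auto simp: prime_gt_0_nat)

text \<open>The third component is a function of the input: \<open>Load\<close> multiplies by
  \<open>pn r ^ x\<close>, and this is the only place where the input enters the rules.\<close>

type_synonym prule = "nat \<times> nat \<times> (nat \<Rightarrow> nat) \<times> nat"

definition inst :: "nat \<Rightarrow> prule list \<Rightarrow> rule list" where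
  "inst x = map (\<lambda>(m, j, a, b). (m, j, a x, b))"

locale machine =
  fixes bd :: com
  assumes wf: "wfc bd"
begin

definition Q where "Q = insert None (Some ` insert [] (conts bd []))"
definition S where "S = card Q"
definition idx where "idx = (SOME h. bij_betw h Q {0..<card Q})"

lemma finite_Q: "finite Q"
  by (simp add: Q_def finite_conts)

lemma idx: "bij_betw idx Q {0..<S}"
  unfolding idx_def S_def using someI_ex[OF ex_bij_betw_finite_nat[OF finite_Q]] .

lemma S_pos: "0 < S"
  using finite_Q by (auto simp: S_def card_gt_0_iff Q_def)

lemma idx_less: "s \<in> Q \<Longrightarrow> idx s < S"
  using idx by (auto simp: bij_betw_def)

text \<open>The remainder modulo \<open>S\<close> is the control state and the quotient the store.
  The sign of the quotient is irrelevant to multiplicities, so negative integers are configurations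
  as well.\<close>

definition cfg :: "int \<Rightarrow> config" where
  "cfg i = (the_inv_into Q idx (nat (i mod int S)), sg (i div int S))"

lemma code:
  assumes "s \<in> Q"
  shows "(int S * q + int (idx s)) div int S = q" "cfg (int S * q + int (idx s)) = (s, sg q)"
proof -
  have "int (idx s) < int S" using idx_less[OF assms] by simp
  then show "(int S * q + int (idx s)) div int S = q" by simp
  moreover have "(int S * q + int (idx s)) mod int S = int (idx s)"
    using \<open>int (idx s) < int S\<close> by simp
  ultimately show "cfg (int S * q + int (idx s)) = (s, sg q)"
    using the_inv_into_f_f[of idx Q s] idx assms by (simp add: cfg_def bij_betw_def)
qed

lemma decode: "\<exists>s\<in>Q. i = int S * (i div int S) + int (idx s)"
proof -
  have "nat (i mod int S) \<in> {0..<S}" using S_pos by (simp add: nat_less_iff)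
  then obtain s where "s \<in> Q" "idx s = nat (i mod int S)"
    using idx unfolding bij_betw_def by (metis imageE)
  then show ?thesis using S_pos by (intro bexI[of _ s]) simp_all
qed

text \<open>The residue of the store modulo the prime of the tested register decides the branch.
  Residue 0 means a positive register, and the prime is divided out and replaced by the factor
  \<open>c\<close>; each other residue has its own rule, which leaves the store unchanged.\<close>

definition test_rules :: "nat \<Rightarrow> com list option \<Rightarrow> com list option \<Rightarrow> com list option \<Rightarrow> nat \<Rightarrow> prule list" where
  "test_rules r s s1 s0 c = (S * pn r, idx s, \<lambda>_. S * c, idx s1) #
     map (\<lambda>\<rho>. (S * pn r, S * \<rho> + idx s, \<lambda>_. S * pn r, S * \<rho> + idx s0)) [1..<pn r]"

text \<open>The rule for \<open>None\<close> links the halting codes with quotients q and q + 1, so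
  one base point accounts for all of them. For the empty stack, the factor
  \<open>pn 1 * pn 3\<close> restores the tested register 3 and increments register 1.\<close>

fun srules :: "com list option \<Rightarrow> prule list" where
  "srules None = [(S, idx None, \<lambda>_. S, idx None + S)]"
| "srules (Some []) = test_rules 3 (Some []) (Some [bd]) None (pn 1 * pn 3)"
| "srules (Some (Skip # k)) = [(S, idx (Some (Skip # k)), \<lambda>_. S, idx (Some k))]"
| "srules (Some (Inc r # k)) = [(S, idx (Some (Inc r # k)), \<lambda>_. S * pn r, idx (Some k))]"
| "srules (Some (Load r # k)) = [(S, idx (Some (Load r # k)), \<lambda>x. S * pn r ^ x, idx (Some k))]"
| "srules (Some (Sq a b # k)) = [(S, idx (Some (Sq a b # k)), \<lambda>_. S, idx (Some (a # b # k)))]"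
| "srules (Some (Lp r c # k)) = test_rules r (Some (Lp r c # k)) (Some (c # Lp r c # k)) (Some k) 1"

lemma step_Q: "s \<in> Q \<Longrightarrow> fst (step x bd (s, \<sigma>)) \<in> Q"
proof -
  assume s: "s \<in> Q"
  then consider "s = None" | "s = Some []" | l where "s = Some l" "l \<in> conts bd []" by (auto simp: Q_def)
  then show ?thesis
  proof cases
    case 3
    from conts_step[OF 3(2), of x bd \<sigma>] show ?thesis by (auto simp: Q_def 3(1))
  qed (auto simp: Q_def conts_self)
qed

text \<open>Quotient 0 codes no store, yet the rules apply to it; they only have to keep it separate
  from the other quotients.\<close>

definition sem :: "nat \<Rightarrow> com list option \<Rightarrow> nat \<times> nat \<times> (nat \<Rightarrow> nat) \<times> nat \<Rightarrow> bool" where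
  "sem x s = (\<lambda>(m, j, a, b). \<forall>z. \<exists>q q' s'. int m * z + int j = int S * q + int (idx s) \<and>
     int (a x) * z + int b = int S * q' + int (idx s') \<and> s' \<in> Q \<and> (q = 0 \<longleftrightarrow> q' = 0) \<and>
     (q \<noteq> 0 \<longrightarrow> step x bd (s, sg q) = (s', sg q')))"

lemma semI:
  assumes "\<And>z. int m * z + int j = int S * q z + int (idx s)" "\<And>z. int (a x) * z + int b = int S * q' z + int (idx s')"
    "s' \<in> Q" "\<And>z. q z = 0 \<longleftrightarrow> q' z = 0" "\<And>z. q z \<noteq> 0 \<Longrightarrow> step x bd (s, sg (q z)) = (s', sg (q' z))"
  shows "sem x s (m, j, a, b)"
  using assms unfolding sem_def by blast

lemma test_sem:
  assumes r: "rule \<in> set (test_rules r s s1 s0 c)" and s: "s1 \<in> Q" "s0 \<in> Q" and c: "c \<noteq> 0"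
    and nz: "\<And>q. q \<noteq> 0 \<Longrightarrow> step x bd (s, sg (int (pn r) * q)) = (s1, sg (int c * q))"
    and z: "\<And>q. q \<noteq> 0 \<Longrightarrow> sg q r = 0 \<Longrightarrow> step x bd (s, sg q) = (s0, sg q)"
  shows "sem x s rule"
proof -
  have p: "0 < pn r" using prime_pn prime_gt_0_nat by blast
  consider "rule = (S * pn r, idx s, \<lambda>_. S * c, idx s1)"
    | \<rho> where "rule = (S * pn r, S * \<rho> + idx s, \<lambda>_. S * pn r, S * \<rho> + idx s0)" "1 \<le> \<rho>" "\<rho> < pn r"
    using r unfolding test_rules_def list.set set_map set_upt by (elim insertE imageE) (blast, metis atLeastLessThan_iff)
  then show ?thesis
  proof cases
    case 1
    show ?thesis
      unfolding 1 by (rule semI[where q = "\<lambda>z. int (pn r) * z" and q' = "\<lambda>z. int c * z" and s' = s1])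
        (use p c s nz in \<open>auto simp: algebra_simps\<close>)
  next
    case 2
    have nd: "\<not> int (pn r) dvd int (pn r) * z + int \<rho>" for z
    proof -
      have "\<not> int (pn r) dvd int \<rho>" using 2(2,3) by (metis int_dvd_int_iff nat_dvd_not_less not_one_le_zero of_nat_dvd_iff zero_less_iff_neq_zero)
      then show ?thesis by (simp add: dvd_add_right_iff)
    qed
    then have nz': "int (pn r) * z + int \<rho> \<noteq> 0" for z by (metis dvd_0_right)
    show ?thesis
      unfolding 2 by (rule semI[where q = "\<lambda>z. int (pn r) * z + int \<rho>" and q' = "\<lambda>z. int (pn r) * z + int \<rho>" and s' = s0])
        (use s z nd nz' sg_0_iff in \<open>auto simp: algebra_simps\<close>)
  qed
qed

lemma srules_sem:
  assumes s: "s \<in> Q" "s \<noteq> None" and r: "rule \<in> set (srules s)"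
  shows "sem x s rule"
proof -
  have Q: "s' \<in> Q" if "step x bd (s, \<sigma>) = (s', \<sigma>')" for \<sigma> s' \<sigma>'
    using step_Q[OF s(1), of x \<sigma>] that by simp
  have p: "pn r \<noteq> 0" for r using prime_pn[of r] by auto
  obtain l where l: "s = Some l" using s(2) by blast
  show ?thesis
  proof (cases l)
    case Nil
    have q: "Some [bd] \<in> Q" "None \<in> Q"
      using Q[of "\<lambda>_. 1"] Q[of "\<lambda>_. 0"] by (auto simp: l Nil)
    show ?thesis
    proof (rule test_sem[of rule 3 s "Some [bd]" None "pn 1 * pn 3" x])
      show "step x bd (s, sg (int (pn 3) * q)) = (Some [bd], sg (int (pn 1 * pn 3) * q))" if "q \<noteq> 0" for q
        using that p[of 3] sg_mult[of q 3] sg_mult[of "int (pn 3) * q" 1] by (simp add: l Nil mult.assoc)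
    qed (use r q p in \<open>auto simp: l Nil\<close>)
  next
    case (Cons d k)
    show ?thesis
    proof (cases d)
      case Skip
      have "Some k \<in> Q" by (rule Q[of undefined]) (simp add: l Cons Skip)
      then show ?thesis using r unfolding l Cons Skip
        by (auto intro!: semI[where q = "\<lambda>z. z" and q' = "\<lambda>z. z" and s' = "Some k"])
    next
      case (Inc r')
      have "Some k \<in> Q" by (rule Q[of undefined]) (simp add: l Cons Inc)
      then show ?thesis using r p[of r'] unfolding l Cons Inc
        by (auto intro!: semI[where q = "\<lambda>z. z" and q' = "\<lambda>z. int (pn r') * z" and s' = "Some k"] simp: sg_mult)
    next
      case (Load r')
      have "Some k \<in> Q" by (rule Q[of undefined]) (simp add: l Cons Load)
      then show ?thesis using r p[of r'] unfolding l Cons Load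
        by (auto intro!: semI[where q = "\<lambda>z. z" and q' = "\<lambda>z. int (pn r') ^ x * z" and s' = "Some k"] simp: sg_power)
    next
      case (Sq a b)
      have "Some (a # b # k) \<in> Q" by (rule Q[of undefined]) (simp add: l Cons Sq)
      then show ?thesis using r unfolding l Cons Sq
        by (auto intro!: semI[where q = "\<lambda>z. z" and q' = "\<lambda>z. z" and s' = "Some (a # b # k)"])
    next
      case (Lp r' c)
      have q: "Some (c # Lp r' c # k) \<in> Q" "Some k \<in> Q"
        using Q[of "\<lambda>_. 1"] Q[of "\<lambda>_. 0"] by (auto simp: l Cons Lp)
      show ?thesis
        by (rule test_sem[of rule r' s "Some (c # Lp r' c # k)" "Some k" 1 x])
           (use r q in \<open>auto simp: l Cons Lp sg_mult\<close>)
    qed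
  qed
qed

lemma test_cover: "\<exists>m j a b z. (m, j, a, b) \<in> set (test_rules r s s1 s0 c) \<and> int S * q + int (idx s) = int m * z + int j"
proof -
  have p: "0 < pn r" using prime_pn prime_gt_0_nat by blast
  define \<rho> where "\<rho> = nat (q mod int (pn r))"
  have \<rho>: "\<rho> < pn r" "int \<rho> = q mod int (pn r)" using p by (simp_all add: \<rho>_def nat_less_iff)
  have q: "q = int (pn r) * (q div int (pn r)) + int \<rho>" by (simp add: \<rho>(2))
  have eq: "int S * q + int (idx s) = int (S * pn r) * (q div int (pn r)) + int (S * \<rho> + idx s)"
    by (subst q) (simp add: algebra_simps)
  show ?thesis
  proof (cases "\<rho> = 0")
    case True
    then have "int S * q + int (idx s) = int (S * pn r) * (q div int (pn r)) + int (idx s)" using eq by simp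
    moreover have "(S * pn r, idx s, \<lambda>_. S * c, idx s1) \<in> set (test_rules r s s1 s0 c)"
      by (simp add: test_rules_def)
    ultimately show ?thesis by blast
  next
    case False
    then have "(S * pn r, S * \<rho> + idx s, \<lambda>_. S * pn r, S * \<rho> + idx s0) \<in> set (test_rules r s s1 s0 c)"
      using \<rho>(1) by (auto simp: test_rules_def)
    then show ?thesis using eq by blast
  qed
qed

lemma srules_cover:
  assumes "s \<in> Q"
  shows "\<exists>m j a b z. (m, j, a, b) \<in> set (srules s) \<and> int S * q + int (idx s) = int m * z + int j"
  using test_cover by (cases s rule: srules.cases) auto

definition all_rules :: "prule list" where
  "all_rules = concat (map srules (SOME l. set l = Q))"

lemma set_all_rules: "set all_rules = (\<Union>s\<in>Q. set (srules s))"
proof -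
  have "set (SOME l. set l = Q) = Q" using finite_list[OF finite_Q] by (rule someI_ex)
  then show ?thesis by (simp add: all_rules_def)
qed

lemma srules_pos: "(m, j, a, b) \<in> set (srules s) \<Longrightarrow> 0 < m \<and> 0 < a x"
  using S_pos prime_pn prime_gt_0_nat
  by (cases s rule: srules.cases) (auto simp: test_rules_def)

lemma srules_U: "(m, j, a, b) \<in> set (srules s) \<Longrightarrow> U a"
proof -
  have "rec_nat 1 (\<lambda>i y. y * c) x = c ^ x" for c x :: nat by (induction x) auto
  moreover have "pr (Suc (Suc 1)) (\<lambda>zs. zs ! 1 * c)" for c by (intro pr_mult pr_snd_arg pr_const)
  ultimately have pow: "U (\<lambda>x. c ^ x)" for c
    using pr_rec[of 1 "\<lambda>xs. 1" "\<lambda>zs. zs ! 1 * c" "\<lambda>xs. xs ! 0"] pr_const[of 1 1] pr_proj[of 0 1]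
    by (simp add: U_def)
  show "(m, j, a, b) \<in> set (srules s) \<Longrightarrow> U a"
    by (cases s rule: srules.cases) (auto simp: test_rules_def intro: U_const U_mult pow)
qed

text \<open>Codes with quotient 0 count as halting by decree; they are exactly the base points
  \<open>[0..<S]\<close>.\<close>

definition good :: "nat \<Rightarrow> int \<Rightarrow> bool" where
  "good x i \<longleftrightarrow> i div int S = 0 \<or> halts x bd (cfg i)"

lemma good_code: "s \<in> Q \<Longrightarrow> good x (int S * q + int (idx s)) \<longleftrightarrow> q = 0 \<or> halts x bd (s, sg q)"
  by (simp add: good_def code)

lemma halts_None: "halts x bd (None, \<sigma>)"
  unfolding halts_def by (rule exI[of _ 0]) simp

lemma None_Q: "None \<in> Q"
  by (simp add: Q_def)

lemma rule_good:
  assumes "(m, j, a, b) \<in> set all_rules"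
  shows "good x (int m * z + int j) \<longleftrightarrow> good x (int (a x) * z + int b)"
proof -
  obtain s where s: "s \<in> Q" "(m, j, a, b) \<in> set (srules s)" using assms by (auto simp: set_all_rules)
  show ?thesis
  proof (cases "s = None")
    case True
    then have "int m * z + int j = int S * z + int (idx None)" "int (a x) * z + int b = int S * (z + 1) + int (idx None)"
      using s(2) by (auto simp: algebra_simps)
    then show ?thesis by (simp only: good_code[OF None_Q] halts_None simp_thms)
  next
    case False
    from srules_sem[OF s(1) False s(2), of x] obtain q q' s' where
      "int m * z + int j = int S * q + int (idx s)" "int (a x) * z + int b = int S * q' + int (idx s')" "s' \<in> Q"
      "q = 0 \<longleftrightarrow> q' = 0" "q \<noteq> 0 \<Longrightarrow> step x bd (s, sg q) = (s', sg q')"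
      unfolding sem_def by blast
    then show ?thesis using good_code[OF s(1)] good_code[of s'] halts_step by metis
  qed
qed

lemma inst_mem: "(m, j, a', b) \<in> set (inst x all_rules) \<longleftrightarrow> (\<exists>a. a' = a x \<and> (m, j, a, b) \<in> set all_rules)"
  by (force simp: inst_def)

lemma reach_good: "i \<in> reach (inst x all_rules) [0..<S] \<Longrightarrow> good x i"
proof (induction rule: reach.induct)
  case (reach_base s)
  then show ?case by (simp add: good_def)
next
  case (reach_fwd m j a b z)
  then show ?case using rule_good by (auto simp: inst_mem)
next
  case (reach_bwd m j a b z)
  then show ?case using rule_good by (auto simp: inst_mem)
qed

lemma reach_base': "s \<in> Q \<Longrightarrow> int S * 0 + int (idx s) \<in> reach (inst x all_rules) [0..<S]"
  using reach_base[of "idx s" "[0..<S]"] idx_less by simp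

lemma reach_None: "int S * q + int (idx None) \<in> reach (inst x all_rules) [0..<S]"
proof (induction q rule: int_induct[of _ 0])
  case base
  show ?case by (rule reach_base'[OF None_Q])
next
  have r: "(S, idx None, S, idx None + S) \<in> set (inst x all_rules)"
    unfolding inst_mem set_all_rules using None_Q by (auto intro!: exI[of _ "\<lambda>_. S"] bexI[of _ None])
  {
    case (step1 q)
    have "int S * q + int (idx None + S) \<in> reach (inst x all_rules) [0..<S]"
      using reach_fwd[OF r] step1 by blast
    then show ?case by (simp add: algebra_simps)
  next
    case (step2 q)
    have "int S * (q - 1) + int (idx None + S) \<in> reach (inst x all_rules) [0..<S]"
      using step2 by (simp add: algebra_simps)
    then show ?case using reach_bwd[OF r] by blast
  }
qed

text \<open>The halting computation is followed backwards: each code is an instance of the left side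
  of a rule, and reachability of the right side is pulled back.\<close>

lemma good_reach: "s \<in> Q \<Longrightarrow> q = 0 \<or> fst ((step x bd ^^ n) (s, sg q)) = None \<Longrightarrow>
  int S * q + int (idx s) \<in> reach (inst x all_rules) [0..<S]"
proof (induction n arbitrary: s q)
  case 0
  then show ?case using reach_base'[of s x] reach_None by auto
next
  case (Suc n)
  show ?case
  proof (cases "q = 0 \<or> s = None")
    case True
    then show ?thesis using reach_base'[OF Suc.prems(1), of x] reach_None by auto
  next
    case False
    obtain m j a b z where r: "(m, j, a, b) \<in> set (srules s)" "int S * q + int (idx s) = int m * z + int j"
      using srules_cover[OF Suc.prems(1)] by blast
    from srules_sem[OF Suc.prems(1) _ r(1), of x] False obtain q1 q' s' where q':
      "int m * z + int j = int S * q1 + int (idx s)" "int (a x) * z + int b = int S * q' + int (idx s')" "s' \<in> Q"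
      "q1 \<noteq> 0 \<longrightarrow> step x bd (s, sg q1) = (s', sg q')"
      unfolding sem_def by blast
    have "q1 = q" using r(2) q'(1) S_pos by simp
    then have "step x bd (s, sg q) = (s', sg q')" using q'(4) False by simp
    then have "fst ((step x bd ^^ n) (s', sg q')) = None"
      using Suc.prems(2) False by (simp only: funpow_Suc_right comp_apply) blast
    then have "int (a x) * z + int b \<in> reach (inst x all_rules) [0..<S]"
      using Suc.IH[OF q'(3)] q'(2) by simp
    moreover have "(m, j, a x, b) \<in> set (inst x all_rules)"
      unfolding inst_mem set_all_rules using r(1) Suc.prems(1) by blast
    ultimately show ?thesis using reach_bwd r(2) by simp
  qed
qed

lemma reach_iff: "i \<in> reach (inst x all_rules) [0..<S] \<longleftrightarrow> good x i"
proof
  assume g: "good x i"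
  obtain s where s: "s \<in> Q" "i = int S * (i div int S) + int (idx s)" using decode by blast
  have "i div int S = 0 \<or> halts x bd (s, sg (i div int S))"
    using g good_code[OF s(1), of x "i div int S"] s(2) by simp
  then obtain n where "i div int S = 0 \<or> fst ((step x bd ^^ n) (s, sg (i div int S))) = None"
    by (auto simp: halts_def)
  from good_reach[OF s(1) this] show "i \<in> reach (inst x all_rules) [0..<S]" using s(2) by simp
qed (rule reach_good)

lemma reach_UNIV_iff: "reach (inst x all_rules) [0..<S] = UNIV \<longleftrightarrow> (\<forall>s\<in>Q. \<forall>q. q \<noteq> 0 \<longrightarrow> halts x bd (s, sg q))"
proof -
  have "(\<forall>i. good x i) \<longleftrightarrow> (\<forall>s\<in>Q. \<forall>q. q \<noteq> 0 \<longrightarrow> halts x bd (s, sg q))"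
    using good_code decode by metis
  then show ?thesis using reach_iff by blast
qed

end

theorem rules_exist:
  assumes f: "pr 3 f" and inf: "\<And>x y z z'. f [x, y, z] = 0 \<Longrightarrow> \<exists>z\<ge>z'. f [x, y, z] = 0"
  shows "\<exists>(R :: prule list) bs. (\<forall>(m, j, a, b)\<in>set R. 0 < m \<and> U a \<and> (\<forall>x. 0 < a x)) \<and>
    (\<forall>x. reach (inst x R) bs = UNIV \<longleftrightarrow> (\<forall>y. \<exists>z. f [x, y, z] = 0))"
proof -
  obtain c where c: "wfc c" "\<And>x \<sigma>. run x c \<sigma> 3 = f (map \<sigma> [2, 0, 1])" "\<And>x \<sigma> r. r < 4 \<Longrightarrow> r \<noteq> 3 \<Longrightarrow> run x c \<sigma> r = \<sigma> r"
    by (rule computesE[OF computes_pr[OF f], of "[2, 0, 1]" 4 3]) auto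
  have c2: "run x c \<sigma> 3 = f [\<sigma> 2, \<sigma> 0, \<sigma> 1]" for x \<sigma> using c(2) by simp
  have hi1: "(\<forall>y. \<exists>z. f [x, y, z] = 0) \<longleftrightarrow>
      (\<forall>k \<sigma>. (\<forall>d\<in>set k. wfc d) \<longrightarrow> halts x (loop_body c) (Some k, \<sigma>))" for x
    by (rule halts_iff(1)) (fact c(1), fact c2, erule (1) c(3), erule inf)
  have hi2: "\<not> halts x (loop_body c) (Some [], \<sigma>)" if "\<forall>z. f [x, y, z] \<noteq> 0" "\<sigma> 0 = y" "\<sigma> 3 \<noteq> 0" for x y \<sigma>
    by (rule halts_iff(2)[where f = f]) (fact c(1), fact c2, erule (1) c(3), erule inf, fact+)
  interpret machine "loop_body c" by unfold_locales (use c(1) in \<open>simp add: loop_body_def\<close>)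
  have "reach (inst x all_rules) [0..<S] = UNIV \<longleftrightarrow> (\<forall>y. \<exists>z. f [x, y, z] = 0)" for x
  proof
    assume U: "reach (inst x all_rules) [0..<S] = UNIV"
    show "\<forall>y. \<exists>z. f [x, y, z] = 0"
    proof (rule ccontr)
      assume "\<not> (\<forall>y. \<exists>z. f [x, y, z] = 0)"
      then obtain y where y: "\<forall>z. f [x, y, z] \<noteq> 0" by metis
      \<comment> \<open>A store with register 0 equal to y and register 3 positive, so that the
        search for y starts instead of stopping at once.\<close>
      define q where "q = int (pn 3) * (int (pn 0) ^ y * 1)"
      have nz: "int (pn r) ^ k \<noteq> 0" for r k using prime_pn[of r] by auto
      have one: "sg 1 = (\<lambda>r. 0)" by (simp add: sg_def fun_eq_iff)
      have "sg q = (sg (int (pn 0) ^ y * 1))(3 := Suc (sg (int (pn 0) ^ y * 1) 3))"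
        unfolding q_def by (rule sg_mult) (use nz[of 0 y] in simp)
      then have "sg q 0 = y" "sg q 3 \<noteq> 0" using sg_power[of 1 0 y] by (simp_all add: one)
      then have "\<not> halts x (loop_body c) (Some [], sg q)" using hi2[of x y] y by blast
      moreover have "q \<noteq> 0" using nz[of 3 1] nz[of 0 y] by (simp add: q_def)
      ultimately show False using U unfolding reach_UNIV_iff by (auto simp: Q_def)
    qed
  next
    assume "\<forall>y. \<exists>z. f [x, y, z] = 0"
    then have h: "\<And>k \<sigma>. \<forall>d\<in>set k. wfc d \<Longrightarrow> halts x (loop_body c) (Some k, \<sigma>)" using hi1[of x] by blast
    have "halts x (loop_body c) (s, \<sigma>)" if "s \<in> Q" for s \<sigma>
      using that h conts_wfc[OF wf, of "[]"] halts_None by (auto simp: Q_def)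
    then show "reach (inst x all_rules) [0..<S] = UNIV" unfolding reach_UNIV_iff by blast
  qed
  moreover have "\<forall>(m, j, a, b)\<in>set all_rules. 0 < m \<and> U a \<and> (\<forall>x. 0 < a x)"
    unfolding set_all_rules using srules_pos srules_U by blast
  ultimately show ?thesis by blast
qed

section \<open>Presentations of torsion-free groups form a Pi-0-2 set\<close>

definition App :: "nat \<Rightarrow> nat \<Rightarrow> nat \<Rightarrow> bool" where
  "App a b c \<longleftrightarrow> list_decode c = list_decode a @ list_decode b"

lemma sig_App:
  assumes "U F" "U G" "U H" shows "sig (\<lambda>u. App (F u) (G u) (H u))"
proof -
  define T where "T s s' \<longleftrightarrow> (\<exists>a. p1 s' = Suc (pe a (p1 s)) \<and> p2 s' = Suc (pe a (p2 s)))" for s s'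
  have T: "sig (\<lambda>u. T (p1 u) (p2 u))"
    unfolding T_def by (intro sig_ex sig_and sig_eq U_Suc U_pe U_p1 U_p2 U_id)
  have sound: "App (p1 s) b (p2 s)" if "T\<^sup>*\<^sup>* (pe 0 b) s" for b s
    using that by (induction rule: rtranclp_induct) (auto simp: App_def T_def)
  have "T\<^sup>*\<^sup>* (pe 0 b) (pe (list_encode xs) (list_encode (xs @ list_decode b)))" for b xs
  proof (induction xs)
    case (Cons a xs)
    have "T (pe (list_encode xs) (list_encode (xs @ list_decode b))) (pe (list_encode (a # xs)) (list_encode ((a # xs) @ list_decode b)))"
      by (auto simp: T_def)
    with Cons show ?case by (rule rtranclp.rtrancl_into_rtrancl)
  qed simp
  then have "T\<^sup>*\<^sup>* (pe 0 b) (pe a c)" if "App a b c" for a b c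
    using that unfolding App_def by (metis list_decode_inverse)
  with sound have "App a b c \<longleftrightarrow> T\<^sup>*\<^sup>* (pe 0 b) (pe a c)" for a b c
    by (metis prod_encode_inverse fst_conv snd_conv)
  moreover have "sig (\<lambda>u. T\<^sup>*\<^sup>* (pe 0 (G u)) (pe (F u) (H u)))"
    by (intro sig_rtranclp[OF T] U_pe U_const assms)
  ultimately show ?thesis by presburger
qed

definition dw :: "nat \<Rightarrow> int list" where "dw w = map int_decode (list_decode w)"
definition dR :: "nat \<Rightarrow> int list list" where "dR c = map dw (list_decode c)"
definition ew :: "int list \<Rightarrow> nat" where "ew w = list_encode (map int_encode w)"

lemma dw_ew [simp]: "dw (ew w) = w" and ew_dw [simp]: "ew (dw c) = c"
  by (simp_all add: dw_def ew_def map_idI)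

lemma dw_inj: "dw a = dw b \<longleftrightarrow> a = b"
  by (metis ew_dw)

lemma App_dw: "App a b c \<longleftrightarrow> dw c = dw a @ dw b"
proof -
  have "App a b c \<longleftrightarrow> map int_decode (list_decode c) = map int_decode (list_decode a @ list_decode b)"
    unfolding App_def by (simp only: inj_map_eq_map[OF inj_int_decode])
  then show ?thesis by (simp add: dw_def)
qed

lemma App_dR: "App a b c \<longleftrightarrow> dR c = dR a @ dR b"
proof -
  have "inj dw" by (simp add: inj_def dw_inj)
  then have "App a b c \<longleftrightarrow> map dw (list_decode c) = map dw (list_decode a @ list_decode b)"
    unfolding App_def by (simp only: inj_map_eq_map)
  then show ?thesis by (simp add: dR_def)
qed

lemma dw_Cons: "dw (Suc (pe a w)) = int_decode a # dw w" and dw_0: "dw 0 = []"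
  by (simp_all add: dw_def)

lemma dR_Cons: "dR (Suc (pe r c)) = dw r # dR c"
  by (simp add: dR_def)

lemma dR_surj: "\<exists>c. dR c = R"
  by (rule exI[of _ "list_encode (map ew R)"]) (simp add: dR_def map_idI)

lemma int_decode_eq: "int_decode c = (if even c then int (c div 2) else - int (c div 2) - 1)"
  by (simp add: int_decode_def sum_decode_def)

text \<open>The integers 0, -1, 1, -2, 2 have codes 0, 1, 2, 3, 4, and so on: negation swaps 2k + 1
  and 2k + 2.\<close>

definition Neg :: "nat \<Rightarrow> nat \<Rightarrow> bool" where
  "Neg a b \<longleftrightarrow> (a = 0 \<and> b = 0) \<or> (\<exists>k. (a = Suc (k + k) \<and> b = Suc (Suc (k + k))) \<or> (b = Suc (k + k) \<and> a = Suc (Suc (k + k))))"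

lemma Neg_iff: "Neg a b \<longleftrightarrow> int_decode b = - int_decode a"
proof
  show "Neg a b \<Longrightarrow> int_decode b = - int_decode a"
    by (auto simp: Neg_def int_decode_eq)
  have ex: "\<exists>b. Neg a b" for a
  proof -
    have "a = 0 \<or> a = Suc ((a - 1) div 2 + (a - 1) div 2) \<or> a = Suc (Suc ((a - 1) div 2 + (a - 1) div 2))"
      by presburger
    then show ?thesis unfolding Neg_def by metis
  qed
  assume *: "int_decode b = - int_decode a"
  obtain b' where b': "Neg a b'" using ex by blast
  then have "int_decode b' = int_decode b" using * by (auto simp: Neg_def int_decode_eq)
  then have "b' = b" by (metis int_decode_inverse)
  with b' show "Neg a b" by simp
qed

lemma sig_Neg: "U F \<Longrightarrow> U G \<Longrightarrow> sig (\<lambda>u. Neg (F u) (G u))"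
proof -
  have "sig (\<lambda>u. Neg (p1 u) (p2 u))"
    unfolding Neg_def by (intro sig_or sig_and sig_ex sig_eq U_Suc U_add U_p1 U_p2 U_const U_id)
  then show "U F \<Longrightarrow> U G \<Longrightarrow> sig (\<lambda>u. Neg (F u) (G u))"
    using sig_comp[of _ "\<lambda>u. pe (F u) (G u)", OF _ U_pe] by fastforce
qed

definition Mid :: "nat \<Rightarrow> nat \<Rightarrow> bool" where
  "Mid c m \<longleftrightarrow> (\<exists>a b. m = Suc (pe a (Suc (pe b 0))) \<and> Neg a b) \<or> (\<exists>p q. App p (Suc (pe m q)) c)"

lemma Mid_iff: "Mid c m \<longleftrightarrow> (\<exists>a. dw m = [a, - a]) \<or> dw m \<in> set (dR c)"
proof -
  have "(\<exists>a b. m = Suc (pe a (Suc (pe b 0))) \<and> Neg a b) \<longleftrightarrow> (\<exists>a. dw m = [a, - a])" (is "?A \<longleftrightarrow> ?B")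
  proof
    show "?A \<Longrightarrow> ?B" by (auto simp: dw_Cons dw_0 Neg_iff)
    assume ?B
    then obtain a where "dw m = [a, - a]" by blast
    then have "dw m = dw (Suc (pe (int_encode a) (Suc (pe (int_encode (- a)) 0))))" by (simp add: dw_Cons dw_0)
    then show ?A unfolding dw_inj by (auto simp: Neg_iff)
  qed
  moreover have "(\<exists>p q. App p (Suc (pe m q)) c) \<longleftrightarrow> dw m \<in> set (dR c)"
    unfolding App_dR dR_Cons by (metis dR_surj in_set_conv_decomp)
  ultimately show ?thesis by (simp add: Mid_def)
qed

definition Ins :: "nat \<Rightarrow> nat \<Rightarrow> nat \<Rightarrow> bool" where
  "Ins c w w' \<longleftrightarrow> (\<exists>u v m t. App u v w \<and> App m v t \<and> App u t w' \<and> Mid c m)"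

lemma Ins_iff: "Ins c w w' \<longleftrightarrow> (\<exists>u v m. dw w = u @ v \<and> dw w' = u @ m @ v \<and> ((\<exists>a. m = [a, - a]) \<or> m \<in> set (dR c)))"
proof
  show "Ins c w w' \<Longrightarrow> \<exists>u v m. dw w = u @ v \<and> dw w' = u @ m @ v \<and> ((\<exists>a. m = [a, - a]) \<or> m \<in> set (dR c))"
    unfolding Ins_def App_dw Mid_iff by metis
  assume "\<exists>u v m. dw w = u @ v \<and> dw w' = u @ m @ v \<and> ((\<exists>a. m = [a, - a]) \<or> m \<in> set (dR c))"
  then obtain u v m where "dw w = u @ v" "dw w' = u @ m @ v" "(\<exists>a. m = [a, - a]) \<or> m \<in> set (dR c)" by blast
  then show "Ins c w w'"
    unfolding Ins_def App_dw Mid_iff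
    by (intro exI[of _ "ew u"] exI[of _ "ew v"] exI[of _ "ew m"] exI[of _ "ew (m @ v)"]) simp
qed

lemma sig_Ins: "U C \<Longrightarrow> U F \<Longrightarrow> U G \<Longrightarrow> sig (\<lambda>u. Ins (C u) (F u) (G u))"
proof -
  have "sig (\<lambda>u. Ins (p1 u) (p1 (p2 u)) (p2 (p2 u)))"
    unfolding Ins_def Mid_def
    by (intro sig_ex sig_and sig_or sig_App sig_Neg sig_eq U_Suc U_pe U_p1 U_p2 U_const U_id)
  then show "U C \<Longrightarrow> U F \<Longrightarrow> U G \<Longrightarrow> sig (\<lambda>u. Ins (C u) (F u) (G u))"
    using sig_comp[of _ "\<lambda>u. pe (C u) (pe (F u) (G u))", OF _ U_pe[OF _ U_pe]] by fastforce
qed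

text \<open>Equality in the group is reachability by single insertions and deletions of cancelling
  pairs or relators.\<close>

lemma sig_word_eq:
  assumes "U C" "U F" "U G" shows "sig (\<lambda>u. word_eq (dR (C u)) (dw (F u)) (dw (G u)))"
proof -
  define T where "T s s' \<longleftrightarrow> p1 s' = p1 s \<and> (Ins (p1 s) (p2 s) (p2 s') \<or> Ins (p1 s) (p2 s') (p2 s))" for s s'
  have T: "sig (\<lambda>u. T (p1 u) (p2 u))"
    unfolding T_def by (intro sig_and sig_or sig_Ins sig_eq U_p1 U_p2 U_id)
  have Ins_word_eq: "word_eq (dR c) (dw w') (dw w)" if "Ins c w w'" for c w w'
    using that unfolding Ins_iff by (auto intro: we_cancel we_rel simp del: append_Cons)
  have sound: "p1 s = c \<and> word_eq (dR c) (dw w) (dw (p2 s))" if "T\<^sup>*\<^sup>* (pe c w) s" for c w s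
    using that
  proof (induction rule: rtranclp_induct)
    case (step s s')
    then show ?case unfolding T_def using Ins_word_eq by (metis we_sym we_trans)
  qed (simp add: we_refl)
  have symT: "T s s' \<Longrightarrow> T s' s" for s s' by (auto simp: T_def)
  have symT': "T\<^sup>*\<^sup>* s' s" if "T\<^sup>*\<^sup>* s s'" for s s'
    using that by (induction rule: rtranclp_induct) (auto intro: symT converse_rtranclp_into_rtranclp)
  have complete: "T\<^sup>*\<^sup>* (pe c (ew u)) (pe c (ew v))" if "word_eq (dR c) u v" for c u v
    using that
  proof (induction rule: word_eq.induct)
    case (we_cancel u a v)
    have "Ins c (ew (u @ v)) (ew (u @ [a, - a] @ v))" unfolding Ins_iff by fastforce
    then have "T (pe c (ew (u @ [a, - a] @ v))) (pe c (ew (u @ v)))" by (simp add: T_def)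
    then show ?case by blast
  next
    case (we_rel r u v)
    then have "Ins c (ew (u @ v)) (ew (u @ r @ v))" unfolding Ins_iff by fastforce
    then have "T (pe c (ew (u @ r @ v))) (pe c (ew (u @ v)))" by (simp add: T_def)
    then show ?case by blast
  qed (auto intro: symT' rtranclp_trans)
  have "word_eq (dR c) (dw w) (dw w') \<longleftrightarrow> T\<^sup>*\<^sup>* (pe c w) (pe c w')" for c w w'
    using sound[of c w "pe c w'"] complete[of c "dw w" "dw w'"] by auto
  moreover have "sig (\<lambda>u. T\<^sup>*\<^sup>* (pe (C u) (F u)) (pe (C u) (G u)))"
    by (intro sig_rtranclp[OF T] U_pe assms)
  ultimately show ?thesis by presburger
qed

text \<open>The letters for n generators have exactly the codes 1 to 2n.\<close>

definition bad :: "nat \<Rightarrow> nat \<Rightarrow> bool" where "bad n c \<longleftrightarrow> c = 0 \<or> c - (n + n) \<noteq> 0"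

lemma bad_iff: "bad n c \<longleftrightarrow> \<not> (int_decode c \<noteq> 0 \<and> \<bar>int_decode c\<bar> \<le> int n)"
  by (auto simp: bad_def int_decode_eq elim!: evenE oddE)

lemma sig_valid_word:
  assumes "U N" "U F" shows "sig (\<lambda>u. valid_word (N u) (dw (F u)))"
proof -
  define T where "T s s' \<longleftrightarrow> p1 s' = p1 s \<and> (\<exists>c. (c \<noteq> 0 \<and> c - (p1 s + p1 s) = 0) \<and> p2 s' = Suc (pe c (p2 s)))" for s s'
  have T: "sig (\<lambda>u. T (p1 u) (p2 u))"
    unfolding T_def by (intro sig_ex sig_and sig_eq sig_nz U_Suc U_diff U_add U_pe U_p1 U_p2 U_const U_id)
  have ok: "c \<noteq> 0 \<and> c - (n + n) = 0 \<longleftrightarrow> int_decode c \<noteq> 0 \<and> \<bar>int_decode c\<bar> \<le> int n" for n c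
    using bad_iff[of n c] by (auto simp: bad_def)
  have sound: "p1 s = n \<and> valid_word n (dw (p2 s))" if "T\<^sup>*\<^sup>* (pe n 0) s" for n s
    using that
  proof (induction rule: rtranclp_induct)
    case (step s s')
    then show ?case unfolding T_def ok by (auto simp: dw_Cons valid_word_def)
  qed (simp add: valid_word_def dw_0)
  have complete: "T\<^sup>*\<^sup>* (pe n 0) (pe n (ew w))" if "valid_word n w" for n w
    using that
  proof (induction w)
    case (Cons a w)
    then have "T (pe n (ew w)) (pe n (ew (a # w)))"
      unfolding T_def ok by (intro conjI exI[of _ "int_encode a"]) (auto simp: valid_word_def ew_def)
    moreover have "T\<^sup>*\<^sup>* (pe n 0) (pe n (ew w))" using Cons by (simp add: valid_word_def)
    ultimately show ?case by simp
  qed (simp add: ew_def)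
  have "valid_word n (dw w) \<longleftrightarrow> T\<^sup>*\<^sup>* (pe n 0) (pe n w)" for n w
    using sound[of n "pe n w"] complete[of n "dw w"] by auto
  moreover have "sig (\<lambda>u. T\<^sup>*\<^sup>* (pe (N u) 0) (pe (N u) (F u)))"
    by (intro sig_rtranclp[OF T] U_pe U_const assms)
  ultimately show ?thesis by presburger
qed

lemma sig_invalid:
  assumes "U N" "U C" shows "sig (\<lambda>u. \<not> valid_pres (N u) (dR (C u)))"
proof -
  have "\<not> valid_pres n (dR c) \<longleftrightarrow> (\<exists>p q r r1 r2 a. App p (Suc (pe r q)) c \<and> App r1 (Suc (pe a r2)) r \<and> (a = 0 \<or> a - (n + n) \<noteq> 0))" for n c
  proof -
    have 1: "r \<in> set (dR c) \<longleftrightarrow> (\<exists>p q. App p (Suc (pe (ew r) q)) c)" for r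
      unfolding App_dR dR_Cons dw_ew by (metis dR_surj in_set_conv_decomp)
    have 2: "int_decode a \<in> set (dw r) \<longleftrightarrow> (\<exists>r1 r2. App r1 (Suc (pe a r2)) r)" for a r
      unfolding App_dw dw_Cons by (metis dw_ew in_set_conv_decomp)
    have "\<not> valid_pres n (dR c) \<longleftrightarrow> (\<exists>r\<in>set (dR c). \<exists>a\<in>set r. \<not> (a \<noteq> 0 \<and> \<bar>a\<bar> \<le> int n))"
      by (auto simp: valid_pres_def valid_word_def)
    also have "\<dots> \<longleftrightarrow> (\<exists>r a. dw r \<in> set (dR c) \<and> int_decode a \<in> set (dw r) \<and> bad n a)"
      unfolding bad_iff by (metis dw_ew int_encode_inverse)
    also have "\<dots> \<longleftrightarrow> (\<exists>r a. (\<exists>p q. App p (Suc (pe r q)) c) \<and> (\<exists>r1 r2. App r1 (Suc (pe a r2)) r) \<and> bad n a)"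
      by (simp only: 1 2 ew_dw)
    finally show ?thesis unfolding bad_def by blast
  qed
  moreover have "sig (\<lambda>u. \<exists>p q r r1 r2 a. App p (Suc (pe r q)) (C u) \<and> App r1 (Suc (pe a r2)) r \<and> (a = 0 \<or> a - (N u + N u) \<noteq> 0))"
    by (intro sig_ex sig_and sig_or sig_App sig_eq sig_nz U_Suc U_pe U_diff U_add
        U_comp[OF assms(1)] U_comp[OF assms(2)] U_p1 U_p2 U_const U_id)
  ultimately show ?thesis by presburger
qed

lemma sig_power:
  assumes "U K" "U F" "U G" shows "sig (\<lambda>u. dw (G u) = concat (replicate (K u) (dw (F u))))"
proof -
  define T where "T s s' \<longleftrightarrow> p1 s' = p1 s \<and> p1 (p2 s') = Suc (p1 (p2 s)) \<and> App (p1 s) (p2 (p2 s)) (p2 (p2 s'))" for s s'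
  have T: "sig (\<lambda>u. T (p1 u) (p2 u))"
    unfolding T_def by (intro sig_and sig_eq sig_App U_Suc U_p1 U_p2 U_id)
  have sound: "p1 s = w \<and> dw (p2 (p2 s)) = concat (replicate (p1 (p2 s)) (dw w))" if "T\<^sup>*\<^sup>* (pe w (pe 0 0)) s" for w s
    using that
  proof (induction rule: rtranclp_induct)
    case (step s s')
    then show ?case unfolding T_def App_dw by simp
  qed (simp add: dw_0)
  have complete: "T\<^sup>*\<^sup>* (pe w (pe 0 0)) (pe w (pe k (ew (concat (replicate k (dw w))))))" for w k
  proof (induction k)
    case (Suc k)
    have "T (pe w (pe k (ew (concat (replicate k (dw w)))))) (pe w (pe (Suc k) (ew (concat (replicate (Suc k) (dw w))))))"
      by (simp add: T_def App_dw)
    with Suc show ?case by (rule rtranclp.rtrancl_into_rtrancl)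
  qed (simp add: ew_def)
  have "dw v = concat (replicate k (dw w)) \<longleftrightarrow> T\<^sup>*\<^sup>* (pe w (pe 0 0)) (pe w (pe k v))" for v k w
    using sound[of w "pe w (pe k v)"] complete[of w k] by (metis ew_dw prod_encode_inverse fst_conv snd_conv)
  moreover have "sig (\<lambda>u. T\<^sup>*\<^sup>* (pe (F u) (pe 0 0)) (pe (F u) (pe (K u) (G u))))"
    by (intro sig_rtranclp[OF T] U_pe U_const assms)
  ultimately show ?thesis by presburger
qed

lemma code_pres_dR: "code_pres (p1 x) (dR (p2 x)) = x"
  using ew_dw by (simp add: code_pres_def dR_def comp_def flip: ew_def)

lemma code_pres_inj: "code_pres n R = code_pres n' R' \<Longrightarrow> n = n' \<and> R = R'"
proof -
  assume "code_pres n R = code_pres n' R'"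
  then have n: "n = n'" and "list_encode (map ew R) = list_encode (map ew R')"
    by (simp_all add: code_pres_def ew_def[abs_def])
  then have "map dw (map ew R) = map dw (map ew R')" by (metis list_encode_inverse)
  with n show ?thesis by (simp add: map_idI)
qed

lemma tf_presentations_iff:
  "code_pres n R \<in> tf_presentations A \<longleftrightarrow> valid_pres n R \<and> A_torsion_free_pres A n R"
  unfolding tf_presentations_def using code_pres_inj by blast

theorem tf_presentations_Pi02:
  assumes "r_e A"
  shows "Pi02 (tf_presentations A)"
proof -
  \<comment> \<open>The value y = 0 carries validity of the presentation: there \<open>?Q\<close> is
    false, so \<open>?P\<close>, which is invalidity, must fail. Every other y codes a word with an
    exponent. All conditions on the left, including k in \<open>A\<close>, occur positively and are
    recursively enumerable.\<close>
  let ?P = "\<lambda>u. (p2 u = 0 \<and> \<not> valid_pres (p1 (p1 u)) (dR (p2 (p1 u)))) \<or>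
     (\<exists>w k v. p2 u = Suc (pe w k) \<and> valid_word (p1 (p1 u)) (dw w) \<and> k \<in> A \<and>
        dw v = concat (replicate k (dw w)) \<and> word_eq (dR (p2 (p1 u))) (dw v) (dw 0))"
  let ?Q = "\<lambda>u. \<exists>w k. p2 u = Suc (pe w k) \<and> word_eq (dR (p2 (p1 u))) (dw w) (dw 0)"
  show ?thesis
  proof (rule Pi02I)
    show "sig ?P"
      by (intro sig_or sig_and sig_ex sig_eq sig_invalid sig_valid_word sig_power sig_word_eq
          sig_comp[OF r_e_sig[OF assms]] U_Suc U_pe U_p1 U_p2 U_const U_id)
    show "sig ?Q"
      by (intro sig_and sig_ex sig_eq sig_word_eq U_Suc U_pe U_p1 U_p2 U_const U_id)
    fix x
    let ?n = "p1 x" and ?R = "dR (p2 x)"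
    have "x \<in> tf_presentations A \<longleftrightarrow> valid_pres ?n ?R \<and> A_torsion_free_pres A ?n ?R"
      using tf_presentations_iff[of ?n ?R A] by (simp add: code_pres_dR)
    also have "A_torsion_free_pres A ?n ?R \<longleftrightarrow> (\<forall>w k v. valid_word ?n (dw w) \<longrightarrow> k \<in> A \<longrightarrow>
        dw v = concat (replicate k (dw w)) \<longrightarrow> word_eq ?R (dw v) [] \<longrightarrow> word_eq ?R (dw w) [])"
      unfolding A_torsion_free_pres_def by (metis dw_ew)
    finally have x: "x \<in> tf_presentations A \<longleftrightarrow> valid_pres ?n ?R \<and> (\<forall>w k v. valid_word ?n (dw w) \<longrightarrow> k \<in> A \<longrightarrow>
        dw v = concat (replicate k (dw w)) \<longrightarrow> word_eq ?R (dw v) [] \<longrightarrow> word_eq ?R (dw w) [])" .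
    have "(\<forall>y. Z y) \<longleftrightarrow> Z 0 \<and> (\<forall>w k. Z (Suc (pe w k)))" for Z
      by (metis nat.exhaust prod_decode_inverse surj_pair)
    note split = this[of "\<lambda>y. ?P (pe x y) \<longrightarrow> ?Q (pe x y)"]
    have P0: "?P (pe x 0) \<longleftrightarrow> \<not> valid_pres ?n ?R" and Q0: "\<not> ?Q (pe x 0)"
      by simp_all
    have PS: "?P (pe x (Suc (pe w k))) \<longleftrightarrow> (\<exists>v. valid_word ?n (dw w) \<and> k \<in> A \<and>
        dw v = concat (replicate k (dw w)) \<and> word_eq ?R (dw v) [])" for w k
      by (simp add: dw_0)
    have QS: "?Q (pe x (Suc (pe w k))) \<longleftrightarrow> word_eq ?R (dw w) []" for w k
      by (simp add: dw_0)
    show "x \<in> tf_presentations A \<longleftrightarrow> (\<forall>y. ?P (pe x y) \<longrightarrow> ?Q (pe x y))"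
      unfolding split x PS QS P0 using Q0 by meson
  qed
qed

section \<open>Computing the presentations\<close>

definition Uw :: "(nat \<Rightarrow> int list) \<Rightarrow> bool" where "Uw w \<longleftrightarrow> U (\<lambda>x. ew (w x))"
definition Ul :: "(nat \<Rightarrow> int list list) \<Rightarrow> bool" where "Ul W \<longleftrightarrow> U (\<lambda>x. list_encode (map ew (W x)))"

lemma Uw_append: "Uw w \<Longrightarrow> Uw (\<lambda>x. c @ w x)"
  by (induction c) (simp_all add: Uw_def ew_def U_Suc U_pe U_const)

lemma Uw_replicate: assumes "U f" shows "Uw (\<lambda>x. replicate (f x) a)"
proof -
  have "ew (replicate k a) = ((\<lambda>u. Suc (pe (int_encode a) u)) ^^ k) 0" for k
    by (induction k) (simp_all add: ew_def)
  then show ?thesis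
    unfolding Uw_def by (simp only:) (intro U_iter U_Suc U_pe U_const U_id assms)
qed

lemma Ul_Cons: "Uw w \<Longrightarrow> Ul W \<Longrightarrow> Ul (\<lambda>x. w x # W x)"
  by (simp add: Uw_def Ul_def U_Suc U_pe)

lemma Ul_const: "Ul (\<lambda>x. C)"
  by (simp add: Ul_def U_const)

text \<open>Of the relators only one per rule varies with the input, and there the varying part is a
  final block of letters -1 of length \<open>a x\<close>. Everything else is a constant
  word.\<close>

lemma Ul_rels_K:
  assumes R: "\<forall>(m, j, a, b)\<in>set R. 0 < m \<and> U a \<and> (\<forall>x. 0 < a x)" and W: "Ul W"
  shows "Ul (\<lambda>x. rels_K (inst x R) @ W x)"
proof -
  let ?f = "\<lambda>x i. map (\<lambda>(a, b). hrel (rl i) a b) (rule_pairs (inst x R ! i))"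
  have "Ul (\<lambda>x. concat (map (?f x) is) @ W x)" if "set is \<subseteq> {..<length R}" for "is"
    using that
  proof (induction "is")
    case (Cons i "is")
    obtain m j a b where mj: "R ! i = (m, j, a, b)" by (cases "R ! i")
    have i: "i < length R" using Cons.prems by simp
    then have a: "U a" using R nth_mem[OF i] mj by auto
    have "?f x i = [([rl i] @ xp (int m) @ [- rl i]) @ replicate (a x) (- 1), hrel (rl i) (tw (int j)) (tw (int b))]" for x
      using i by (simp add: inst_def mj hrel_def winv_def xp_def)
    moreover have "Uw (\<lambda>x. ([rl i] @ xp (int m) @ [- rl i]) @ replicate (a x) (- 1))"
      by (intro Uw_append Uw_replicate a)
    moreover have "Uw (\<lambda>x. hrel (rl i) (tw (int j)) (tw (int b)))" by (simp add: Uw_def U_const)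
    moreover have "Ul (\<lambda>x. concat (map (?f x) is) @ W x)" using Cons by simp
    ultimately show ?case by (simp add: Ul_Cons)
  qed (use W in simp)
  from this[of "[0..<length R]"] show ?thesis by (simp add: rels_K_def inst_def atLeast0LessThan)
qed

lemma computable_pres:
  assumes R: "\<forall>(m, j, a, b)\<in>set R. 0 < m \<and> U a \<and> (\<forall>x. 0 < a x)"
  shows "computable (\<lambda>x. code_pres (pres_gens (inst x R)) (pres (inst x R) bs n))"
proof (rule U_computable)
  have len: "length (inst x R) = length R" for x by (simp add: inst_def)
  have "Ul (\<lambda>x. pres (inst x R) bs n)"
    unfolding pres_def rels_P_def append_assoc
    by (rule Ul_rels_K[OF R]) (simp add: gens_L_def letters_P_def len Ul_const)
  then show "U (\<lambda>x. code_pres (pres_gens (inst x R)) (pres (inst x R) bs n))"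
    unfolding code_pres_def pres_gens_def len Ul_def ew_def by (intro U_pe U_const)
qed

theorem tf_presentations_hard:
  assumes A: "A \<noteq> {}" "\<forall>k\<in>A. 2 \<le> k"
  shows "Pi02_hard (tf_presentations A)"
  unfolding Pi02_hard_def
proof (intro allI impI)
  fix X assume X: "Pi02 X"
  obtain f where f: "U f" "\<And>x. x \<in> X \<longleftrightarrow> (\<forall>y. \<exists>z. f (pe (pe x y) z) = 0)"
    by (rule Pi02_sig[OF X]) blast
  obtain n where n: "n \<in> A" using A by blast
  \<comment> \<open>Only the first component of the search variable matters, so each zero recurs at
    arbitrarily large values, as \<open>rules_exist\<close> requires.\<close>
  define F where "F xs = f (pe (pe (xs ! 0) (xs ! 1)) (p1 (xs ! 2)))" for xs
  have a: "pr 3 (\<lambda>xs. xs ! 0)" "pr 3 (\<lambda>xs. xs ! 1)" "pr 3 (\<lambda>xs. xs ! 2)" by (auto intro: pr_proj)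
  have F: "pr 3 F" unfolding F_def by (intro U_pr[OF f(1)] pr_pe pr_p1 a)
  have F_eq: "F [x, y, z] = f (pe (pe x y) (p1 z))" for x y z by (simp add: F_def)
  have inf: "\<exists>z\<ge>z'. F [x, y, z] = 0" if "F [x, y, z] = 0" for x y z z'
    using that le_prod_encode_2[of z' "p1 z"] by (intro exI[of _ "pe (p1 z) z'"]) (simp add: F_eq)
  have "\<exists>R bs. (\<forall>(m, j, a, b)\<in>set R. 0 < m \<and> U a \<and> (\<forall>x. 0 < a x)) \<and>
      (\<forall>x. reach (inst x R) bs = UNIV \<longleftrightarrow> (\<forall>y. \<exists>z. F [x, y, z] = 0))"
    by (rule rules_exist[OF F]) (rule inf)
  then obtain R bs where R: "\<forall>(m, j, a, b)\<in>set R. 0 < m \<and> U a \<and> (\<forall>x. 0 < a x)"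
    "\<And>x. reach (inst x R) bs = UNIV \<longleftrightarrow> (\<forall>y. \<exists>z. F [x, y, z] = 0)"
    by blast
  have "x \<in> X \<longleftrightarrow> code_pres (pres_gens (inst x R)) (pres (inst x R) bs n) \<in> tf_presentations A" for x
  proof -
    have pos: "0 < m \<and> 0 < a" if "(m, j, a, b) \<in> set (inst x R)" for m j a b
      using that R(1) by (auto simp: inst_def)
    have "x \<in> X \<longleftrightarrow> reach (inst x R) bs = UNIV"
      unfolding f(2) R(2) F_eq by (metis prod_encode_inverse fst_conv)
    moreover have "valid_pres (pres_gens (inst x R)) (pres (inst x R) bs n)"
      by (rule pres_A_torsion_free_iff(1)[OF _ A(2) n]) (rule pos)
    moreover have "A_torsion_free_pres A (pres_gens (inst x R)) (pres (inst x R) bs n) \<longleftrightarrow> reach (inst x R) bs = UNIV"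
      by (rule pres_A_torsion_free_iff(2)[OF _ A(2) n]) (rule pos)
    ultimately show ?thesis
      unfolding tf_presentations_iff by blast
  qed
  then show "many_one_reducible X (tf_presentations A)"
    unfolding many_one_reducible_def using computable_pres[OF R(1)] by blast
qed

theorem theorem2p13:
  fixes A :: "nat set"
  assumes "A \<noteq> {}" and "\<forall>k\<in>A. 2 \<le> k"
  shows "Pi02_hard (tf_presentations A) \<and> (r_e A \<longrightarrow> Pi02_complete (tf_presentations A))"
  using tf_presentations_hard[OF assms] tf_presentations_Pi02 by (simp add: Pi02_complete_def)

end
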